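(* Let $G$ be a complex linear algebraic group defined over $\mathbb{R}$, not necessarily Zariski-connected. Let $k\in\mathbb{N}$. Then $P_k:G(\mathbb{R})\to G(\mathbb{R})$ is surjective if and only if $P_k(Z_{G(\mathbb{R})}(u))$ is dense in $Z_{G(\mathbb{R})}(u)$ for every unipotent element $u\in G(\mathbb{R})$.
   Context: $\mathbb{N}$ denotes the positive integers. For a group $H$ and $k\in\mathbb{N}$, $P_k:H\to H$ is the power map $P_k(h)=h^k$. $G(\mathbb{R})$ is the group of $\mathbb{R}$-points of $G$, equipped with the real (Hausdorff) topology; density is with respect to this topology. $Z_{G(\mathbb{R})}(u)=\{g\in G(\mathbb{R}): gu=ug\}$ is the centralizer of $u$ in $G(\mathbb{R})$. *)

theory Defs
  imports
    "HOL-Analysis.Analysis"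
    "HOL-Algebra.Group"
    "HOL-Library.Poly_Mapping"
begin

(* The product on the type complex^'n^'n that belongs to its type-class instances is
   componentwise; the monoid below carries the matrix product instead. *)
definition matrix_monoid :: "(complex^'n^'n) monoid" where
  "matrix_monoid = \<lparr>carrier = UNIV, mult = (**), one = mat 1\<rparr>"

definition general_linear :: "(complex^'n^'n) monoid" where
  "general_linear = units_of matrix_monoid"

(* The polynomial ring C[x_ij] in the matrix entries: monomials are exponent functions on the
   index pairs, polynomials are finitely supported coefficient functions on monomials. *)
type_synonym 'n matrix_poly = "('n \<times> 'n \<Rightarrow>\<^sub>0 nat) \<Rightarrow>\<^sub>0 complex"

definition poly_eval :: "'n matrix_poly \<Rightarrow> complex^'n^'n \<Rightarrow> complex" where
  "poly_eval p A =
     (\<Sum>m\<in>Poly_Mapping.keys p. Poly_Mapping.lookup p m *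
       (\<Prod>(i, j)\<in>Poly_Mapping.keys m. (A $ i $ j) ^ Poly_Mapping.lookup m (i, j)))"

definition vanishing_ideal :: "(complex^'n^'n) set \<Rightarrow> 'n matrix_poly set" where
  "vanishing_ideal X = {p. \<forall>A\<in>X. poly_eval p A = 0}"

definition real_poly :: "'n matrix_poly \<Rightarrow> bool" where
  "real_poly p \<longleftrightarrow> (\<forall>m. Poly_Mapping.lookup p m \<in> \<real>)"

(* Functions in C[x_ij, 1/det] have the same zero sets in GL_n(C) as polynomials in C[x_ij],
   since powers of 1/det can be cleared. *)
definition zariski_closed_in_GL :: "(complex^'n^'n) set \<Rightarrow> bool" where
  "zariski_closed_in_GL X \<longleftrightarrow>
     (\<exists>S :: 'n matrix_poly set.
        X = {A \<in> carrier general_linear. \<forall>p\<in>S. poly_eval p A = 0})"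

definition linear_algebraic_group :: "(complex^'n^'n) set \<Rightarrow> bool" where
  "linear_algebraic_group G \<longleftrightarrow> subgroup G general_linear \<and> zariski_closed_in_GL G"

(* The span for the scalar action of the ring on itself by multiplication is the generated
   ideal: the ideal of G is generated by the polynomials with real coefficients in it. *)
definition defined_over_reals :: "(complex^'n^'n) set \<Rightarrow> bool" where
  "defined_over_reals G \<longleftrightarrow>
     vanishing_ideal G = module.span (*) {p \<in> vanishing_ideal G. real_poly p}"

(* G(R), kept inside the complex matrices; the subspace topology is the usual topology of the
   space of real matrices. *)
definition real_points :: "(complex^'n^'n) set \<Rightarrow> (complex^'n^'n) set" where
  "real_points G = {A \<in> G. \<forall>i j. A $ i $ j \<in> \<real>}"

definition unipotent :: "complex^'n^'n \<Rightarrow> bool" where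
  "unipotent A \<longleftrightarrow> (\<exists>m::nat. (A - mat 1) [^]\<^bsub>matrix_monoid\<^esub> m = 0)"

definition power_map :: "nat \<Rightarrow> complex^'n^'n \<Rightarrow> complex^'n^'n" where
  "power_map k A = A [^]\<^bsub>general_linear\<^esub> k"

definition centralizer :: "(complex^'n^'n) set \<Rightarrow> complex^'n^'n \<Rightarrow> (complex^'n^'n) set" where
  "centralizer H u = {g \<in> H. g ** u = u ** g}"

definition dense_in :: "'a::topological_space set \<Rightarrow> 'a set \<Rightarrow> bool" where
  "dense_in D X \<longleftrightarrow> D \<subseteq> X \<and> top_of_set X closure_of D = X"

end

theory Submission
  imports Defs "HOL-Computational_Algebra.Fundamental_Theorem_Algebra"
    "HOL-Computational_Algebra.Polynomial_Factorial" "HOL-Computational_Algebra.Field_as_Ring"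
begin

text \<open>
  Write \<open>Z(u)\<close> for the centralizer of a unipotent \<open>u\<close> in \<open>G(\<real>)\<close>. A \<open>k\<close>-th root of \<open>su\<close>, with \<open>s \<in> Z(u)\<close>
  semisimple, has a semisimple part that commutes with \<open>u\<close> and is a \<open>k\<close>-th root of \<open>s\<close>; conversely
  \<open>h\<^sup>k = s\<close> with \<open>h \<in> Z(u)\<close> gives the root \<open>h u\<^sup>1\<^sup>/\<^sup>k\<close> of \<open>su\<close>. So \<open>P\<^sub>k\<close> is surjective on \<open>G(\<real>)\<close> iff for
  every \<open>u\<close> each semisimple element of \<open>Z(u)\<close> is a \<open>k\<close>-th power in \<open>Z(u)\<close>, and it remains to compare
  this with density in \<open>H = Z(u)\<close>.

  If semisimple elements have roots, take \<open>g = sv \<in> H\<close> with a locally maximal number of eigenvalues;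
  such \<open>g\<close> are dense. Then every element of \<open>H\<close> close to \<open>v\<close> and commuting with \<open>s\<close> has a single eigenvalue on
  each eigenspace of \<open>s\<close>. For \<open>a \<in> H\<close> semisimple, close to \<open>1\<close> and commuting with \<open>s\<close>, this applies to
  \<open>v\<^sup>t a\<close> for \<open>t\<close> near \<open>1\<close>, hence, the condition being polynomial in \<open>t\<close>, to \<open>a\<close> itself; so \<open>a\<close> is scalar
  on the eigenspaces of \<open>s\<close> and commutes with \<open>v\<close>. Iterated semisimple roots \<open>h\<^sub>0 = s\<close>, \<open>h\<^sub>n\<^sub>+\<^sub>1\<^sup>k = h\<^sub>n\<close> form a
  bounded sequence, so some \<open>h\<^sub>i h\<^sub>j\<^sup>-\<^sup>1\<close> with \<open>i < j\<close> is close to \<open>1\<close> and commutes with \<open>v\<close>. It is a power of \<open>h\<^sub>j\<close>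
  with exponent prime to \<open>k\<close>, while \<open>s\<close> is a power of \<open>h\<^sub>j\<close> whose exponent is a power of \<open>k\<close>; hence \<open>h\<^sub>j\<close>
  and \<open>h\<^sub>1\<close> commute with \<open>v\<close>, and \<open>h\<^sub>1 v\<^sup>1\<^sup>/\<^sup>k\<close> is a root of \<open>g\<close>.

  Conversely, near a semisimple \<open>s\<close> every element of the closed group \<open>H\<close> is conjugate in \<open>H\<close> to some \<open>s exp X\<close>
  with \<open>X\<close> small in the Lie algebra and commuting with \<open>s\<close>. If \<open>h\<^sup>k = s exp X\<close>, then \<open>h\<close> commutes with \<open>s\<close>
  and \<open>X\<close>, so \<open>h exp(-X/k)\<close> is a \<open>k\<close>-th root of \<open>s\<close>.
\<close>

section \<open>The normed algebra of complex square matrices\<close>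

text \<open>The class instances of \<open>complex^'n^'n\<close> carry the componentwise product. A
  copy of the type can carry the matrix product, so that powers, commutation and \<open>exp\<close>
  come from the ring and Banach algebra classes.\<close>

typedef (overloaded) 'n sqmat = "UNIV :: (complex^'n^'n) set"
  morphisms mat_of of_mat ..

lemma mat_of_of_mat [simp]: "mat_of (of_mat A) = A"
  by (simp add: of_mat_inverse)

lemma of_mat_mat_of [simp]: "of_mat (mat_of A) = A"
  by (rule mat_of_inverse)

lemma sqmat_eq_iff: "A = B \<longleftrightarrow> mat_of A = mat_of B"
  by (simp add: mat_of_inject)

instantiation sqmat :: (finite) "{real_vector, ring_1, real_algebra_1}"
begin

definition "0 = of_mat 0"
definition "1 = of_mat (mat 1)"
definition "A + B = of_mat (mat_of A + mat_of B)"
definition "A - B = of_mat (mat_of A - mat_of B)"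
definition "- A = of_mat (- mat_of A)"
definition "A * B = of_mat (mat_of A ** mat_of B)"
definition "r *\<^sub>R A = of_mat (r *\<^sub>R mat_of A)"

lemma mat_of_simps [simp]:
  "mat_of 0 = 0" "mat_of 1 = mat 1" "mat_of (A + B) = mat_of A + mat_of B"
  "mat_of (A - B) = mat_of A - mat_of B" "mat_of (- A) = - mat_of A"
  "mat_of (A * B) = mat_of A ** mat_of B" "mat_of (r *\<^sub>R A) = r *\<^sub>R mat_of A"
  by (simp_all add: zero_sqmat_def one_sqmat_def plus_sqmat_def minus_sqmat_def
      uminus_sqmat_def times_sqmat_def scaleR_sqmat_def)

instance
proof
  have "mat 1 \<noteq> (0 :: complex^'a^'a)"
    by (simp add: vec_eq_iff mat_def)
  then show "(0 :: 'a sqmat) \<noteq> 1"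
    by (simp add: sqmat_eq_iff)
qed (simp_all add: sqmat_eq_iff algebra_simps matrix_mul_assoc matrix_add_ldistrib
    matrix_scalar_ac scalar_matrix_assoc flip: scalar_mult_eq_scaleR,
    (simp add: vec_eq_iff matrix_matrix_mult_def sum.distrib scaleR_sum_right distrib_right distrib_left)+)

end

section \<open>Comparison of the Euclidean norm with the operator norm\<close>

lemma norm_entry_le_onorm:
  fixes A :: "complex^'n^'n"
  shows "norm (A $ i $ j) \<le> onorm ((*v) A)"
proof -
  have "norm (A $ i $ j) = norm ((A *v axis j 1) $ i)"
    by (simp add: matrix_vector_mult_def axis_def if_distrib[of "\<lambda>x. _ * x"] cong: if_cong)
  also have "\<dots> \<le> norm (A *v axis j 1)"
    by (rule Finite_Cartesian_Product.norm_nth_le)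
  also have "\<dots> \<le> onorm ((*v) A) * norm (axis j (1::complex))"
    by (rule onorm) simp
  finally show ?thesis
    by (simp add: norm_vec_def L2_set_def axis_def if_distrib[of norm] if_distrib[of "\<lambda>x. x\<^sup>2"] cong: if_cong)
qed

text \<open>Each of the n^2 entries is bounded by the operator norm. The crude constant suffices,
  since only the equivalence of the two topologies matters.\<close>

lemma norm_le_onorm:
  fixes A :: "complex^'n^'n"
  shows "norm A \<le> (real CARD('n))\<^sup>2 * onorm ((*v) A)"
proof -
  have "norm A \<le> (\<Sum>i\<in>UNIV. norm (A $ i))"
    by (simp add: norm_vec_def L2_set_le_sum)
  also have "\<dots> \<le> (\<Sum>i\<in>(UNIV::'n set). \<Sum>j\<in>(UNIV::'n set). norm (A $ i $ j))"
    by (intro sum_mono) (subst norm_vec_def, rule L2_set_le_sum, simp)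
  also have "\<dots> \<le> (\<Sum>i\<in>(UNIV::'n set). \<Sum>j\<in>(UNIV::'n set). onorm ((*v) A))"
    by (intro sum_mono norm_entry_le_onorm)
  finally show ?thesis
    by (simp add: power2_eq_square mult.assoc)
qed

lemma onorm_le_norm:
  fixes A :: "complex^'n^'n"
  shows "onorm ((*v) A) \<le> (real CARD('n))\<^sup>2 * norm A"
proof (rule onorm_bound)
  fix v :: "complex^'n"
  have "norm (A *v v) \<le> (\<Sum>i\<in>UNIV. norm ((A *v v) $ i))"
    by (simp add: norm_vec_def L2_set_le_sum)
  also have "\<dots> \<le> (\<Sum>i\<in>(UNIV::'n set). \<Sum>j\<in>(UNIV::'n set). norm A * norm v)"
  proof (rule sum_mono)
    fix i
    have "norm ((A *v v) $ i) \<le> (\<Sum>j\<in>UNIV. norm (A $ i $ j * v $ j))"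
      by (simp add: matrix_vector_mult_def norm_sum)
    also have "\<dots> \<le> (\<Sum>j\<in>(UNIV::'n set). norm A * norm v)"
    proof (rule sum_mono)
    fix j
    have "norm (A $ i $ j) \<le> norm A"
      by (rule order.trans[OF Finite_Cartesian_Product.norm_nth_le Finite_Cartesian_Product.norm_nth_le])
    then show "norm (A $ i $ j * v $ j) \<le> norm A * norm v"
      by (simp add: norm_mult mult_mono Finite_Cartesian_Product.norm_nth_le)
    qed
    finally show "norm ((A *v v) $ i) \<le> (\<Sum>j\<in>(UNIV::'n set). norm A * norm v)" .
  qed
  finally show "norm (A *v v) \<le> (real CARD('n))\<^sup>2 * norm A * norm v"
    by (simp add: power2_eq_square mult.assoc)
qed simp_all

instantiation sqmat :: (finite) real_normed_algebra_1
begin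

text \<open>The operator norm is submultiplicative and gives the identity norm 1, as
  \<open>real_normed_algebra_1\<close> demands.\<close>

definition "norm A = onorm ((*v) (mat_of A))"
definition "dist A B = norm (A - B :: 'a sqmat)"
definition "sgn A = A /\<^sub>R norm (A :: 'a sqmat)"
definition "uniformity = (INF e\<in>{0 <..}. principal {(x, y). dist x (y :: 'a sqmat) < e})"
definition "open U = (\<forall>x\<in>U. eventually (\<lambda>(x', y). x' = x \<longrightarrow> y \<in> (U :: 'a sqmat set)) uniformity)"

lemma norm_mat_of_le: "norm (mat_of A) \<le> (real CARD('a))\<^sup>2 * norm (A :: 'a sqmat)"
  unfolding norm_sqmat_def by (rule norm_le_onorm)

lemma norm_le_norm_mat_of: "norm (A :: 'a sqmat) \<le> (real CARD('a))\<^sup>2 * norm (mat_of A)"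
  unfolding norm_sqmat_def by (rule onorm_le_norm)

lemma dist_mat_of_le: "dist (mat_of A) (mat_of B) \<le> (real CARD('a))\<^sup>2 * dist A (B :: 'a sqmat)"
  using norm_mat_of_le[of "A - B"] by (simp add: dist_norm dist_sqmat_def)

lemma dist_le_dist_mat_of: "dist A (B :: 'a sqmat) \<le> (real CARD('a))\<^sup>2 * dist (mat_of A) (mat_of B)"
  using norm_le_norm_mat_of[of "A - B"] by (simp add: dist_norm dist_sqmat_def)

instance
proof
  fix A B :: "'a sqmat" and r :: real
  show "norm A = 0 \<longleftrightarrow> A = 0"
    using norm_mat_of_le[of A] norm_le_norm_mat_of[of A] onorm_pos_le[of "(*v) (mat_of A)"]
    by (auto simp: sqmat_eq_iff norm_sqmat_def onorm_zero)
  show "norm (A + B) \<le> norm A + norm B"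
    unfolding norm_sqmat_def
    using onorm_triangle[of "(*v) (mat_of A)" "(*v) (mat_of B)"]
    by (simp flip: matrix_vector_mult_add_rdistrib)
  show "norm (r *\<^sub>R A) = \<bar>r\<bar> * norm A"
    unfolding norm_sqmat_def onorm_scaleR[OF matrix_vector_mul_bounded_linear, symmetric]
    by (rule arg_cong[where f = onorm]) (simp add: fun_eq_iff vec_eq_iff matrix_vector_mult_def scaleR_sum_right)
  show "norm (A * B) \<le> norm A * norm B"
    unfolding norm_sqmat_def
    using onorm_compose[of "(*v) (mat_of A)" "(*v) (mat_of B)"]
    by (simp add: o_def matrix_vector_mul_assoc)
  show "norm (1 :: 'a sqmat) = 1"
    unfolding norm_sqmat_def using onorm_id[where 'a = "complex^'a"] by (simp add: matrix_vector_mul_lid [abs_def])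
qed (simp_all add: dist_sqmat_def sgn_sqmat_def uniformity_sqmat_def open_sqmat_def)

end

text \<open>Completeness is transported from the vector type along the two Lipschitz
  estimates.\<close>

instance sqmat :: (finite) banach
proof
  fix X :: "nat \<Rightarrow> 'a sqmat"
  assume X: "Cauchy X"
  let ?c = "(real CARD('a))\<^sup>2"
  have c: "?c > 0"
    by simp
  have "Cauchy (\<lambda>n. mat_of (X n))"
  proof (rule metric_CauchyI)
    fix e :: real
    assume "e > 0"
    then have "e / ?c > 0"
      using c by (rule divide_pos_pos)
    with X obtain M where M: "\<And>m n. m \<ge> M \<Longrightarrow> n \<ge> M \<Longrightarrow> dist (X m) (X n) < e / ?c"
      unfolding Cauchy_def by meson
    have "dist (mat_of (X m)) (mat_of (X n)) < e" if "m \<ge> M" "n \<ge> M" for m n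
      using M[OF that] dist_mat_of_le[of "X m" "X n"] c
      by (simp add: pos_less_divide_eq mult.commute)
    then show "\<exists>M. \<forall>m\<ge>M. \<forall>n\<ge>M. dist (mat_of (X m)) (mat_of (X n)) < e"
      by blast
  qed
  then obtain L where L: "(\<lambda>n. mat_of (X n)) \<longlonglongrightarrow> L"
    using Cauchy_convergent_iff convergent_def by blast
  then have "(\<lambda>n. ?c * dist (mat_of (X n)) L) \<longlonglongrightarrow> 0"
    unfolding tendsto_dist_iff[of _ L] by (rule tendsto_mult_right_zero)
  then have "X \<longlonglongrightarrow> of_mat L"
    unfolding tendsto_dist_iff[of X]
  proof (rule tendsto_sandwich[OF _ _ tendsto_const, rotated 2])
    show "\<forall>\<^sub>F n in sequentially. dist (X n) (of_mat L) \<le> ?c * dist (mat_of (X n)) L"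
      using dist_le_dist_mat_of[of _ "of_mat L"] by (intro always_eventually) simp
  qed auto
  then show "convergent X"
    by (auto simp: convergent_def)
qed

section \<open>Polynomials in a matrix and spectral idempotents\<close>

lemma mult_swap: "A * B = B * A \<Longrightarrow> A * (B * C) = B * (A * C)" for A B C :: "'a::semigroup_mult"
  by (metis mult.assoc)

lemma commuting_power_distrib:
  fixes N M :: "'a::monoid_mult"
  assumes "N * M = M * N"
  shows "(N * M) ^ m = N ^ m * M ^ m"
proof (induction m)
  case (Suc m)
  have "(N * M) ^ Suc m = N * (M * N ^ m) * M ^ m"
    by (simp add: Suc.IH mult.assoc)
  also have "M * N ^ m = N ^ m * M"
    by (rule power_commuting_commutes[OF assms, symmetric])
  finally show ?case
    by (simp add: mult.assoc)
qed simp

text \<open>The exponent is one below the least that kills \<open>B\<close>. With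
  \<open>A - scal z\<close> for \<open>N\<close> this extracts genuine eigenvectors from a
  generalized eigenspace.\<close>

lemma power_last:
  fixes N B :: "'a::ring_1"
  assumes "N ^ m * B = 0" "B \<noteq> 0"
  obtains i where "N ^ i * B \<noteq> 0" "N * (N ^ i * B) = 0"
proof -
  define j where "j = (LEAST j. N ^ j * B = 0)"
  have j: "N ^ j * B = 0"
    unfolding j_def by (rule LeastI) fact
  have "j \<noteq> 0"
    using j assms(2) by (metis mult_1 power_0)
  then obtain i where i: "j = Suc i"
    by (auto simp: gr0_conv_Suc)
  have "N ^ i * B \<noteq> 0"
    using not_less_Least[of i "\<lambda>j. N ^ j * B = 0"] i by (simp add: j_def)
  moreover have "N * (N ^ i * B) = 0"
    using j by (simp add: i mult.assoc)
  ultimately show ?thesis using that by blast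
qed

text \<open>The classes provide only real scalars; complex ones act as multiples of the identity,
  which commute with everything.\<close>

definition scal :: "complex \<Rightarrow> 'n::finite sqmat" where
  "scal z = of_mat (mat z)"

lemma mat_of_scal [simp]: "mat_of (scal z) = mat z"
  by (simp add: scal_def)

lemma scal_0 [simp]: "scal 0 = 0"
  and scal_1 [simp]: "scal 1 = 1"
  and scal_add: "scal (a + b) = scal a + scal b"
  and scal_diff: "scal (a - b) = scal a - scal b"
  and scal_minus: "scal (- a) = - scal a"
  by (simp_all add: sqmat_eq_iff vec_eq_iff mat_def)

lemma mat_mult_entry: "(mat z ** A) $ i $ j = z * A $ i $ j" for A :: "complex^'n^'n"
  by (simp add: matrix_matrix_mult_def mat_def if_distrib[of "\<lambda>x. x * _"] cong: if_cong)

lemma mult_mat_entry: "(A ** mat z) $ i $ j = z * A $ i $ j" for A :: "complex^'n^'n"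
  by (simp add: matrix_matrix_mult_def mat_def if_distrib[of "\<lambda>x. _ * x"] mult.commute cong: if_cong)

lemma scal_mult: "scal (a * b) = scal a * scal b"
  by (simp add: sqmat_eq_iff vec_eq_iff mat_mult_entry) (simp add: mat_def)

lemma scal_commute: "A * scal z = scal z * A"
  by (simp add: sqmat_eq_iff vec_eq_iff mat_mult_entry mult_mat_entry)

lemma scal_left_commute: "A * (scal z * B) = scal z * (A * B)"
  by (metis mult.assoc scal_commute)

lemma scal_scal_mult: "scal a * (scal b * B) = scal (a * b) * B"
  by (simp add: scal_mult mult.assoc)

lemma scal_sum: "scal (sum f I) = (\<Sum>i\<in>I. scal (f i))"
  by (induction I rule: infinite_finite_induct) (simp_all add: scal_add)

lemma scal_of_real: "scal (of_real r) = of_real r"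
  by (simp add: sqmat_eq_iff vec_eq_iff of_real_def mat_def)

lemma scal_mult_eq_0_iff: "scal z * A = 0 \<longleftrightarrow> z = 0 \<or> A = 0"
proof -
  have "A = 0" if "scal z * A = 0" "z \<noteq> 0"
  proof -
    have "A = scal (1 / z) * (scal z * A)"
      using that(2) by (simp add: scal_scal_mult)
    also have "\<dots> = 0"
      unfolding that(1) by simp
    finally show ?thesis .
  qed
  then show ?thesis by auto
qed

lemma scal_mult_cancel: "scal a * A = scal b * A \<Longrightarrow> A \<noteq> 0 \<Longrightarrow> a = b"
  using scal_mult_eq_0_iff[of "a - b" A] by (simp add: scal_diff left_diff_distrib)

lemma norm_scal_le: "norm (scal z) \<le> norm z"
  unfolding norm_sqmat_def
proof (rule onorm_bound)
  fix v :: "complex^'a"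
  have "mat z *v v = (\<chi> i. z * v $ i)"
    by (simp add: vec_eq_iff matrix_vector_mult_def mat_def if_distrib[of "\<lambda>x. x * _"] cong: if_cong)
  then show "norm (mat_of (scal z) *v v) \<le> norm z * norm v"
    by (simp add: norm_vec_def norm_mult L2_set_right_distrib)
qed simp

text \<open>The library's \<^const>\<open>poly\<close> needs a commutative coefficient ring, hence a separate evaluation.\<close>

definition pev :: "complex poly \<Rightarrow> 'n::finite sqmat \<Rightarrow> 'n sqmat" where
  "pev p A = fold_coeffs (\<lambda>a B. scal a + A * B) p 0"

lemma pev_0 [simp]: "pev 0 A = 0"
  by (simp add: pev_def)

lemma pev_pCons [simp]: "pev (pCons a p) A = scal a + A * pev p A"
  by (cases "p = 0 \<and> a = 0") (auto simp add: pev_def)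

lemma pev_1 [simp]: "pev 1 A = 1"
  by (simp add: one_pCons)

lemma pev_add: "pev (p + q) A = pev p A + pev q A"
  by (induction p q rule: poly_induct2) (simp_all add: scal_add algebra_simps)

lemma pev_smult: "pev (smult a p) A = scal a * pev p A"
  by (induction p) (simp_all add: scal_mult scal_left_commute distrib_left)

lemma pev_minus: "pev (- p) A = - pev p A"
  by (induction p) (simp_all add: scal_minus)

lemma pev_diff: "pev (p - q) A = pev p A - pev q A"
  using pev_add[of p "- q" A] by (simp add: pev_minus)

lemma pev_mult: "pev (p * q) A = pev p A * pev q A"
  by (induction p) (simp_all add: pev_add pev_smult distrib_right mult.assoc)

lemma pev_power: "pev (p ^ m) A = pev p A ^ m"
  by (induction m) (simp_all add: pev_mult)

lemma pev_sum: "pev (sum f I) A = (\<Sum>i\<in>I. pev (f i) A)"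
  by (induction I rule: infinite_finite_induct) (simp_all add: pev_add)

lemma pev_dvd_0: "p dvd q \<Longrightarrow> pev p A = 0 \<Longrightarrow> pev q A = 0"
  by (auto simp: dvd_def pev_mult)

lemma pev_commute:
  assumes "C * A = A * C"
  shows "C * pev p A = pev p A * C"
proof (induction p)
  case (pCons a p)
  have "C * (A * pev p A) = A * pev p A * C"
    by (metis assms mult.assoc pCons.IH)
  then show ?case
    by (simp add: algebra_simps scal_commute)
qed simp

lemma pev_mult_eigen:
  assumes "A * B = scal z * B"
  shows "pev p A * B = scal (poly p z) * B"
proof (induction p)
  case (pCons a p)
  have "A * pev p A * B = scal (poly p z) * (A * B)"
    by (simp add: mult.assoc pCons.IH scal_left_commute)
  then show ?case
    by (simp add: assms scal_add distrib_right scal_scal_mult mult.commute)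
qed simp

lemma mult_power_eigen:
  assumes "A * B = scal z * B"
  shows "A ^ m * B = scal (z ^ m) * B"
proof (induction m)
  case (Suc m)
  have "A ^ Suc m * B = A * (scal (z ^ m) * B)"
    by (simp add: mult.assoc Suc.IH)
  also have "\<dots> = scal (z ^ m) * (scal z * B)"
    by (simp only: scal_left_commute[of A] assms)
  finally show ?case
    by (simp add: scal_scal_mult mult.commute)
qed simp

text \<open>The real dimension 2 n^2 of the matrix space serves as one crude bound for degrees of
  annihilating polynomials, nilpotency indices and numbers of eigenvalues.\<close>

abbreviation mdim :: "'n::finite itself \<Rightarrow> nat" where
  "mdim _ \<equiv> DIM(complex^'n^'n)"

lemma linear_mat_of: "linear mat_of"
  by (rule linearI) simp_all

lemma bounded_linear_mat_of: "bounded_linear mat_of"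
  by (rule bounded_linear_intro[where K = "(real CARD('a))\<^sup>2"])
    (simp_all add: norm_mat_of_le mult.commute[of "norm _"])

lemma bounded_linear_of_mat: "bounded_linear (of_mat :: complex^'n^'n \<Rightarrow> 'n::finite sqmat)"
  using norm_le_norm_mat_of[where 'a = 'n]
  by (intro bounded_linear_intro[where K = "(real CARD('n))\<^sup>2"])
    (simp_all add: sqmat_eq_iff, metis mat_of_of_mat mult.commute)

text \<open>The d + 1 powers up to \<open>A ^ d\<close> are linearly dependent over the reals in a
  space of dimension d.\<close>

lemma exists_annihilating_poly:
  fixes A :: "'n::finite sqmat"
  shows "\<exists>p. p \<noteq> 0 \<and> degree p \<le> mdim TYPE('n) \<and> pev p A = 0"
proof -
  let ?d = "mdim TYPE('n)"
  let ?f = "\<lambda>i. mat_of (A ^ i)"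
  have pev_monom: "pev (monom a i) A = scal a * A ^ i" for a i
    by (induction i) (simp_all add: monom_0 monom_Suc scal_left_commute)
  show ?thesis
  \<comment> \<open>A repetition among the powers is treated apart: linear dependence is a property
    of sets and does not see it.\<close>
  proof (cases "inj_on ?f {..?d}")
    case False
    then obtain i j where "i \<le> ?d" "j \<le> ?d" "i \<noteq> j" "A ^ i = A ^ j"
      by (auto simp: inj_on_def sqmat_eq_iff)
    then have "pev (monom 1 i - monom 1 j) A = 0"
      by (simp add: pev_diff pev_monom)
    moreover have "monom 1 i - monom (1::complex) j \<noteq> 0"
      using \<open>i \<noteq> j\<close> by (simp add: monom_eq_iff')
    moreover have "degree (monom 1 i - monom (1::complex) j) \<le> ?d"
      using \<open>i \<le> ?d\<close> \<open>j \<le> ?d\<close> by (intro degree_diff_le) (auto intro: order.trans[OF degree_monom_le])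
    ultimately show ?thesis by blast
  next
    case True
    then have card: "card (?f ` {..?d}) = Suc ?d"
      by (simp add: card_image)
    then have "dependent (?f ` {..?d})"
      by (intro dependent_biggerset) auto
    then obtain u where u: "(\<Sum>v\<in>?f ` {..?d}. u v *\<^sub>R v) = 0" "\<exists>v\<in>?f ` {..?d}. u v \<noteq> 0"
      by (subst (asm) real_vector.dependent_finite) auto
    define p where "p = (\<Sum>i\<le>?d. monom (complex_of_real (u (?f i))) i)"
    have coeff: "coeff p i = complex_of_real (u (?f i))" if "i \<le> ?d" for i
      using that by (simp add: p_def coeff_sum)
    have "(\<Sum>i\<le>?d. u (?f i) *\<^sub>R ?f i) = 0"
      using u(1) by (subst (asm) sum.reindex[OF True]) simp
    then have "mat_of (\<Sum>i\<le>?d. u (?f i) *\<^sub>R A ^ i) = 0"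
      by (simp add: linear_sum[OF linear_mat_of])
    then have "(\<Sum>i\<le>?d. u (?f i) *\<^sub>R A ^ i) = 0"
      by (simp add: sqmat_eq_iff)
    then have "pev p A = 0"
      by (simp add: p_def pev_sum pev_monom scal_of_real scaleR_conv_of_real)
    moreover have "p \<noteq> 0"
      using u(2) coeff by auto
    moreover have "degree p \<le> ?d"
      unfolding p_def by (intro degree_sum_le) (auto intro: order.trans[OF degree_monom_le])
    ultimately show ?thesis by blast
  qed
qed

section \<open>Nilpotent matrices\<close>

definition nilp :: "'n::finite sqmat \<Rightarrow> bool" where
  "nilp N \<longleftrightarrow> (\<exists>m. N ^ m = 0)"

lemma nilp_0 [simp]: "nilp 0"
  unfolding nilp_def by (rule exI[of _ 1]) simp

lemma nilp_mult: "nilp N \<Longrightarrow> N * M = M * N \<Longrightarrow> nilp (N * M)"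
  unfolding nilp_def by (metis commuting_power_distrib mult_zero_left)

lemma nilp_last:
  assumes "nilp N" "B \<noteq> 0"
  obtains i where "N ^ i * B \<noteq> 0" "N * (N ^ i * B) = 0"
  using assms power_last[of N _ B] unfolding nilp_def by (metis mult_zero_left)

text \<open>Write an annihilating polynomial as X^j q with q(0) nonzero. On the last nonzero power
  from \<open>N ^ j\<close> onwards, \<open>pev q N\<close> acts as the nonzero scalar q(0), yet the
  product vanishes; hence \<open>N ^ j = 0\<close>, and j is at most the degree.\<close>

lemma nilp_power_mdim:
  fixes N :: "'n::finite sqmat"
  assumes "nilp N"
  shows "N ^ mdim TYPE('n) = 0"
proof -
  obtain p where p: "p \<noteq> 0" "degree p \<le> mdim TYPE('n)" "pev p N = 0"
    using exists_annihilating_poly by blast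
  define j where "j = order 0 p"
  obtain q where q: "p = [:0, 1:] ^ j * q" "\<not> [:0, 1:] dvd q"
    using order_decomp[OF p(1), of 0] by (auto simp: j_def)
  have "poly q 0 \<noteq> 0"
    using q(2) poly_eq_0_iff_dvd[of q 0] by simp
  have "N ^ j = 0"
  proof (rule ccontr)
    assume "N ^ j \<noteq> 0"
    then obtain i where i: "N ^ i * N ^ j \<noteq> 0" "N * (N ^ i * N ^ j) = 0"
      using nilp_last[OF assms] by blast
    have "0 = N ^ i * pev p N"
      using p(3) by simp
    also have "pev p N = N ^ j * pev q N"
      unfolding q(1) pev_mult pev_power by simp
    also have "N ^ i * (N ^ j * pev q N) = N ^ (i + j) * pev q N"
      unfolding power_add mult.assoc ..
    also have "\<dots> = pev q N * N ^ (i + j)"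
      by (rule pev_commute) (rule power_commutes)
    also have "N ^ (i + j) = N ^ i * N ^ j"
      by (rule power_add)
    also have "pev q N * (N ^ i * N ^ j) = scal (poly q 0) * (N ^ i * N ^ j)"
      by (rule pev_mult_eigen) (simp add: i)
    finally show False
      using i(1) \<open>poly q 0 \<noteq> 0\<close> by (simp add: scal_mult_eq_0_iff)
  qed
  moreover have "j \<le> mdim TYPE('n)"
    using order_degree[OF p(1), of 0] p(2) by (simp add: j_def)
  ultimately show ?thesis
    by (metis le_add_diff_inverse2 mult_zero_right power_add)
qed

text \<open>The \<open>E z\<close> are the projections onto the generalized eigenspaces for the
  eigenvalues in \<open>L\<close>, and \<open>m\<close> bounds the nilpotency index on each;
  \<open>m = 1\<close> means diagonalizable. The commutation clause stands for \<open>E z\<close>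
  being a polynomial in \<open>A\<close>.\<close>

definition spectral ::
  "'n::finite sqmat \<Rightarrow> nat \<Rightarrow> complex set \<Rightarrow> (complex \<Rightarrow> 'n sqmat) \<Rightarrow> bool" where
  "spectral A m L E \<longleftrightarrow> finite L \<and>
     (\<forall>z\<in>L. E z \<noteq> 0 \<and> (A - scal z) ^ m * E z = 0 \<and> (\<forall>C. C * A = A * C \<longrightarrow> C * E z = E z * C)) \<and>
     (\<Sum>z\<in>L. E z) = 1 \<and> (\<forall>z\<in>L. \<forall>w\<in>L. z \<noteq> w \<longrightarrow> E z * E w = 0)"

lemma
  assumes "spectral A m L E"
  shows spectral_finite: "finite L"
    and spectral_nonzero: "z \<in> L \<Longrightarrow> E z \<noteq> 0"
    and spectral_nilp: "z \<in> L \<Longrightarrow> (A - scal z) ^ m * E z = 0"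
    and spectral_commute: "z \<in> L \<Longrightarrow> C * A = A * C \<Longrightarrow> C * E z = E z * C"
    and spectral_sum: "(\<Sum>z\<in>L. E z) = 1"
    and spectral_orth: "z \<in> L \<Longrightarrow> w \<in> L \<Longrightarrow> z \<noteq> w \<Longrightarrow> E z * E w = 0"
  using assms unfolding spectral_def by blast+

lemma spectral_idem:
  assumes "spectral A m L E" "z \<in> L"
  shows "E z * E z = E z"
proof -
  have "E z = E z * (\<Sum>w\<in>L. E w)"
    by (simp add: spectral_sum[OF assms(1)])
  also have "\<dots> = (\<Sum>w\<in>L. if w = z then E z * E z else 0)"
    using assms spectral_orth[OF assms(1)] by (auto simp: sum_distrib_left intro!: sum.cong)
  also have "\<dots> = E z * E z"
    using assms spectral_finite[OF assms(1)] by simp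
  finally show ?thesis by simp
qed

lemma spectral_resolve:
  assumes "spectral A m L E"
  shows "B = (\<Sum>z\<in>L. E z * B)"
  by (simp add: sum_distrib_right[symmetric] spectral_sum[OF assms])

section \<open>Construction of the spectral projections\<close>

lemma coprime_linear_powers:
  "z \<noteq> w \<Longrightarrow> coprime ([:- z, 1:] ^ m) ([:- w, 1:] ^ k :: complex poly)"
proof -
  assume "z \<noteq> w"
  have "coprime [:- z, 1:] [:- w, 1:]"
  proof (rule coprimeI)
    fix c
    assume "c dvd [:- z, 1:]" "c dvd [:- w, 1:]"
    then have "c dvd [:- z, 1:] - [:- w, 1:]"
      by (rule dvd_diff)
    also have "[:- z, 1:] - [:- w, 1:] = [:w - z:]"
      by simp
    finally show "is_unit c"
      using \<open>z \<noteq> w\<close> by (auto elim: dvd_unit_imp_unit simp: is_unit_pCons_iff)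
  qed
  then show ?thesis by simp
qed

text \<open>Chinese remainder theorem: \<open>e z\<close> is 1 modulo \<open>l z\<close> and 0
  modulo the other factors, and \<open>E z\<close> is its value at \<open>A\<close>. Being
  polynomials in \<open>A\<close>, the \<open>E z\<close> commute with whatever commutes with
  \<open>A\<close>.\<close>

lemma exists_spectral_of_roots:
  assumes "finite L" and ann: "pev (\<Prod>z\<in>L. [:- z, 1:] ^ m) A = 0"
  obtains K E where "spectral A m K E"
proof -
  define l where "l = (\<lambda>z. [:- z, 1:] ^ m :: complex poly)"
  define f where "f = (\<lambda>z. \<Prod>w\<in>L - {z}. l w)"
  have lf: "(\<Prod>z\<in>L. l z) = l z * f z" if "z \<in> L" for z
    unfolding f_def by (rule prod.remove[OF assms(1) that])
  have "coprime (f z) (l z)" if "z \<in> L" for z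
    unfolding f_def l_def by (intro prod_coprime_left coprime_linear_powers) auto
  then have "\<exists>a b. a * f z + b * l z = 1" if "z \<in> L" for z
    using that bezout_coefficients_fst_snd[of "f z" "l z"] by auto
  then obtain a b where ab: "\<And>z. z \<in> L \<Longrightarrow> a z * f z + b z * l z = 1"
    by metis
  define e where "e = (\<lambda>z. a z * f z)"
  define E where "E = (\<lambda>z. pev (e z) A)"
  have ann': "pev (\<Prod>z\<in>L. l z) A = 0"
    using ann by (simp add: l_def)
  have dvd: "l w dvd e z" if "w \<in> L" "z \<noteq> w" for z w
    using that assms(1) by (auto simp: e_def f_def intro!: dvd_mult dvd_prodI)
  have le: "(\<Prod>z\<in>L. l z) dvd l z * e z" if "z \<in> L" for z
    unfolding lf[OF that] e_def by (simp add: mult.left_commute)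
  have orth: "E z * E w = 0" if "z \<in> L" "w \<in> L" "z \<noteq> w" for z w
  proof -
    have "l z * f z dvd e w * e z"
      by (rule mult_dvd_mono) (use dvd[of z w] that in \<open>auto simp: e_def\<close>)
    then have "pev (e w * e z) A = 0"
      using ann' lf[OF that(1)] by (metis pev_dvd_0)
    then show ?thesis
      by (simp add: E_def pev_mult[symmetric] mult.commute)
  qed
  have sum: "(\<Sum>z\<in>L. E z) = 1"
  proof -
    \<comment> \<open>The difference is divisible by every \<open>l w\<close>, hence by coprimality
      by their product, which annihilates \<open>A\<close>.\<close>
    have ldvd: "l w dvd 1 - (\<Sum>z\<in>L. e z)" if "w \<in> L" for w
    proof -
      have "1 - (\<Sum>z\<in>L. e z) = b w * l w - (\<Sum>z\<in>L - {w}. e z)"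
        using ab[OF that] by (simp add: sum.remove[OF assms(1) that] e_def algebra_simps)
      also have "l w dvd \<dots>"
        using that dvd by (intro dvd_diff dvd_sum) auto
      finally show ?thesis .
    qed
    have "(\<Prod>z\<in>K. l z) dvd 1 - (\<Sum>z\<in>L. e z)" if "K \<subseteq> L" for K
      using finite_subset[OF that assms(1)] that
    proof (induction K rule: finite_induct)
      case (insert z K)
      have "coprime (l z) (\<Prod>z\<in>K. l z)"
        using insert unfolding l_def by (intro prod_coprime_right coprime_linear_powers) auto
      with insert show ?case
        by (simp add: divides_mult ldvd)
    qed simp
    then have "pev (1 - (\<Sum>z\<in>L. e z)) A = 0"
      using ann' pev_dvd_0 by blast
    then show ?thesis
      by (simp add: E_def pev_diff pev_sum)
  qed
  \<comment> \<open>Roots of the product that are not eigenvalues have zero projection and are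
    discarded.\<close>
  define K where "K = {z \<in> L. E z \<noteq> 0}"
  have "(\<Sum>z\<in>K. E z) = (\<Sum>z\<in>L. E z)"
    unfolding K_def using assms(1) by (intro sum.mono_neutral_left) auto
  moreover have "(A - scal z) ^ m * E z = 0" if "z \<in> L" for z
    using pev_dvd_0[OF le[OF that] ann'] by (simp add: E_def l_def pev_mult pev_power scal_minus)
  ultimately have "spectral A m K E"
    using assms(1) orth sum by (auto simp: spectral_def K_def E_def intro: pev_commute)
  then show ?thesis
    by (rule that)
qed

lemma exists_spectral:
  fixes A :: "'n::finite sqmat"
  obtains L E where "spectral A (mdim TYPE('n)) L E"
proof -
  let ?d = "mdim TYPE('n)"
  obtain p where p: "p \<noteq> 0" "degree p \<le> ?d" "pev p A = 0"
    using exists_annihilating_poly by blast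
  define L where "L = {z. poly p z = 0}"
  have L: "finite L"
    using poly_roots_finite[OF p(1)] by (simp add: L_def)
  \<comment> \<open>Every root has multiplicity at most the degree, so one common exponent
    works.\<close>
  have "p dvd (\<Prod>z\<in>L. [:- z, 1:] ^ ?d)"
  proof -
    have "smult (lead_coeff p) (\<Prod>z\<in>L. [:- z, 1:] ^ order z p) dvd (\<Prod>z\<in>L. [:- z, 1:] ^ ?d)"
      using p(1,2) order_degree[OF p(1)]
      by (intro smult_dvd prod_dvd_prod le_imp_power_dvd) (auto intro: order.trans)
    then show ?thesis
      by (simp add: L_def complex_poly_decompose)
  qed
  then have "pev (\<Prod>z\<in>L. [:- z, 1:] ^ ?d) A = 0"
    using p(3) by (rule pev_dvd_0)
  with L show ?thesis
    by (rule exists_spectral_of_roots) (rule that)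
qed

section \<open>Jordan decomposition\<close>

text \<open>A nonzero matrix \<open>B\<close> stands in for an eigenvector, each nonzero column of
  it being one; so all arguments stay inside the algebra.\<close>

definition spec :: "'n::finite sqmat \<Rightarrow> complex set" where
  "spec A = {z. \<exists>B. B \<noteq> 0 \<and> A * B = scal z * B}"

lemma specI: "B \<noteq> 0 \<Longrightarrow> A * B = scal z * B \<Longrightarrow> z \<in> spec A"
  by (auto simp: spec_def)

lemma finite_spec: "finite (spec A)"
  and card_spec_le: "card (spec (A :: 'n::finite sqmat)) \<le> mdim TYPE('n)"
proof -
  obtain p where p: "p \<noteq> 0" "degree p \<le> mdim TYPE('n)" "pev p A = 0"
    using exists_annihilating_poly by blast
  have sub: "spec A \<subseteq> {z. poly p z = 0}"
    using p(3) pev_mult_eigen[of A _ _ p] by (force simp: spec_def scal_mult_eq_0_iff)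
  with p poly_roots_finite[OF p(1)] card_poly_roots_bound[OF p(1)]
  show "finite (spec A)" "card (spec A) \<le> mdim TYPE('n)"
    by (auto intro: finite_subset order.trans[OF card_mono])
qed

text \<open>In the main use \<open>C\<close> is a spectral projection of a commuting matrix, and the
  eigenvector found is one for both matrices.\<close>

lemma spectral_eigenvector:
  assumes "spectral l m K F" "a \<in> K" "F a * C \<noteq> 0"
  obtains i where "(l - scal a) ^ i * (F a * C) \<noteq> 0"
    "l * ((l - scal a) ^ i * (F a * C)) = scal a * ((l - scal a) ^ i * (F a * C))"
proof -
  have "(l - scal a) ^ m * (F a * C) = 0"
    by (simp add: mult.assoc[symmetric] spectral_nilp[OF assms(1,2)])
  then obtain i where "(l - scal a) ^ i * (F a * C) \<noteq> 0" "(l - scal a) * ((l - scal a) ^ i * (F a * C)) = 0"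
    using power_last assms(3) by metis
  then show ?thesis
    using that by (simp add: left_diff_distrib)
qed

lemma unit_spectral_nonzero:
  assumes "h * s = 1" "spectral s m L E" "z \<in> L"
  shows "z \<noteq> 0"
proof
  assume "z = 0"
  moreover have "E z * 1 \<noteq> 0"
    using spectral_nonzero[OF assms(2,3)] by simp
  ultimately obtain B where "B \<noteq> 0" "s * B = 0"
    using spectral_eigenvector[OF assms(2,3), of 1] by (metis mult_zero_left scal_0)
  then show False
    using assms(1) by (metis mult.assoc mult_1 mult_zero_right)
qed

definition semisimple :: "'n::finite sqmat \<Rightarrow> bool" where
  "semisimple s \<longleftrightarrow> (\<exists>L E. spectral s 1 L E)"

lemma spectral_eigen: "spectral s 1 L E \<Longrightarrow> z \<in> L \<Longrightarrow> s * E z = scal z * E z"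
  using spectral_nilp[of s 1 L E z] by (simp add: left_diff_distrib)

lemma spectral_1_expand:
  assumes "spectral s 1 L E"
  shows "s * B = (\<Sum>z\<in>L. scal z * E z * B)"
proof -
  have "s * B = s * (\<Sum>z\<in>L. E z) * B"
    by (simp add: spectral_sum[OF assms])
  then show ?thesis
    by (simp add: sum_distrib_left sum_distrib_right spectral_eigen[OF assms])
qed

text \<open>The product of X - c over the values of \<open>c\<close> has simple roots and kills
  every \<open>F i\<close>, hence also 1; an annihilating polynomial with simple roots yields
  projections with exponent 1.\<close>

lemma semisimpleI:
  assumes "finite I" "\<And>i. i \<in> I \<Longrightarrow> s * F i = scal (c i) * F i" "(\<Sum>i\<in>I. F i) = 1"
  shows "semisimple s"
proof -
  define p where "p = (\<Prod>z\<in>c ` I. [:- z, 1:] ^ 1)"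
  have "pev p s = (\<Sum>i\<in>I. pev p s * F i)"
    by (simp add: sum_distrib_left[symmetric] assms(3))
  also have "\<dots> = (\<Sum>i\<in>I. 0)"
  proof (rule sum.cong[OF refl])
    fix i
    assume i: "i \<in> I"
    have "poly p (c i) = 0"
      unfolding p_def poly_prod using i assms(1) by (intro prod_zero) auto
    then show "pev p s * F i = 0"
      using pev_mult_eigen[OF assms(2)[OF i], of p] by simp
  qed
  finally show ?thesis
    using exists_spectral_of_roots[of "c ` I" 1 s] assms(1) by (metis finite_imageI p_def semisimple_def sum.neutral_const)
qed

lemma semisimple_power:
  assumes "semisimple s"
  shows "semisimple (s ^ k)"
proof -
  obtain L E where LE: "spectral s 1 L E"
    using assms by (auto simp: semisimple_def)
  have "s ^ k * E z = scal (z ^ k) * E z" if "z \<in> L" for z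
    by (rule mult_power_eigen[OF spectral_eigen[OF LE that]])
  then show ?thesis
    using spectral_finite[OF LE] spectral_sum[OF LE] by (intro semisimpleI[of L _ E "\<lambda>z. z ^ k"])
qed

definition jordan :: "'n::finite sqmat \<Rightarrow> 'n sqmat \<Rightarrow> 'n sqmat \<Rightarrow> bool" where
  "jordan g s v \<longleftrightarrow> g = s * v \<and> s * v = v * s \<and> semisimple s \<and> nilp (v - 1)"

text \<open>\<open>s\<close> acts as z and \<open>t\<close> as 1/z on the image of
  \<open>E z\<close>, and \<open>v = t * g\<close>. The commutation clauses descend from the
  projections and carry the uniqueness proof below.\<close>

lemma jordan_exists:
  assumes "h * g = 1" "g * h = (1 :: 'n::finite sqmat)"
  obtains s v where "jordan g s v"
    "\<And>C. C * g = g * C \<Longrightarrow> C * s = s * C" "\<And>C. C * g = g * C \<Longrightarrow> C * v = v * C"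
proof -
  let ?d = "mdim TYPE('n)"
  obtain L E where LE: "spectral g ?d L E"
    using exists_spectral by metis
  have nz: "z \<noteq> 0" if "z \<in> L" for z
    by (rule unit_spectral_nonzero[OF assms(1) LE that])
  define s where "s = (\<Sum>z\<in>L. scal z * E z)"
  define t where "t = (\<Sum>z\<in>L. scal (1 / z) * E z)"
  have sum_mult: "(\<Sum>z\<in>L. scal (f z) * E z) * E w = scal (f w) * E w" if "w \<in> L" for f w
  proof -
    have "(\<Sum>z\<in>L. scal (f z) * E z) * E w = (\<Sum>z\<in>L. if z = w then scal (f w) * E w else 0)"
      using that spectral_orth[OF LE] spectral_idem[OF LE]
      by (auto simp: sum_distrib_right mult.assoc intro!: sum.cong)
    then show ?thesis
      using that spectral_finite[OF LE] by simp
  qed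
  have sE: "s * E z = scal z * E z" if "z \<in> L" for z
    unfolding s_def by (rule sum_mult[OF that])
  have resolve: "A = B" if "\<And>z. z \<in> L \<Longrightarrow> A * E z = B * E z" for A B
  proof -
    have "A * (\<Sum>z\<in>L. E z) = B * (\<Sum>z\<in>L. E z)"
      unfolding sum_distrib_left using that by (rule sum.cong[OF refl])
    then show ?thesis by (simp add: spectral_sum[OF LE])
  qed
  have tE: "t * E z = scal (1 / z) * E z" if "z \<in> L" for z
    unfolding t_def by (rule sum_mult[OF that])
  have ts: "t * s = 1"
    by (rule resolve) (simp add: mult.assoc sE tE scal_left_commute[of s] scal_left_commute[of t] scal_scal_mult nz)
  have st: "s * t = 1"
    by (rule resolve) (simp add: mult.assoc sE tE scal_left_commute[of s] scal_left_commute[of t] scal_scal_mult nz)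
  have comm: "C * s = s * C" "C * t = t * C" if "C * g = g * C" for C
    using spectral_commute[OF LE _ that]
    by (simp_all add: s_def t_def sum_distrib_left sum_distrib_right scal_left_commute[of C] mult.assoc cong: sum.cong)
  define v where "v = t * g"
  have commv: "C * v = v * C" if "C * g = g * C" for C
    using comm(2)[OF that] that unfolding v_def by (metis mult.assoc)
  have sv: "s * v = g"
    unfolding v_def by (simp add: mult.assoc[symmetric] st)
  have gs: "g * s = s * g" "g * t = t * g"
    by (rule comm; simp)+
  have "v * s = g"
    unfolding v_def by (simp add: mult.assoc gs(1)) (simp add: mult.assoc[symmetric] ts)
  moreover have "semisimple s"
    using spectral_finite[OF LE] sE spectral_sum[OF LE] by (rule semisimpleI)
  moreover have "nilp (v - 1)"
  proof -
    have "(g - s) ^ ?d = 0"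
    proof (rule resolve)
      fix z
      assume z: "z \<in> L"
      \<comment> \<open>On the image of \<open>E z\<close> the commuting matrix \<open>s\<close> may
        be replaced by z, one factor at a time.\<close>
      have "(g - s) ^ k * E z = (g - scal z) ^ k * E z" for k
      proof (induction k)
        case (Suc k)
        have "s * (g - scal z) ^ k = (g - scal z) ^ k * s"
          by (rule power_commuting_commutes[symmetric]) (simp add: algebra_simps gs scal_commute)
        then have "s * (g - scal z) ^ k * E z = scal z * (g - scal z) ^ k * E z"
          by (simp add: mult.assoc sE[OF z] scal_left_commute[of "(g - scal z) ^ k"])
        then show ?case
          by (simp add: mult.assoc Suc.IH) (simp add: mult.assoc[symmetric] left_diff_distrib)
      qed simp
      then show "(g - s) ^ ?d * E z = 0 * E z"
        using spectral_nilp[OF LE z] by simp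
    qed
    then have "nilp (g - s)"
      by (auto simp: nilp_def)
    then have "nilp ((g - s) * t)"
      by (rule nilp_mult) (use gs ts st in \<open>simp add: algebra_simps\<close>)
    also have "(g - s) * t = v - 1"
      by (simp add: left_diff_distrib gs st v_def)
    finally show ?thesis .
  qed
  ultimately have "jordan g s v"
    using sv by (simp add: jordan_def)
  with comm commv that show ?thesis by blast
qed

text \<open>Any decomposition is compared with the one constructed above, whose parts commute with
  everything that commutes with \<open>g\<close>; so all four parts commute.\<close>

lemma jordan_unique:
  assumes "h * g = 1" "g * h = (1 :: 'n::finite sqmat)" and g: "jordan g s v" "jordan g s' v'"
  shows "s = s'" "v = v'"
proof -
  obtain r w where rw: "jordan g r w" and comm: "\<And>C. C * g = g * C \<Longrightarrow> C * r = r * C"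
      "\<And>C. C * g = g * C \<Longrightarrow> C * w = w * C"
    using jordan_exists[OF assms(1,2)] by metis
  have eq: "s = r \<and> v = w" if "jordan g s v" for s v
  proof -
    have g: "g = s * v" "s * v = v * s" "semisimple s" "nilp (v - 1)"
      using that by (auto simp: jordan_def)
    have rw': "g = r * w" "r * w = w * r" "semisimple r" "nilp (w - 1)"
      using rw by (auto simp: jordan_def)
    have sg: "s * g = g * s" "v * g = g * v"
      unfolding g(1) using g(2) by (metis mult.assoc)+
    have sr: "s * r = r * s" "v * w = w * v" "s * w = w * s" "v * r = r * v"
      using comm sg by auto
    obtain L E where LE: "spectral s 1 L E"
      using g(3) by (auto simp: semisimple_def)
    obtain K F where KF: "spectral r 1 K F"
      using rw'(3) by (auto simp: semisimple_def)
    \<comment> \<open>If the eigenspaces of \<open>s\<close> and \<open>r\<close> meet, the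
      intersection contains a vector fixed by both \<open>v\<close> and \<open>w\<close>; on it
      \<open>g\<close> acts as z and as y.\<close>
    have eq: "z = y" if "z \<in> L" "y \<in> K" and nz: "E z * F y \<noteq> 0" for z y
    proof -
      have Er: "r * E z = E z * r"
        using spectral_commute[OF LE \<open>z \<in> L\<close>] sr by metis
      obtain i where i: "(v - 1) ^ i * (E z * F y) \<noteq> 0" "(v - 1) * ((v - 1) ^ i * (E z * F y)) = 0"
        using nilp_last[OF g(4) nz] by blast
      obtain j where j: "(w - 1) ^ j * ((v - 1) ^ i * (E z * F y)) \<noteq> 0"
          "(w - 1) * ((w - 1) ^ j * ((v - 1) ^ i * (E z * F y))) = 0"
        using nilp_last[OF rw'(4) i(1)] by blast
      \<comment> \<open>Applying first \<open>v - 1\<close>, then \<open>w - 1\<close> as often as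
        possible without reaching 0 makes both unipotent parts act trivially.\<close>
      let ?B = "(w - 1) ^ j * ((v - 1) ^ i * (E z * F y))"
      have "(w - 1) ^ j * (v - 1) = (v - 1) * (w - 1) ^ j"
        by (rule power_commuting_commutes) (simp add: algebra_simps sr)
      then have "(v - 1) * ?B = (w - 1) ^ j * ((v - 1) * ((v - 1) ^ i * (E z * F y)))"
        by (intro mult_swap) simp
      then have vB: "v * ?B = ?B"
        using i(2) by (simp add: left_diff_distrib)
      have wB: "w * ?B = ?B"
        using j(2) by (simp add: left_diff_distrib)
      have cs: "s * (w - 1) ^ j = (w - 1) ^ j * s" "s * (v - 1) ^ i = (v - 1) ^ i * s"
        by (rule power_commuting_commutes[symmetric], simp add: algebra_simps sr g)+
      have cr: "r * (w - 1) ^ j = (w - 1) ^ j * r" "r * (v - 1) ^ i = (v - 1) ^ i * r"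
        by (rule power_commuting_commutes[symmetric], simp add: algebra_simps sr rw')+
      have "s * ?B = (w - 1) ^ j * ((v - 1) ^ i * (s * E z * F y))"
        by (simp only: mult_swap[OF cs(1)] mult_swap[OF cs(2)] mult.assoc)
      then have sB: "s * ?B = scal z * ?B"
        by (simp only: spectral_eigen[OF LE \<open>z \<in> L\<close>] mult.assoc
            scal_left_commute[of "(w - 1) ^ j"] scal_left_commute[of "(v - 1) ^ i"])
      have "r * ?B = (w - 1) ^ j * ((v - 1) ^ i * (E z * (r * F y)))"
        by (simp only: mult_swap[OF cr(1)] mult_swap[OF cr(2)] mult_swap[OF Er])
      then have rB: "r * ?B = scal y * ?B"
        by (simp only: spectral_eigen[OF KF \<open>y \<in> K\<close>] mult.assoc scal_left_commute[of "E z"]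
            scal_left_commute[of "(w - 1) ^ j"] scal_left_commute[of "(v - 1) ^ i"])
      have "scal z * ?B = s * (v * ?B)"
        by (simp only: vB sB)
      also have "\<dots> = s * v * ?B"
        by (simp only: mult.assoc)
      also have "s * v = r * w"
        using g(1) rw'(1) by simp
      also have "r * w * ?B = r * (w * ?B)"
        by (simp only: mult.assoc)
      also have "\<dots> = scal y * ?B"
        by (simp only: wB rB)
      finally show ?thesis
        using j(1) scal_mult_cancel by blast
    qed
    \<comment> \<open>After resolving by both families of projections only the terms with z = y
      survive.\<close>
    have "s = (\<Sum>z\<in>L. scal z * E z * (\<Sum>y\<in>K. F y))"
      using spectral_1_expand[OF LE, of 1] by (simp add: spectral_sum[OF KF])
    also have "\<dots> = (\<Sum>z\<in>L. \<Sum>y\<in>K. E z * (scal y * F y))"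
      unfolding sum_distrib_left
      by (intro sum.cong refl) (metis eq mult.assoc scal_left_commute mult_zero_right)
    also have "\<dots> = r"
      using spectral_1_expand[OF KF, of 1]
      by (simp add: sum_distrib_left[symmetric] sum_distrib_right[symmetric] spectral_sum[OF LE])
    finally have "s = r" .
    moreover have "v = w"
    proof -
      have "s * v = s * w"
        using g(1) rw'(1) \<open>s = r\<close> by simp
      moreover have "(h * v) * s = 1"
        using assms(1) g(1,2) by (simp add: mult.assoc)
      ultimately show ?thesis
        by (metis mult.assoc mult_1)
    qed
    ultimately show ?thesis by simp
  qed
  show "s = s'" "v = v'"
    using eq g by metis+
qed

lemma jordan_power:
  assumes "jordan h s v"
  shows "jordan (h ^ k) (s ^ k) (v ^ k)"
proof -
  have h: "h = s * v" "s * v = v * s" "semisimple s" "nilp (v - 1)"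
    using assms by (auto simp: jordan_def)
  have c: "s ^ k * v ^ k = v ^ k * s ^ k" for k
    by (metis h(2) power_commuting_commutes)
  have "h ^ k = s ^ k * v ^ k"
  proof (induction k)
    case (Suc k)
    have "v * s ^ k = s ^ k * v"
      using h(2) by (metis power_commuting_commutes)
    then have "s * v * (s ^ k * v ^ k) = s * s ^ k * (v * v ^ k)"
      by (simp only: mult.assoc mult_swap)
    then show ?case
      by (simp add: Suc.IH) (simp add: h(1))
  qed simp
  \<comment> \<open>\<open>v ^ k - 1\<close> is a multiple of \<open>v - 1\<close> with commuting
    factors, hence nilpotent.\<close>
  moreover have "\<exists>M. v ^ k - 1 = (v - 1) * M \<and> (v - 1) * M = M * (v - 1)"
  proof (induction k)
    case (Suc k)
    then obtain M where M: "v ^ k - 1 = (v - 1) * M" "(v - 1) * M = M * (v - 1)"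
      by blast
    have "v ^ Suc k - 1 = (v ^ k - 1) * v + (v - 1)"
      by (simp add: algebra_simps power_commutes)
    also have "\<dots> = (v - 1) * (M * v + 1)"
      unfolding M(1) by (simp add: algebra_simps)
    finally have "v ^ Suc k - 1 = (v - 1) * (M * v + 1)" .
    moreover have "(v - 1) * (M * v + 1) = (M * v + 1) * (v - 1)"
      using M(2) by (simp add: algebra_simps) (metis mult.assoc)
    ultimately show ?case by blast
  qed (auto intro: exI[of _ 0])
  then have "nilp (v ^ k - 1)"
    using nilp_mult[OF h(4)] by metis
  ultimately show ?thesis
    using c semisimple_power[OF h(3)] by (simp add: jordan_def)
qed

section \<open>Jordan parts in algebraic groups\<close>

text \<open>A formal power series at a nilpotent matrix; the sum stops at the uniform bound for
  nilpotency indices.\<close>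

definition nev :: "complex fps \<Rightarrow> 'n::finite sqmat \<Rightarrow> 'n sqmat" where
  "nev f N = (\<Sum>j<mdim TYPE('n). scal (fps_nth f j) * N ^ j)"

lemma nev_mult:
  fixes N :: "'n::finite sqmat"
  assumes "nilp N"
  shows "nev (f * g) N = nev f N * nev g N"
proof -
  define d where "d = mdim TYPE('n)"
  let ?h = "\<lambda>i j. scal (fps_nth f i * fps_nth g j) * N ^ (i + j)"
  have zero: "N ^ m = 0" if "m \<ge> d" for m
    using that nilp_power_mdim[OF assms] unfolding d_def by (metis le_add_diff_inverse mult_zero_left power_add)
  have prod_term: "scal a * N ^ i * (scal b * N ^ j) = scal (a * b) * N ^ (i + j)" for a b i j
    by (simp only: mult.assoc scal_left_commute[of "N ^ i"] scal_scal_mult power_add)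
  have "nev f N * nev g N = (\<Sum>i<d. \<Sum>j<d. ?h i j)"
    by (simp only: nev_def d_def sum_product prod_term)
  also have "\<dots> = (\<Sum>(i, j)\<in>{..<d} \<times> {..<d}. ?h i j)"
    by (rule sum.cartesian_product)
  \<comment> \<open>Pairs with i + j at least d contribute nothing, which leaves the triangle of the
    Cauchy product.\<close>
  also have "\<dots> = (\<Sum>(i, j)\<in>{(i, j). i + j < d}. ?h i j)"
    by (rule sum.mono_neutral_right) (auto, metis mult_zero_right not_less zero)
  also have "\<dots> = (\<Sum>k<d. \<Sum>i\<le>k. ?h i (k - i))"
    by (rule sum.triangle_reindex)
  also have "\<dots> = (\<Sum>k<d. scal (fps_nth (f * g) k) * N ^ k)"
    by (intro sum.cong refl) (simp add: fps_mult_nth scal_sum sum_distrib_right atLeast0AtMost)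
  finally show ?thesis
    by (simp only: nev_def d_def)
qed

text \<open>The power of \<open>v\<close> with exponent \<open>t\<close> by the binomial
  series.\<close>

definition upow :: "'n::finite sqmat \<Rightarrow> complex \<Rightarrow> 'n sqmat" where
  "upow v t = nev (fps_binomial t) (v - 1)"

lemma upow_add: "nilp (v - 1) \<Longrightarrow> upow v (a + b) = upow v a * upow v b"
  by (simp add: upow_def fps_binomial_add_mult nev_mult)

text \<open>Guarantees that the truncated series reaches the linear term, which
  \<open>upow_1\<close> reads off.\<close>

lemma mdim_ge_2: "\<exists>d. mdim TYPE('n::finite) = Suc (Suc d)"
proof -
  have "mdim TYPE('n) = 2 * (CARD('n) * CARD('n))"
    by simp
  moreover have "CARD('n) * CARD('n) > 0"
    by simp
  ultimately show ?thesis
    by (metis One_nat_def Suc_leI add_Suc_right le_Suc_ex mult_2 plus_1_eq_Suc add_Suc)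
qed

lemma upow_0 [simp]: "upow v 0 = (1 :: 'n::finite sqmat)"
proof -
  obtain d where "mdim TYPE('n) = Suc (Suc d)"
    using mdim_ge_2 by blast
  then show ?thesis
    unfolding upow_def nev_def by (simp only: sum.lessThan_Suc_shift fps_binomial_0) simp
qed

lemma upow_1 [simp]: "upow v 1 = (v :: 'n::finite sqmat)"
proof -
  obtain d where "mdim TYPE('n) = Suc (Suc d)"
    using mdim_ge_2 by blast
  then show ?thesis
    unfolding upow_def nev_def by (simp only: sum.lessThan_Suc_shift fps_binomial_1) simp
qed

lemma upow_of_nat_mult: "nilp (v - 1) \<Longrightarrow> upow v (of_nat n * t) = upow v t ^ n"
  by (induction n) (simp_all add: distrib_right upow_add)

lemma upow_of_nat: "nilp (v - 1) \<Longrightarrow> upow v (of_nat n) = v ^ n"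
  using upow_of_nat_mult[of v n 1] by simp

lemma upow_minus: "nilp (v - 1) \<Longrightarrow> upow v t * upow v (- t) = 1"
  using upow_add[of v t "- t"] by simp

lemma upow_commute:
  assumes "C * v = v * C"
  shows "C * upow v t = upow v t * C"
proof -
  have "(v - 1) ^ j * C = C * (v - 1) ^ j" for j
    by (rule power_commuting_commutes) (simp add: algebra_simps assms)
  then show ?thesis
    by (simp add: upow_def nev_def sum_distrib_left sum_distrib_right scal_left_commute[of C] mult.assoc)
qed

section \<open>Polynomial dependence on the exponent, and exponential polynomials\<close>

lemma gbinomial_poly: "\<exists>p. \<forall>t :: complex. t gchoose j = poly p t"
  by (rule exI[of _ "smult (1 / fact j) (\<Prod>i=0..<j. [:- of_nat i, 1:])"])
    (simp add: gbinomial_prod_rev poly_prod algebra_simps)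

lemma mat_of_sum: "mat_of (sum f I) = (\<Sum>i\<in>I. mat_of (f i))"
  by (rule linear_sum[OF linear_mat_of])

lemma entry_scal_mult: "mat_of (scal z * A) $ a $ b = z * mat_of A $ a $ b"
  by (simp add: mat_mult_entry)

lemma upow_entry_poly: "\<exists>p. \<forall>t. mat_of (upow v t) $ a $ b = poly p t"
proof -
  obtain q where q: "\<And>j t. (t :: complex) gchoose j = poly (q j) t"
    using gbinomial_poly by metis
  show ?thesis
    by (rule exI[of _ "\<Sum>j<mdim TYPE('a). smult (mat_of ((v - 1) ^ j) $ a $ b) (q j)"])
      (simp add: upow_def nev_def mat_of_sum entry_scal_mult q poly_sum mult.commute del: mat_of_simps)
qed

lemma continuous_upow: "continuous_on UNIV (upow v)"
proof -
  have 1: "continuous_on UNIV (\<lambda>t. scal (t gchoose j) :: 'a sqmat)" for j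
  proof -
    obtain q where q: "\<And>t. (t :: complex) gchoose j = poly q t"
      using gbinomial_poly by metis
    have "bounded_linear (scal :: complex \<Rightarrow> 'a sqmat)"
    proof (rule bounded_linear_intro[where K = 1])
      fix r and z :: complex
      show "scal (r *\<^sub>R z) = r *\<^sub>R (scal z :: 'a sqmat)"
        by (simp add: scaleR_conv_of_real scal_mult scal_of_real)
    qed (use norm_scal_le in \<open>auto simp: scal_add\<close>)
    then show ?thesis
      unfolding q by (rule bounded_linear.continuous_on) (intro continuous_intros)
  qed
  show ?thesis
    unfolding upow_def [abs_def] nev_def by (simp, intro continuous_intros 1)
qed

text \<open>Exponential polynomials with nonzero bases. The arguments n and t are kept separate so
  that an identity on the diagonal t = n can be extended to all pairs.\<close>

definition expol :: "(nat \<Rightarrow> complex \<Rightarrow> complex) \<Rightarrow> bool" where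
  "expol f \<longleftrightarrow> (\<exists>M q. finite M \<and> 0 \<notin> M \<and> (\<forall>n t. f n t = (\<Sum>z\<in>M. poly (q z) t * z ^ n)))"

text \<open>Equal bases may occur several times in a natural expansion; their coefficients are
  collected here.\<close>

lemma expolI:
  assumes "finite I" "\<And>i. i \<in> I \<Longrightarrow> c i \<noteq> 0" "\<And>n t. f n t = (\<Sum>i\<in>I. poly (q i) t * c i ^ n)"
  shows "expol f"
proof -
  define r where "r = (\<lambda>z. \<Sum>i\<in>{i \<in> I. c i = z}. q i)"
  have "f n t = (\<Sum>z\<in>c ` I. poly (r z) t * z ^ n)" for n t
  proof -
    have "f n t = (\<Sum>z\<in>c ` I. \<Sum>i\<in>{i \<in> I. c i = z}. poly (q i) t * c i ^ n)"
      unfolding assms(3) by (rule sum.image_gen[OF assms(1)])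
    then show ?thesis
      by (simp add: r_def poly_sum sum_distrib_right)
  qed
  then show ?thesis
    unfolding expol_def using assms(1,2) by (intro exI[of _ "c ` I"] exI[of _ r]) auto
qed

lemma expol_const: "expol (\<lambda>n t. c)"
  by (rule expolI[of "{()}" "\<lambda>_. 1" _ "\<lambda>_. [:c:]"]) auto

lemma expol_add:
  assumes "expol f" "expol g"
  shows "expol (\<lambda>n t. f n t + g n t)"
proof -
  obtain M q where f: "finite M" "0 \<notin> M" "\<And>n t. f n t = (\<Sum>z\<in>M. poly (q z) t * z ^ n)"
    using assms(1) unfolding expol_def by blast
  obtain N r where g: "finite N" "0 \<notin> N" "\<And>n t. g n t = (\<Sum>z\<in>N. poly (r z) t * z ^ n)"
    using assms(2) unfolding expol_def by blast
  show ?thesis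
    by (rule expolI[of "M <+> N" "case_sum id id" _ "case_sum q r"])
      (use f g in \<open>auto simp: sum.Plus\<close>)
qed

lemma expol_mult:
  assumes "expol f" "expol g"
  shows "expol (\<lambda>n t. f n t * g n t)"
proof -
  obtain M q where f: "finite M" "0 \<notin> M" "\<And>n t. f n t = (\<Sum>z\<in>M. poly (q z) t * z ^ n)"
    using assms(1) unfolding expol_def by blast
  obtain N r where g: "finite N" "0 \<notin> N" "\<And>n t. g n t = (\<Sum>z\<in>N. poly (r z) t * z ^ n)"
    using assms(2) unfolding expol_def by blast
  show ?thesis
  proof (rule expolI[of "M \<times> N" "\<lambda>(z, w). z * w" _ "\<lambda>(z, w). q z * r w"])
    fix n t
    have "f n t * g n t = (\<Sum>z\<in>M. \<Sum>w\<in>N. poly (q z * r w) t * (z * w) ^ n)"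
      unfolding f(3) g(3) sum_product by (intro sum.cong refl) (simp add: power_mult_distrib)
    then show "f n t * g n t = (\<Sum>i\<in>M \<times> N. poly (case i of (z, w) \<Rightarrow> q z * r w) t * (case i of (z, w) \<Rightarrow> z * w) ^ n)"
      by (simp add: sum.cartesian_product case_prod_unfold)
  qed (use f(1,2) g(1,2) in auto)
qed

lemma expol_sum: "(\<And>i. i \<in> I \<Longrightarrow> expol (f i)) \<Longrightarrow> expol (\<lambda>n t. \<Sum>i\<in>I. f i n t)"
  by (induction I rule: infinite_finite_induct) (auto intro: expol_const expol_add)

lemma expol_prod: "(\<And>i. i \<in> I \<Longrightarrow> expol (f i)) \<Longrightarrow> expol (\<lambda>n t. \<Prod>i\<in>I. f i n t)"
  by (induction I rule: infinite_finite_induct) (auto intro: expol_const expol_mult)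

lemma expol_power: "expol f \<Longrightarrow> expol (\<lambda>n t. f n t ^ m)"
  by (induction m) (auto intro: expol_const expol_mult)

lemma poly_shift_invariant:
  fixes p :: "complex poly"
  assumes "pcompose p [:1, 1:] = p"
  shows "p = [:poly p 0:]"
proof -
  have "poly p (of_nat n) = poly p 0" for n
  proof (induction n)
    case (Suc n)
    have "poly p (of_nat (Suc n)) = poly (pcompose p [:1, 1:]) (of_nat n)"
      by (simp add: poly_pcompose add.commute)
    then show ?case
      by (simp add: assms Suc)
  qed simp
  then have "range of_nat \<subseteq> {z. poly (p - [:poly p 0:]) z = 0}"
    by auto
  moreover have "infinite (range (of_nat :: nat \<Rightarrow> complex))"
    by (simp add: finite_image_iff inj_of_nat)
  ultimately have "p - [:poly p 0:] = 0"
    using poly_roots_finite finite_subset by blast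
  then show ?thesis by simp
qed

text \<open>The operator \<open>S(n) \<mapsto> S(n + 1) - w S(n)\<close> lowers the degree of the coefficient of \<open>w\<^sup>n\<close>
  and keeps the degrees of the other coefficients.\<close>

lemma exp_poly_independent:
  fixes q :: "complex \<Rightarrow> complex poly"
  assumes "finite M" "0 \<notin> M" "\<And>n. (\<Sum>z\<in>M. poly (q z) (of_nat n) * z ^ n) = 0"
  shows "\<forall>z\<in>M. q z = 0"
  using assms(3)
proof (induction "\<Sum>z\<in>M. if q z = 0 then 0 else Suc (degree (q z))" arbitrary: q rule: less_induct)
  case less
  show ?case
  proof (rule ccontr)
    assume "\<not> (\<forall>z\<in>M. q z = 0)"
    then obtain w where w: "w \<in> M" "q w \<noteq> 0"
      by blast
    define r where "r = (\<lambda>z. smult z (pcompose (q z) [:1, 1:]) - smult w (q z))"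
    have lead: "coeff (pcompose p [:1, 1:]) (degree p) = lead_coeff p" for p :: "complex poly"
      using lead_coeff_comp[of "[:1, 1:]" p] by (simp add: degree_pcompose)
    have deg: "degree (r z) \<le> degree (q z)" for z
      unfolding r_def by (intro degree_diff_le) (auto intro: order.trans[OF degree_smult_le] simp: degree_pcompose)
    have r_zero: "r z = 0" if "q z = 0" for z
      using that by (simp add: r_def)
    have r_less: "r w = 0 \<or> degree (r w) < degree (q w)"
      using deg by (intro eq_zero_or_degree_less) (simp_all add: r_def lead)
    have "(\<Sum>z\<in>M. poly (r z) (of_nat n) * z ^ n) = 0" for n
    proof -
      have "(\<Sum>z\<in>M. poly (r z) (of_nat n) * z ^ n) =
        (\<Sum>z\<in>M. poly (q z) (of_nat (Suc n)) * z ^ Suc n) - w * (\<Sum>z\<in>M. poly (q z) (of_nat n) * z ^ n)"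
        by (simp add: r_def poly_pcompose sum_distrib_left sum_subtractf[symmetric] algebra_simps)
      then show ?thesis
        by (simp only: less.prems mult_zero_right diff_zero)
    qed
    moreover have "(\<Sum>z\<in>M. if r z = 0 then 0 else Suc (degree (r z))) <
        (\<Sum>z\<in>M. if q z = 0 then 0 else Suc (degree (q z)))"
    proof (rule sum_strict_mono_ex1[OF assms(1)])
      show "\<forall>z\<in>M. (if r z = 0 then 0 else Suc (degree (r z))) \<le> (if q z = 0 then 0 else Suc (degree (q z)))"
        using deg r_zero by auto
      show "\<exists>z\<in>M. (if r z = 0 then 0 else Suc (degree (r z))) < (if q z = 0 then 0 else Suc (degree (q z)))"
        using w r_less by (intro bexI[of _ w]) auto
    qed
    \<comment> \<open>By induction all new coefficients vanish. The coefficient of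
      \<open>r z\<close> in degree \<open>degree (q z)\<close> is z - w times the leading one of
      \<open>q z\<close>, so only \<open>q w\<close> can remain; it is invariant under the shift,
      hence constant, and the relation for n = 0 makes it 0.\<close>
    ultimately have r0: "r z = 0" if "z \<in> M" for z
      using less.hyps that by blast
    have q0: "q z = 0" if "z \<in> M" "z \<noteq> w" for z
    proof -
      have "coeff (r z) (degree (q z)) = (z - w) * lead_coeff (q z)"
        by (simp add: r_def lead algebra_simps)
      then show ?thesis
        using r0 that by simp
    qed
    have "w \<noteq> 0"
      using assms(2) w(1) by blast
    moreover have "smult w (pcompose (q w) [:1, 1:] - q w) = 0"
      using r0[OF w(1)] by (simp add: r_def smult_diff_right)
    ultimately have "q w = [:poly (q w) 0:]"
      by (intro poly_shift_invariant) simp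
    moreover have "(\<Sum>z\<in>M. poly (q z) (of_nat 0) * z ^ 0) = poly (q w) 0"
      using q0 by (simp add: sum.remove[OF assms(1) w(1)])
    ultimately show False
      using less.prems[of 0] w(2) by auto
  qed
qed

text \<open>On the diagonal the independence of exponential polynomials kills all coefficient
  polynomials, and these determine \<open>f\<close> everywhere.\<close>

lemma expol_zero:
  assumes "expol f" "\<And>n. f n (of_nat n) = 0"
  shows "f n t = 0"
proof -
  obtain M q where *: "finite M" "0 \<notin> M" "\<And>n t. f n t = (\<Sum>z\<in>M. poly (q z) t * z ^ n)"
    using assms(1) unfolding expol_def by blast
  then have "\<forall>z\<in>M. q z = 0"
    using assms(2) by (intro exp_poly_independent) simp_all
  then show ?thesis
    by (simp add: *)
qed

lemma expol_poly_eval: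
  assumes "\<And>a b. expol (\<lambda>n t. F n t $ a $ b)"
  shows "expol (\<lambda>n t. poly_eval p (F n t))"
  unfolding poly_eval_def
  by (intro expol_sum expol_mult expol_const expol_prod) (auto intro!: expol_power assms)

lemma jordan_unit:
  assumes "h * g = 1" "jordan g s v"
  shows "(h * v) * s = 1"
  using assms by (simp add: jordan_def mult.assoc)

text \<open>Since \<open>g ^ n = s ^ n * v ^ n\<close>, the value of \<open>p\<close> at
  \<open>s ^ n * upow v t\<close> is an exponential polynomial that vanishes for t = n, hence
  everywhere. In this way the Jordan parts inherit all equations satisfied by the powers of
  \<open>g\<close>.\<close>

lemma jordan_poly_eval_zero:
  assumes "h * g = 1" "jordan g s v" and zero: "\<And>n. poly_eval p (mat_of (g ^ n)) = 0"
  shows "poly_eval p (mat_of (s ^ n * upow v t)) = 0"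
proof (rule expol_zero[of "\<lambda>n t. poly_eval p (mat_of (s ^ n * upow v t))"])
  have nil: "nilp (v - 1)"
    using assms(2) by (simp add: jordan_def)
  obtain L E where LE: "spectral s 1 L E"
    using assms(2) by (auto simp: jordan_def semisimple_def)
  obtain c where c: "\<And>j t. (t :: complex) gchoose j = poly (c j) t"
    using gbinomial_poly by metis
  let ?I = "L \<times> {..<mdim TYPE('a)}"
  have sE: "s ^ n * E z = scal (z ^ n) * E z" if "z \<in> L" for n z
    by (rule mult_power_eigen[OF spectral_eigen[OF LE that]])
  show "expol (\<lambda>n t. poly_eval p (mat_of (s ^ n * upow v t)))"
  proof (rule expol_poly_eval, rule expolI)
    fix a b n t
    have "s ^ n = (\<Sum>z\<in>L. scal (z ^ n) * E z)"
    proof -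
      have "s ^ n = s ^ n * (\<Sum>z\<in>L. E z)"
        by (simp add: spectral_sum[OF LE])
      then show ?thesis
        by (simp add: sum_distrib_left sE)
    qed
    then have "s ^ n * upow v t =
        (\<Sum>z\<in>L. \<Sum>j<mdim TYPE('a). scal (z ^ n) * E z * (scal (t gchoose j) * (v - 1) ^ j))"
      by (simp only: upow_def nev_def sum_product fps_binomial_nth)
    also have "\<dots> = (\<Sum>(z, j)\<in>?I. scal (z ^ n * (t gchoose j)) * (E z * (v - 1) ^ j))"
      by (simp only: sum.cartesian_product mult.assoc scal_left_commute[of "E _"] scal_scal_mult)
    finally show "mat_of (s ^ n * upow v t) $ a $ b =
      (\<Sum>i\<in>?I. poly (smult (mat_of (E (fst i) * (v - 1) ^ snd i) $ a $ b) (c (snd i))) t * fst i ^ n)"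
      by (simp add: mat_of_sum entry_scal_mult c case_prod_unfold mult_ac del: mat_of_simps)
  qed (use unit_spectral_nonzero[OF jordan_unit[OF assms(1,2)] LE] spectral_finite[OF LE] in auto)
  have "g ^ n = s ^ n * v ^ n" for n
    using jordan_power[OF assms(2), of n] by (simp add: jordan_def)
  then show "poly_eval p (mat_of (s ^ n * upow v (of_nat n))) = 0" for n
    using zero by (simp add: upow_of_nat[OF nil] del: mat_of_simps)
qed

section \<open>Traces of nilpotent and idempotent matrices\<close>

definition tr :: "'n::finite sqmat \<Rightarrow> complex" where
  "tr A = trace (mat_of A)"

lemma tr_0 [simp]: "tr 0 = 0"
  and tr_diff: "tr (A - B) = tr A - tr B"
  and tr_commute: "tr (A * B) = tr (B * A)"
  by (simp_all add: tr_def trace_sub trace_mul_sym[of "mat_of A"]) (simp add: trace_def)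

lemma tr_scal_mult: "tr (scal z * A) = z * tr A"
  by (simp add: tr_def trace_def mat_mult_entry sum_distrib_left)

text \<open>\<open>Q\<close> is the matrix of a linear section of \<open>N\<close> over its
  range.\<close>

lemma exists_generalized_inverse: "\<exists>Q. N * Q * N = (N :: 'n::finite sqmat)"
proof -
  obtain g where g: "Vector_Spaces.linear (*s) (*s) g" "\<forall>x\<in>range ((*v) (mat_of N)). mat_of N *v g x = x"
    using vec.linear_exists_right_inverse_on[OF matrix_vector_mul_linear_gen[of "mat_of N"] vec.subspace_UNIV] by blast
  have "mat_of N ** matrix g ** mat_of N = mat_of N"
    unfolding matrix_eq by (simp add: matrix_vector_mul_assoc[symmetric] matrix_works[OF g(1)] g(2))
  then have "N * of_mat (matrix g) * N = N"
    by (simp add: sqmat_eq_iff)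
  then show ?thesis ..
qed

text \<open>With \<open>N Q N = N\<close>, the matrix \<open>N (N Q)\<close> has the trace of \<open>N\<close> and a smaller index of nilpotency.\<close>

lemma tr_nilp:
  assumes "nilp N"
  shows "tr N = 0"
proof -
  have "tr N = 0" if "N ^ Suc m = 0" for m and N :: "'a sqmat"
    using that
  proof (induction m arbitrary: N)
    case (Suc m)
    obtain Q where Q: "N * Q * N = N"
      using exists_generalized_inverse by blast
    have "(N * (N * Q)) ^ Suc j = N ^ Suc j * (N * Q)" for j
    proof (induction j)
      case (Suc j)
      have "(N * (N * Q)) ^ Suc (Suc j) = N * (N * Q) * (N * N ^ j * (N * Q))"
        by (subst power_Suc, subst Suc.IH) simp
      also have "\<dots> = N * (N * Q * N) * (N ^ j * (N * Q))"
        by (simp only: mult.assoc)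
      also have "\<dots> = N ^ Suc (Suc j) * (N * Q)"
        by (simp only: Q) (simp add: mult.assoc)
      finally show ?case .
    qed simp
    then have "(N * (N * Q)) ^ Suc m = N ^ Suc (Suc m) * Q"
      by (simp only: power_Suc2[of N "Suc m"] mult.assoc)
    then have "tr (N * (N * Q)) = 0"
      using Suc by simp
    moreover have "tr (N * (N * Q)) = tr (N * Q * N)"
      by (rule tr_commute)
    ultimately show ?case
      by (simp add: Q)
  qed simp
  moreover obtain m where "N ^ Suc m = 0"
    using assms by (metis mult_zero_right nilp_def power_Suc)
  ultimately show ?thesis by blast
qed

text \<open>A nonzero idempotent splits off the rank-one idempotent \<open>P U P / c\<close>, where \<open>U\<close> is a matrix unit
  and \<open>c\<close> a nonzero entry of \<open>P\<close>.\<close>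

lemma tr_idempotent:
  fixes P :: "'n::finite sqmat"
  assumes "P * P = P"
  shows "\<exists>r :: nat. tr P = of_nat r \<and> (P \<noteq> 0 \<longrightarrow> r \<noteq> 0)"
  using assms
proof (induction "dim (range (\<lambda>X. mat_of (P * X)))" arbitrary: P rule: less_induct)
  case less
  show ?case
  proof (cases "P = 0")
    case False
    then obtain i j where ij: "mat_of P $ i $ j \<noteq> 0"
      by (auto simp: sqmat_eq_iff vec_eq_iff)
    define c where "c = mat_of P $ i $ j"
    define U :: "'n sqmat" where "U = of_mat (\<chi> a b. if a = j \<and> b = i then 1 else 0)"
    have UX: "mat_of (U * X) $ a $ b = (if a = j then mat_of X $ i $ b else 0)" for X a b
      by (simp add: U_def matrix_matrix_mult_def if_distrib[of "\<lambda>x. x * _"] if_conn cong: if_cong)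
    have "U * P * U = U * (P * U)"
      by (rule mult.assoc)
    also have "\<dots> = scal c * U"
      by (simp add: sqmat_eq_iff vec_eq_iff UX mat_mult_entry del: mat_of_simps)
        (simp add: U_def matrix_matrix_mult_def if_distrib[of "\<lambda>x. _ * x"] mat_mult_entry mat_def c_def if_conn cong: if_cong)
    finally have UPU: "U * P * U = scal c * U" .
    have trUP: "tr (U * P) = c"
      by (simp add: tr_def trace_def UX c_def del: mat_of_simps)
    define R where "R = scal (1 / c) * (P * U * P)"
    have "c \<noteq> 0"
      using ij by (simp add: c_def)
    have PR: "P * R = R"
    proof -
      have "P * (P * X) = P * X" for X
        by (simp only: mult.assoc[symmetric] less.prems)
      then show ?thesis
        by (simp only: R_def scal_left_commute[of P] mult.assoc)
    qed
    have RP: "R * P = R"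
      by (simp add: R_def mult.assoc less.prems)
    have "R * R = scal (1 / c) * (scal (1 / c) * (P * (U * (P * P) * U) * P))"
      by (simp only: R_def mult.assoc scal_left_commute[of P] scal_left_commute[of U])
    also have "\<dots> = scal (1 / c) * (scal (1 / c * c) * (P * U * P))"
    proof -
      have "U * (P * (U * X)) = scal c * (U * X)" for X
        by (simp only: mult.assoc[symmetric] UPU)
      then show ?thesis
        by (simp only: less.prems mult.assoc scal_left_commute[of P] scal_scal_mult)
    qed
    finally have RR: "R * R = R"
      using \<open>c \<noteq> 0\<close> by (simp add: R_def)
    have "tr R = 1 / c * tr (U * P * P)"
      by (simp only: R_def tr_scal_mult mult.assoc tr_commute[of P])
    then have trR: "tr R = 1"
      using \<open>c \<noteq> 0\<close> by (simp add: mult.assoc less.prems trUP)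
    have idem: "(P - R) * (P - R) = P - R"
      by (simp add: algebra_simps less.prems PR RP RR)
    have sub: "subspace (range (\<lambda>X. mat_of (A * X)))" for A :: "'n sqmat"
      using linear_compose[OF bounded_linear.linear[OF bounded_linear_mult_right] linear_mat_of, of A]
      unfolding o_def by (rule linear_subspace_image[OF _ subspace_UNIV])
    \<comment> \<open>\<open>R\<close> lies in the right ideal generated by \<open>P\<close> but not
      in that of \<open>P - R\<close>, so the dimension drops.\<close>
    have "range (\<lambda>X. mat_of ((P - R) * X)) \<subset> range (\<lambda>X. mat_of (P * X))"
    proof
      show "range (\<lambda>X. mat_of ((P - R) * X)) \<subseteq> range (\<lambda>X. mat_of (P * X))"
      proof safe
        fix X
        have "(P - R) * X = P * ((P - R) * X)"
          by (simp add: algebra_simps mult.assoc[symmetric] less.prems PR)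
        then show "mat_of ((P - R) * X) \<in> range (\<lambda>X. mat_of (P * X))"
          by (metis rangeI)
      qed
      show "range (\<lambda>X. mat_of ((P - R) * X)) \<noteq> range (\<lambda>X. mat_of (P * X))"
      proof
        assume "range (\<lambda>X. mat_of ((P - R) * X)) = range (\<lambda>X. mat_of (P * X))"
        then have "mat_of (P * R) \<in> range (\<lambda>X. mat_of ((P - R) * X))"
          by blast
        then obtain X where X: "R = (P - R) * X"
          by (auto simp: PR sqmat_eq_iff)
        have "R = (P - R) * (P - R) * X"
          unfolding idem by (rule X)
        also have "\<dots> = (P - R) * R"
          by (simp only: mult.assoc X[symmetric])
        also have "\<dots> = 0"
          by (simp add: left_diff_distrib PR RR)
        finally show False
          using trR by simp
      qed
    qed
    then have "dim (range (\<lambda>X. mat_of ((P - R) * X))) < dim (range (\<lambda>X. mat_of (P * X)))"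
      by (intro dim_psubset) (simp only: span_eq_iff[THEN iffD2, OF sub])
    then obtain r :: nat where "tr (P - R) = of_nat r"
      using less.hyps idem by blast
    then have "tr P = of_nat (Suc r)"
      by (simp add: tr_diff trR algebra_simps)
    then show ?thesis by blast
  qed (auto intro: exI[of _ 0])
qed

text \<open>The pairs (z, a) with \<open>F a * E z\<close> nonzero inject into \<open>T\<close>, so
  there are at most \<open>card L\<close> of them, and each z has at least one because the
  \<open>F a\<close> sum to 1.\<close>

lemma spectral_single:
  assumes LE: "spectral s 1 L E" and KF: "spectral l m K F"
    and fin: "finite T" "card T \<le> card L"
    and f: "\<And>z a. z \<in> L \<Longrightarrow> a \<in> K \<Longrightarrow> F a * E z \<noteq> 0 \<Longrightarrow> f z a \<in> T"
    and inj: "\<And>z a w b. z \<in> L \<Longrightarrow> a \<in> K \<Longrightarrow> F a * E z \<noteq> 0 \<Longrightarrow>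
      w \<in> L \<Longrightarrow> b \<in> K \<Longrightarrow> F b * E w \<noteq> 0 \<Longrightarrow> f z a = f w b \<Longrightarrow> z = w \<and> a = b"
    and z: "z \<in> L"
  obtains a where "a \<in> K" "F a * E z \<noteq> 0" "\<And>b. b \<in> K \<Longrightarrow> b \<noteq> a \<Longrightarrow> F b * E z = 0"
proof -
  define S where "S = (\<lambda>z. {a \<in> K. F a * E z \<noteq> 0})"
  have finS: "finite (S z)" for z
    using spectral_finite[OF KF] by (simp add: S_def)
  have "card (Sigma L S) \<le> card T"
  proof (rule card_inj_on_le[of "\<lambda>(z, a). f z a"])
    show "inj_on (\<lambda>(z, a). f z a) (Sigma L S)"
      by (auto simp: inj_on_def S_def dest: inj)
    show "(\<lambda>(z, a). f z a) ` Sigma L S \<subseteq> T"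
      using f by (auto simp: S_def)
  qed (rule fin)
  then have le: "(\<Sum>z\<in>L. card (S z)) \<le> (\<Sum>z\<in>L. 1)"
    using fin(2) spectral_finite[OF LE] finS by simp
  have ge: "card (S z) \<ge> 1" if "z \<in> L" for z
  proof -
    have "S z \<noteq> {}"
    proof
      assume "S z = {}"
      then have "(\<Sum>a\<in>K. F a * E z) = 0"
        by (simp add: S_def)
      then show False
        using spectral_resolve[OF KF, of "E z"] spectral_nonzero[OF LE that] by simp
    qed
    then show ?thesis
      using finS[of z] by (simp add: Suc_le_eq card_gt_0_iff)
  qed
  have "card (S z) = 1"
  proof (rule ccontr)
    assume "card (S z) \<noteq> 1"
    then have "1 < card (S z)"
      using ge[OF z] by linarith
    then have "(\<Sum>z\<in>L. 1) < (\<Sum>z\<in>L. card (S z))"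
      using ge z spectral_finite[OF LE] by (intro sum_strict_mono_ex1) auto
    with le show False by simp
  qed
  then obtain a where "S z = {a}"
    by (auto simp: card_1_singleton_iff)
  then show ?thesis
    using that[of a] by (auto simp: S_def)
qed

lemma norm_scal_mult: "norm (scal z * A) = norm z * norm A"
proof (rule antisym)
  show le: "norm (scal z * A) \<le> norm z * norm A" for z and A :: "'a sqmat"
    by (rule order.trans[OF norm_mult_ineq mult_right_mono[OF norm_scal_le]]) simp
  show "norm z * norm A \<le> norm (scal z * A)"
  proof (cases "z = 0")
    case False
    have "norm A = norm (scal (1 / z) * (scal z * A))"
      using False by (simp add: scal_scal_mult)
    also have "\<dots> \<le> norm (1 / z) * norm (scal z * A)"
      by (rule le)
    finally show ?thesis
      using False by (simp add: norm_divide field_simps)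
  qed simp
qed

text \<open>By continuity \<open>(l - 1) ^ m\<close> is close to \<open>(v - 1) ^ m = 0\<close> for
  m the dimension bound, and its norm dominates \<open>norm (a - 1) ^ m\<close>.\<close>

lemma eigenvalues_near_1:
  assumes "nilp (v - (1 :: 'n::finite sqmat))" "e > 0"
  shows "\<exists>d>0. \<forall>l B a. dist l v < d \<longrightarrow> B \<noteq> 0 \<longrightarrow> l * B = scal a * B \<longrightarrow> norm (a - 1) < e"
proof -
  let ?m = "mdim TYPE('n)"
  have "isCont (\<lambda>l. norm ((l - 1) ^ ?m)) v"
    by (intro continuous_intros)
  moreover have "norm ((v - 1) ^ ?m) < e ^ ?m"
    using nilp_power_mdim[OF assms(1)] assms(2) by simp
  ultimately have "\<forall>\<^sub>F l in nhds v. norm ((l - 1) ^ ?m) < e ^ ?m"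
    by (metis eventually_nhds_x_imp_x filterlim_def isContD order_tendstoD(2) tendsto_at_iff_tendsto_nhds)
  then obtain d where d: "d > 0" "\<And>l. dist l v < d \<Longrightarrow> norm ((l - 1) ^ ?m) < e ^ ?m"
    by (auto simp: eventually_nhds_metric)
  have "norm (a - 1) < e" if "dist l v < d" "B \<noteq> 0" "l * B = scal a * B" for l B a
  proof -
    have "(l - 1) * B = scal (a - 1) * B"
      by (simp add: left_diff_distrib scal_diff that(3))
    then have "norm (a - 1) ^ ?m * norm B = norm ((l - 1) ^ ?m * B)"
      by (simp add: mult_power_eigen norm_scal_mult norm_power)
    also have "\<dots> \<le> norm ((l - 1) ^ ?m) * norm B"
      by (rule norm_mult_ineq)
    finally have "norm (a - 1) ^ ?m \<le> norm ((l - 1) ^ ?m)"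
      using that(2) by simp
    also have "\<dots> < e ^ ?m"
      using d(2) that(1) by blast
    finally show ?thesis
      using assms(2) power_less_imp_less_base by fastforce
  qed
  with d(1) show ?thesis by blast
qed

text \<open>If z a = w b with a and b within e of 1, then \<open>norm (z - w)\<close> is at most
  \<open>e * (norm z + norm w)\<close>. Such factors therefore cannot make distinct elements of
  \<open>L\<close> collide.\<close>

lemma separating_radius:
  fixes L :: "complex set"
  assumes "finite L"
  shows "\<exists>e>0. \<forall>z\<in>L. \<forall>w\<in>L. z \<noteq> w \<longrightarrow> e * (norm z + norm w) < norm (z - w)"
proof -
  have "\<forall>\<^sub>F e in at_right 0. \<forall>z\<in>L. \<forall>w\<in>L. z \<noteq> w \<longrightarrow> e * (norm z + norm w) < norm (z - w)"
  proof (intro eventually_ball_finite assms ballI)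
    fix z w :: complex
    show "\<forall>\<^sub>F e in at_right 0. z \<noteq> w \<longrightarrow> e * (norm z + norm w) < norm (z - w)"
    proof (cases "z = w")
      case False
      have "((\<lambda>e. e * (norm z + norm w)) \<longlongrightarrow> 0 * (norm z + norm w)) (at_right 0)"
        by (intro tendsto_intros)
      then have "\<forall>\<^sub>F e in at_right 0. e * (norm z + norm w) < norm (z - w)"
        using False by (intro order_tendstoD) auto
      then show ?thesis
        by eventually_elim simp
    qed simp
  qed
  moreover have "\<forall>\<^sub>F e :: real in at_right 0. e > 0"
    by (rule eventually_at_right_less)
  ultimately have "\<forall>\<^sub>F e in at_right 0. e > 0 \<and> (\<forall>z\<in>L. \<forall>w\<in>L. z \<noteq> w \<longrightarrow> e * (norm z + norm w) < norm (z - w))"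
    by eventually_elim blast
  then show ?thesis
    by (rule eventually_happens'[rotated]) simp
qed

section \<open>Semisimple elements near the identity\<close>

definition polymat :: "(complex \<Rightarrow> 'n::finite sqmat) \<Rightarrow> bool" where
  "polymat F \<longleftrightarrow> (\<forall>a b. \<exists>p. \<forall>t. mat_of (F t) $ a $ b = poly p t)"

lemma polymat_const: "polymat (\<lambda>t. A)"
  unfolding polymat_def by (metis poly_const_conv poly_pCons mult_zero_right add.right_neutral poly_0)

lemma polymat_mult:
  assumes "polymat F" "polymat G"
  shows "polymat (\<lambda>t. F t * G t)"
proof -
  obtain p q where pq: "\<And>a b t. mat_of (F t) $ a $ b = poly (p a b) t"
      "\<And>a b t. mat_of (G t) $ a $ b = poly (q a b) t"
    using assms unfolding polymat_def by metis
  show ?thesis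
    unfolding polymat_def
  proof (intro allI)
    fix a b
    show "\<exists>r. \<forall>t. mat_of (F t * G t) $ a $ b = poly r t"
      by (rule exI[of _ "\<Sum>c\<in>UNIV. p a c * q c b"]) (simp add: matrix_matrix_mult_def pq poly_sum)
  qed
qed

lemma polymat_diff:
  assumes "polymat F" "polymat G"
  shows "polymat (\<lambda>t. F t - G t)"
  using assms unfolding polymat_def by (metis mat_of_simps(4) poly_diff vector_minus_component)

lemma polymat_power: "polymat F \<Longrightarrow> polymat (\<lambda>t. F t ^ m)"
  by (induction m) (auto intro: polymat_const polymat_mult)

lemma polymat_upow: "polymat (upow v)"
  unfolding polymat_def using upow_entry_poly by blast

lemma polymat_scal_tr:
  assumes "polymat F"
  shows "polymat (\<lambda>t. scal (tr (F t) / c))"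
proof -
  obtain p where p: "\<And>a b t. mat_of (F t) $ a $ b = poly (p a b) t"
    using assms unfolding polymat_def by metis
  show ?thesis
    unfolding polymat_def
  proof (intro allI)
    fix a b
    show "\<exists>q. \<forall>t. mat_of (scal (tr (F t) / c)) $ a $ b = poly q t"
      by (rule exI[of _ "if a = b then smult (1 / c) (\<Sum>i\<in>UNIV. p i i) else 0"])
        (simp add: tr_def trace_def p mat_def poly_sum)
  qed
qed

lemma polymat_zero:
  assumes "polymat F" "infinite {t. F t = 0}"
  shows "F t = 0"
proof -
  have "mat_of (F t) $ a $ b = 0" for a b
  proof -
    obtain p where p: "\<And>t. mat_of (F t) $ a $ b = poly p t"
      using assms(1) unfolding polymat_def by metis
    have "{t. F t = 0} \<subseteq> {t. poly p t = 0}"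
      by (auto simp: p[symmetric])
    then have "p = 0"
      using assms(2) poly_roots_finite finite_subset by blast
    then show ?thesis
      by (simp add: p)
  qed
  then show ?thesis
    by (simp add: sqmat_eq_iff vec_eq_iff)
qed

lemma inverse_commute:
  fixes a b c :: "'a::monoid_mult"
  assumes "b * a = 1" "a * b = 1" "a * c = c * a"
  shows "b * c = c * b"
proof -
  have "b * c = b * (c * a) * b"
    by (simp add: mult.assoc assms(2))
  also have "\<dots> = b * a * (c * b)"
    by (simp only: assms(3)[symmetric] mult.assoc)
  finally show ?thesis
    by (simp add: assms(1))
qed

text \<open>For some y the block \<open>E y * B\<close> is nonzero. Applying \<open>v - 1\<close> to
  it up to the last nonzero power gives an eigenvector on which \<open>v\<close> is the identity and
  \<open>s\<close> is y; there \<open>g\<close> acts both as z and as y.\<close>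

lemma spec_subset_spectral:
  assumes g: "g = s * v" "s * v = v * s" "nilp (v - 1)" and LE: "spectral s 1 L E"
  shows "spec g \<subseteq> L"
proof
  fix z
  assume "z \<in> spec g"
  then obtain B where B: "B \<noteq> 0" "g * B = scal z * B"
    by (auto simp: spec_def)
  have "\<exists>y\<in>L. E y * B \<noteq> 0"
  proof (rule ccontr)
    assume "\<not> (\<exists>y\<in>L. E y * B \<noteq> 0)"
    then have "(\<Sum>y\<in>L. E y * B) = 0"
      by simp
    then show False
      using B(1) spectral_resolve[OF LE, of B] by simp
  qed
  then obtain y where y: "y \<in> L" "E y * B \<noteq> 0"
    by blast
  obtain i where i: "(v - 1) ^ i * (E y * B) \<noteq> 0" "(v - 1) * ((v - 1) ^ i * (E y * B)) = 0"
    using nilp_last[OF g(3) y(2)] by blast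
  let ?B = "(v - 1) ^ i * (E y * B)"
  have vB: "v * ?B = ?B"
    using i(2) by (simp add: left_diff_distrib)
  have sv: "s * (v - 1) ^ i = (v - 1) ^ i * s"
    by (rule power_commuting_commutes[symmetric]) (simp add: algebra_simps g(2))
  have "s * ?B = (v - 1) ^ i * (s * E y * B)"
    by (simp only: mult_swap[OF sv] mult.assoc)
  then have sB: "s * ?B = scal y * ?B"
    by (simp only: spectral_eigen[OF LE y(1)] mult.assoc scal_left_commute[of "(v - 1) ^ i"])
  have gv: "g * (v - 1) ^ i = (v - 1) ^ i * g"
    by (rule power_commuting_commutes[symmetric]) (simp add: algebra_simps g(1) g(2))
  have "g * s = s * g"
    unfolding g(1) by (metis g(2) mult.assoc)
  then have gE: "g * E y = E y * g"
    by (rule spectral_commute[OF LE y(1)])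
  have "g * ?B = scal z * ?B"
    by (simp only: mult_swap[OF gv] mult_swap[OF gE] B(2) scal_left_commute[of "E y"] scal_left_commute[of "(v - 1) ^ i"])
  moreover have "g * ?B = scal y * ?B"
    unfolding g(1) mult.assoc vB by (rule sB)
  ultimately have "z = y"
    using i(1) scal_mult_cancel by metis
  then show "z \<in> L"
    using y(1) by simp
qed

locale matrix_group =
  fixes H :: "'n::finite sqmat set"
  assumes one_closed: "1 \<in> H"
    and mult_closed: "a \<in> H \<Longrightarrow> b \<in> H \<Longrightarrow> a * b \<in> H"
    and inv_closed: "a \<in> H \<Longrightarrow> \<exists>b\<in>H. b * a = 1 \<and> a * b = 1"
begin

lemma power_closed: "a \<in> H \<Longrightarrow> a ^ m \<in> H"
  by (induction m) (auto intro: one_closed mult_closed)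

end

text \<open>Isolates what algebraicity contributes to the density argument: semisimple parts and
  real powers of unipotent parts stay in the group.\<close>

locale jordan_closed_group = matrix_group H
  for H :: "'n::finite sqmat set" +
  assumes jordan_closed: "g \<in> H \<Longrightarrow> jordan g s v \<Longrightarrow> s \<in> H"
    and upow_closed: "g \<in> H \<Longrightarrow> jordan g s v \<Longrightarrow> upow v (of_real t) \<in> H"
begin

text \<open>An eigenvalue a of \<open>l\<close> on the image of \<open>E z\<close> makes z a an
  eigenvalue of \<open>s * l\<close>, which is close to \<open>g\<close>. Distinct pairs give
  distinct products, so local maximality of the number of eigenvalues leaves one a for each
  z.\<close>

lemma locally_single_eigenvalue:
  assumes g: "g \<in> H" "jordan g s v" and LE: "spectral s 1 L E"
    and e: "e > 0" "\<And>g'. g' \<in> H \<Longrightarrow> dist g' g < e \<Longrightarrow> card (spec g') \<le> card (spec g)"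
  obtains d where "d > 0"
    "\<And>l z. l \<in> H \<Longrightarrow> l * s = s * l \<Longrightarrow> dist l v < d \<Longrightarrow> z \<in> L \<Longrightarrow> \<exists>a. nilp ((l - scal a) * E z)"
proof -
  have jd: "g = s * v" "s * v = v * s" "semisimple s" "nilp (v - 1)"
    using g(2) by (auto simp: jordan_def)
  have card_spec: "card (spec g) \<le> card L"
    by (rule card_mono[OF spectral_finite[OF LE] spec_subset_spectral[OF jd(1,2,4) LE]])
  obtain h where h: "h * g = 1"
    using inv_closed[OF g(1)] by blast
  have nz: "z \<noteq> 0" if "z \<in> L" for z
    using unit_spectral_nonzero[OF jordan_unit[OF h g(2)] LE that] .
  obtain r where r: "r > 0" "\<And>z w. z \<in> L \<Longrightarrow> w \<in> L \<Longrightarrow> z \<noteq> w \<Longrightarrow> r * (norm z + norm w) < norm (z - w)"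
    using separating_radius[OF spectral_finite[OF LE]] by blast
  obtain d where d: "d > 0" "\<And>l B a. dist l v < d \<Longrightarrow> B \<noteq> 0 \<Longrightarrow> l * B = scal a * B \<Longrightarrow> norm (a - 1) < r"
    using eigenvalues_near_1[OF jd(4) r(1)] by blast
  \<comment> \<open>The first bound puts the eigenvalues of \<open>l\<close> within \<open>r\<close>
    of 1, the second puts \<open>s * l\<close> within \<open>e\<close> of \<open>g\<close>; the
    summand 1 keeps the divisor positive.\<close>
  define d' where "d' = min d (e / (norm s + 1))"
  have s1: "norm s + 1 > 0"
    by (simp add: add_nonneg_pos)
  have "d' > 0"
    using d(1) e(1) s1 by (simp add: d'_def)
  moreover have "\<exists>a. nilp ((l - scal a) * E z)"
    if l: "l \<in> H" "l * s = s * l" "dist l v < d'" and z: "z \<in> L" for l z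
  proof -
    let ?m = "mdim TYPE('n)"
    obtain K F where KF: "spectral l ?m K F"
      using exists_spectral by metis
    have "s * l - g = s * (l - v)"
      by (simp add: jd(1) right_diff_distrib)
    then have "dist (s * l) g \<le> norm s * dist l v"
      using norm_mult_ineq[of s "l - v"] by (simp add: dist_norm)
    also have "\<dots> \<le> (norm s + 1) * dist l v"
      by (simp add: mult_right_mono)
    also have "\<dots> < e"
      using l(3) s1 by (simp add: d'_def pos_less_divide_eq mult.commute)
    finally have "card (spec (s * l)) \<le> card (spec g)"
      using g(1) jordan_closed[OF g] l(1) by (intro e(2) mult_closed)
    then have cardT: "card (spec (s * l)) \<le> card L"
      using card_spec by linarith
    have near: "norm (a - 1) < r" if "a \<in> K" "F a * C \<noteq> 0" for a C
      using spectral_eigenvector[OF KF that] d(2)[of l] l(3) unfolding d'_def by (metis min_less_iff_conj)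
    have in_spec: "z * a \<in> spec (s * l)" if "z \<in> L" "a \<in> K" and nzB: "F a * E z \<noteq> 0" for z a
    proof -
      obtain i where i: "(l - scal a) ^ i * (F a * E z) \<noteq> 0"
          "l * ((l - scal a) ^ i * (F a * E z)) = scal a * ((l - scal a) ^ i * (F a * E z))"
        using spectral_eigenvector[OF KF \<open>a \<in> K\<close> nzB] by blast
      have sl: "s * (l - scal a) ^ i = (l - scal a) ^ i * s"
        by (rule power_commuting_commutes[symmetric]) (simp add: algebra_simps l(2) scal_commute)
      have sF: "s * F a = F a * s"
        by (rule spectral_commute[OF KF \<open>a \<in> K\<close>]) (simp add: l(2))
      have "s * l * ((l - scal a) ^ i * (F a * E z)) = scal (z * a) * ((l - scal a) ^ i * (F a * E z))"
        by (simp only: mult.assoc i(2) scal_left_commute[of s] mult_swap[OF sl] mult_swap[OF sF]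
            spectral_eigen[OF LE \<open>z \<in> L\<close>] scal_left_commute[of "F a"] scal_left_commute[of "(l - scal a) ^ i"]
            scal_scal_mult mult.commute[of z])
      with i(1) show ?thesis
        by (rule specI)
    qed
    have inj: "z = w \<and> a = b"
      if "z \<in> L" "a \<in> K" "F a * E z \<noteq> 0" "w \<in> L" "b \<in> K" "F b * E w \<noteq> 0" "z * a = w * b" for z a w b
    proof -
      have "z = w"
      proof (rule ccontr)
        assume "z \<noteq> w"
        have "z - w = z * (1 - a) - w * (1 - b)"
          using that(7) by (simp add: algebra_simps)
        then have "norm (z - w) \<le> norm z * norm (1 - a) + norm w * norm (1 - b)"
          by (metis norm_mult norm_triangle_ineq4)
        also have "\<dots> \<le> norm z * r + norm w * r"
          using near[OF that(2,3)] near[OF that(5,6)]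
          by (intro add_mono mult_left_mono) (simp_all add: norm_minus_commute)
        also have "\<dots> < norm (z - w)"
          using r(2)[OF that(1,4) \<open>z \<noteq> w\<close>] by (simp add: algebra_simps)
        finally show False by simp
      qed
      then show ?thesis
        using that nz by auto
    qed
    obtain a where a: "a \<in> K" "\<And>b. b \<in> K \<Longrightarrow> b \<noteq> a \<Longrightarrow> F b * E z = 0"
      by (rule spectral_single[OF LE KF finite_spec cardT, where f = "\<lambda>z a. z * a", OF in_spec inj z]) blast+
    have "E z = F a * E z"
      using spectral_resolve[OF KF, of "E z"] a spectral_finite[OF KF] by (simp add: sum.remove[OF _ a(1)])
    then have "(l - scal a) ^ ?m * E z = 0"
      using spectral_nilp[OF KF a(1)] by (metis mult.assoc mult_zero_left)
    moreover have "l * E z = E z * l"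
      using spectral_commute[OF LE z] l(2) by blast
    then have "((l - scal a) * E z) ^ ?m = (l - scal a) ^ ?m * E z ^ ?m"
      by (intro commuting_power_distrib) (simp add: algebra_simps scal_commute)
    moreover have "E z ^ ?m = E z * E z ^ (?m - 1)"
      by (rule power_eq_if[THEN trans]) simp
    ultimately have "((l - scal a) * E z) ^ ?m = 0"
      by (simp add: mult.assoc[symmetric])
    then show ?thesis
      unfolding nilp_def by blast
  qed
  ultimately show ?thesis
    using that by blast
qed

text \<open>The single eigenvalue of \<open>upow v t * a\<close> on each \<open>E z\<close>, known
  for t near 1, is transported to t = 0 by polynomial dependence on t. Acting as a scalar on every
  eigenspace of \<open>s\<close>, \<open>a\<close> commutes with \<open>v\<close>, which preserves
  these eigenspaces.\<close>

lemma semisimple_near_1_commutes: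
  assumes g: "g \<in> H" "jordan g s v"
    and e: "e > 0" "\<And>g'. g' \<in> H \<Longrightarrow> dist g' g < e \<Longrightarrow> card (spec g') \<le> card (spec g)"
  obtains c where "c > 0"
    "\<And>a. a \<in> H \<Longrightarrow> semisimple a \<Longrightarrow> a * s = s * a \<Longrightarrow> dist a 1 < c \<Longrightarrow> a * v = v * a"
proof -
  let ?m = "mdim TYPE('n)"
  have jd: "g = s * v" "s * v = v * s" "semisimple s" "nilp (v - 1)"
    using g(2) by (auto simp: jordan_def)
  obtain L E where LE: "spectral s 1 L E"
    using jd(3) by (auto simp: semisimple_def)
  obtain d where d: "d > 0"
    "\<And>l z. l \<in> H \<Longrightarrow> l * s = s * l \<Longrightarrow> dist l v < d \<Longrightarrow> z \<in> L \<Longrightarrow> \<exists>a. nilp ((l - scal a) * E z)"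
    using locally_single_eigenvalue[OF g LE e] by blast
  have "((\<lambda>t :: real. upow v (of_real t)) \<longlongrightarrow> upow v (of_real 1)) (at 1)"
    by (intro isCont_tendsto_compose[OF _ tendsto_of_real[OF tendsto_ident_at]])
      (use continuous_upow[of v] in \<open>simp add: continuous_on_eq_continuous_at\<close>)
  then obtain r where r: "r > 0" "\<And>t. t \<noteq> 1 \<Longrightarrow> dist t 1 < r \<Longrightarrow> dist (upow v (of_real t)) v < d / 2"
    using d(1) unfolding tendsto_iff eventually_at by (metis UNIV_I half_gt_zero of_real_1 upow_1)
  \<comment> \<open>\<open>M\<close> bounds \<open>upow v t\<close> for t near 1. With
    \<open>c\<close> below, the factor \<open>a\<close> moves \<open>upow v t\<close> by less than
    \<open>d / 2\<close>; the other half pays for the distance from \<open>upow v t\<close> to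
    \<open>v\<close>.\<close>
  define M where "M = norm v + d / 2"
  have "M > 0"
    using d(1) by (simp add: M_def add_nonneg_pos)
  define c where "c = d / 2 / M"
  have "c > 0"
    using d(1) \<open>M > 0\<close> by (simp add: c_def)
  moreover have "a * v = v * a" if a: "a \<in> H" "semisimple a" "a * s = s * a" "dist a 1 < c" for a
  proof -
    have scalar: "\<exists>b. a * E z = scal b * E z" if z: "z \<in> L" for z
    proof -
      have "tr (E z) \<noteq> 0"
        using tr_idempotent[OF spectral_idem[OF LE z]] spectral_nonzero[OF LE z] by auto
      \<comment> \<open>Where \<open>upow v t * a\<close> has a single eigenvalue on the image of
        \<open>E z\<close>, that eigenvalue is b(t), because nilpotent matrices have trace 0. As a
        trace, b is polynomial in t.\<close>
      define b where "b = (\<lambda>t. tr (upow v t * a * E z) / tr (E z))"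
      define F where "F = (\<lambda>t. ((upow v t * a - scal (b t)) * E z) ^ ?m)"
      have "polymat F"
        unfolding F_def b_def
        by (intro polymat_power polymat_mult polymat_diff polymat_scal_tr polymat_upow polymat_const)
      moreover have "F (of_real t) = 0" if "t \<in> {1<..<1 + r}" for t
      proof -
        let ?l = "upow v (of_real t) * a"
        have t: "dist (upow v (of_real t)) v < d / 2"
          using that by (intro r(2)) (auto simp: dist_real_def)
        have "norm (upow v (of_real t)) \<le> M"
          using t norm_triangle_sub[of "upow v (of_real t)" v] by (simp add: M_def dist_norm)
        then have "norm (upow v (of_real t) * (a - 1)) \<le> M * norm (a - 1)"
          by (meson mult_right_mono norm_ge_zero norm_mult_ineq order.trans)
        also have "\<dots> < d / 2"
          using a(4) \<open>M > 0\<close> by (simp add: c_def dist_norm field_simps)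
        finally have "dist ?l (upow v (of_real t)) < d / 2"
          by (simp add: dist_norm right_diff_distrib)
        with t have near: "dist ?l v < d"
          using dist_triangle[of ?l v "upow v (of_real t)"] by linarith
        have "s * upow v (of_real t) = upow v (of_real t) * s"
          by (rule upow_commute[OF jd(2)])
        then have "?l * s = s * ?l"
          by (simp add: mult.assoc a(3) mult_swap)
        then obtain x where x: "nilp ((?l - scal x) * E z)"
          using d(2)[OF mult_closed[OF upow_closed[OF g] a(1)] _ near z] by blast
        have "tr (?l * E z) = x * tr (E z)"
          using tr_nilp[OF x] by (simp add: left_diff_distrib tr_diff tr_scal_mult)
        then have "b (of_real t) = x"
          using \<open>tr (E z) \<noteq> 0\<close> by (simp add: b_def)
        then show ?thesis
          using nilp_power_mdim[OF x] by (simp add: F_def)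
      qed
      then have "of_real ` {1<..<1 + r} \<subseteq> {t. F t = 0}"
        by blast
      then have "infinite {t. F t = 0}"
        using r(1) by (meson finite_imageD finite_subset infinite_Ioo inj_on_def less_add_same_cancel1 of_real_eq_iff)
      \<comment> \<open>At t = 0 the unipotent factor is 1: \<open>a - scal (b 0)\<close> is
        nilpotent on the image of \<open>E z\<close>, and the semisimple \<open>a\<close> then acts
        there as the scalar b(0).\<close>
      ultimately have F0: "F 0 = 0"
        by (rule polymat_zero)
      obtain K D where KD: "spectral a 1 K D"
        using a(2) by (auto simp: semisimple_def)
      have aE: "a * E z = E z * a"
        using spectral_commute[OF LE z] a(3) by blast
      have "y = b 0" if y: "y \<in> K" "D y * E z \<noteq> 0" for y
      proof -
        have ED: "E z * D y = D y * E z"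
          using spectral_commute[OF KD y(1), of "E z"] aE by simp
        have "(a - scal (b 0)) * E z * (D y * E z) = scal (y - b 0) * (D y * E z)"
          by (simp add: mult.assoc mult_swap[OF ED] spectral_idem[OF LE z] left_diff_distrib scal_diff)
            (simp add: mult.assoc[symmetric] spectral_eigen[OF KD y(1)])
        then have "F 0 * (D y * E z) = scal ((y - b 0) ^ ?m) * (D y * E z)"
          by (simp add: F_def mult_power_eigen)
        then show ?thesis
          using F0 y(2) by (simp add: scal_mult_eq_0_iff)
      qed
      then have "scal y * D y * E z = scal (b 0) * (D y * E z)" if "y \<in> K" for y
        using that by (metis mult.assoc mult_zero_right)
      then have "a * E z = (\<Sum>y\<in>K. scal (b 0) * (D y * E z))"
        unfolding spectral_1_expand[OF KD] by (rule sum.cong[OF refl])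
      also have "\<dots> = scal (b 0) * E z"
        unfolding sum_distrib_left[symmetric] spectral_resolve[OF KD, symmetric] ..
      finally show ?thesis by blast
    qed
    have Ev: "v * E z = E z * v" if "z \<in> L" for z
      using spectral_commute[OF LE that] jd(2) by metis
    have "a * v = (\<Sum>z\<in>L. a * E z * v)"
      using spectral_resolve[OF LE, of v] by (metis (no_types, lifting) mult.assoc sum.cong sum_distrib_left)
    also have "\<dots> = (\<Sum>z\<in>L. v * (a * E z))"
    proof (rule sum.cong[OF refl])
      fix z
      assume z: "z \<in> L"
      then obtain b where "a * E z = scal b * E z"
        using scalar by blast
      then show "a * E z * v = v * (a * E z)"
        by (simp add: mult.assoc Ev[OF z] scal_left_commute[of v])
    qed
    also have "\<dots> = v * a"
      by (simp add: sum_distrib_left[symmetric] spectral_sum[OF LE])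
    finally show ?thesis .
  qed
  ultimately show ?thesis
    using that by blast
qed

end

section \<open>Density of powers\<close>

lemma norm_root_le:
  fixes x :: complex
  assumes "x ^ m = z" "m > 0"
  shows "norm x \<le> 1 + norm z"
proof (cases "norm x \<le> 1")
  case False
  then have "norm x ^ 1 \<le> norm x ^ m"
    using assms(2) by (intro power_increasing) auto
  then show ?thesis
    by (simp add: assms(1)[symmetric] norm_power)
qed (simp add: add_increasing2)

lemma bounded_sequence_close_terms:
  fixes X :: "nat \<Rightarrow> 'n::finite sqmat"
  assumes "\<And>n. norm (X n) \<le> C" "e > 0"
  obtains i j where "i < j" "dist (X i) (X j) < e"
proof -
  let ?c = "(real CARD('n))\<^sup>2"
  have "mat_of (X n) \<in> cball 0 (?c * C)" for n
    using order.trans[OF norm_mat_of_le mult_left_mono[OF assms(1)]] by simp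
  then obtain l r where r: "strict_mono r" "((\<lambda>n. mat_of (X n)) \<circ> r) \<longlonglongrightarrow> l"
    using compact_cball[of 0 "?c * C"] unfolding compact_def by metis
  have c: "?c > 0"
    by simp
  then have "e / ?c > 0"
    by (intro divide_pos_pos assms(2))
  then obtain N where N: "\<And>m n. m \<ge> N \<Longrightarrow> n \<ge> N \<Longrightarrow> dist (mat_of (X (r m))) (mat_of (X (r n))) < e / ?c"
    using LIMSEQ_imp_Cauchy[OF r(2)] unfolding Cauchy_def o_def by blast
  have "dist (X (r N)) (X (r (Suc N))) \<le> ?c * dist (mat_of (X (r N))) (mat_of (X (r (Suc N))))"
    by (rule dist_le_dist_mat_of)
  also have "\<dots> < e"
    using N[of N "Suc N"] c by (simp only: pos_less_divide_eq mult.commute[of ?c])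
  finally show ?thesis
    using that r(1) by (meson lessI strict_mono_less)
qed

lemma coprime_power_power_minus_1: "m > 0 \<Longrightarrow> coprime (k ^ j) (k ^ m - 1 :: nat)" if "k > 0"
  using coprime_diff_one_right_nat[of "k ^ m"] that by simp

context jordan_closed_group
begin

text \<open>All \<open>h\<^sub>n\<close> are scalar on the eigenspaces of a fixed \<open>h\<^sub>m\<close> whose number of eigenvalues is maximal;
  this bounds the sequence and its inverses.\<close>

lemma iterated_roots_bounded:
  fixes h :: "nat \<Rightarrow> 'n sqmat"
  assumes h: "\<And>n. h n \<in> H" "\<And>n. semisimple (h n)" "\<And>n. h (Suc n) ^ k = h n" and k: "k \<ge> 1"
  obtains m C where "\<And>n. norm (h (m + n)) \<le> C"
    "\<And>n b. b * h (m + n) = 1 \<Longrightarrow> h (m + n) * b = 1 \<Longrightarrow> norm b \<le> C"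
proof -
  have hpow: "h (m + n) ^ (k ^ n) = h m" for m n
    by (induction n) (simp_all add: power_mult h(3))
  \<comment> \<open>The maximum exists because the numbers of eigenvalues are bounded by the
    dimension.\<close>
  obtain m where m: "\<And>n. card (spec (h n)) \<le> card (spec (h m))"
  proof -
    have "\<exists>m. True \<and> (\<forall>n. True \<longrightarrow> card (spec (h n)) \<le> card (spec (h m)))"
      by (rule ex_has_greatest_nat[of "\<lambda>_. True" 0 _ "Suc (mdim TYPE('n))"]) (simp_all only: card_spec_le less_Suc_eq_le simp_thms)
    then show ?thesis
      using that by blast
  qed
  obtain L E where LE: "spectral (h m) 1 L E"
    using h(2) unfolding semisimple_def by blast
  have "card (spec (h m)) \<le> card L"
    by (rule card_mono[OF spectral_finite[OF LE] spec_subset_spectral[OF _ _ _ LE, of _ 1]]) simp_all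
  then have card: "card (spec (h n)) \<le> card L" for n
    using m order.trans by blast
  have nz: "z \<noteq> 0" if "z \<in> L" for z
    using inv_closed[OF h(1)[of m]] unit_spectral_nonzero[OF _ LE that] by blast
  \<comment> \<open>Eigenvalues of \<open>h (m + n)\<close> on different \<open>E z\<close> have
    different powers with exponent \<open>k ^ n\<close>, so they are distinct. As there are at most
    \<open>card L\<close> of them, each \<open>E z\<close> sees only one.\<close>
  have scalar: "\<exists>x. h (m + n) * E z = scal x * E z \<and> x ^ (k ^ n) = z" if z: "z \<in> L" for n z
  proof -
    obtain K F where KF: "spectral (h (m + n)) 1 K F"
      using h(2) unfolding semisimple_def by blast
    have hE: "h (m + n) * E z = E z * h (m + n)" if "z \<in> L" for z
      by (rule spectral_commute[OF LE that]) (metis hpow power_commutes)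
    have pow: "a ^ (k ^ n) = z" if "z \<in> L" "a \<in> K" and FE: "F a * E z \<noteq> 0" for a z
    proof -
      have EF: "E z * F a = F a * E z"
        by (rule spectral_commute[OF KF \<open>a \<in> K\<close>]) (simp add: hE[OF \<open>z \<in> L\<close>])
      have "h (m + n) * (F a * E z) = scal a * (F a * E z)"
        by (simp only: mult.assoc[symmetric] spectral_eigen[OF KF \<open>a \<in> K\<close>])
      then have "h m * (F a * E z) = scal (a ^ (k ^ n)) * (F a * E z)"
        using mult_power_eigen hpow by metis
      moreover have "h m * (F a * E z) = scal z * (F a * E z)"
        by (simp only: EF[symmetric] mult.assoc[symmetric] spectral_eigen[OF LE \<open>z \<in> L\<close>])
      ultimately show ?thesis
        using scal_mult_cancel FE by metis
    qed
    have eig: "h (m + n) * (F a * C) = scal a * (F a * C)" if "a \<in> K" for a C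
      by (simp only: mult.assoc[symmetric] spectral_eigen[OF KF that])
    obtain a where a: "a \<in> K" "F a * E z \<noteq> 0" "\<And>b. b \<in> K \<Longrightarrow> b \<noteq> a \<Longrightarrow> F b * E z = 0"
    proof (rule spectral_single[OF LE KF finite_spec card, where f = "\<lambda>z a. a", OF _ _ z])
      show "a \<in> spec (h (m + n))" if "a \<in> K" "F a * E z \<noteq> 0" for z a
        using that(2) eig[OF that(1)] by (rule specI)
      show "z = w \<and> a = b" if "z \<in> L" "a \<in> K" "F a * E z \<noteq> 0" "w \<in> L" "b \<in> K" "F b * E w \<noteq> 0" "a = b"
        for z a w b
        using pow[OF that(1-3)] pow[OF that(4-6)] that(7) by simp
    qed blast
    have "E z = F a * E z"
      using spectral_resolve[OF KF, of "E z"] a spectral_finite[OF KF] by (simp add: sum.remove[OF _ a(1)])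
    then have "h (m + n) * E z = scal a * E z"
      using eig[OF a(1)] by metis
    with pow[OF z a(1,2)] show ?thesis by blast
  qed
  \<comment> \<open>An eigenvalue x over z satisfies \<open>x ^ (k ^ n) = z\<close>, so 1 + norm z
    bounds x and 1 + norm (1 / z) bounds 1 / x; one constant covers both.\<close>
  define C where "C = (\<Sum>z\<in>L. (1 + norm z + norm (1 / z)) * norm (E z))"
  have bound: "norm A \<le> C"
    if "\<And>z. z \<in> L \<Longrightarrow> \<exists>y. A * E z = scal y * E z \<and> norm y \<le> 1 + norm z + norm (1 / z)" for A
  proof -
    have "A = (\<Sum>z\<in>L. A * E z)"
      by (simp add: sum_distrib_left[symmetric] spectral_sum[OF LE])
    moreover have "norm (A * E z) \<le> (1 + norm z + norm (1 / z)) * norm (E z)" if z: "z \<in> L" for z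
    proof -
      obtain y where "A * E z = scal y * E z" "norm y \<le> 1 + norm z + norm (1 / z)"
        using \<open>\<And>z. z \<in> L \<Longrightarrow> \<exists>y. A * E z = scal y * E z \<and> norm y \<le> 1 + norm z + norm (1 / z)\<close> z by blast
      then show ?thesis
        by (simp only: norm_scal_mult mult_right_mono norm_ge_zero)
    qed
    ultimately show ?thesis
      unfolding C_def by (metis (no_types, lifting) sum_norm_le)
  qed
  have kn: "k ^ n > 0" for n
    using k by simp
  have "norm (h (m + n)) \<le> C" for n
  proof (rule bound)
    fix z
    assume "z \<in> L"
    then obtain x where x: "h (m + n) * E z = scal x * E z" "x ^ (k ^ n) = z"
      using scalar by blast
    have "norm x \<le> 1 + norm z + norm (1 / z)"
      using norm_root_le[OF x(2) kn] by (simp add: add_increasing2)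
    with x(1) show "\<exists>y. h (m + n) * E z = scal y * E z \<and> norm y \<le> 1 + norm z + norm (1 / z)"
      by blast
  qed
  moreover have "norm b \<le> C" if b: "b * h (m + n) = 1" for n b
  proof (rule bound)
    fix z
    assume z: "z \<in> L"
    then obtain x where x: "h (m + n) * E z = scal x * E z" "x ^ (k ^ n) = z"
      using scalar by blast
    have "x \<noteq> 0"
      using x(2) nz[OF z] kn[of n] by (auto simp: zero_power)
    have "E z = b * (h (m + n) * E z)"
      by (simp only: mult.assoc[symmetric] b mult_1)
    also have "\<dots> = scal x * (b * E z)"
      by (simp only: x(1) scal_left_commute[of b])
    finally have "scal (1 / x) * E z = scal (1 / x) * (scal x * (b * E z))"
      by simp
    then have "b * E z = scal (1 / x) * E z"
      using \<open>x \<noteq> 0\<close> by (simp add: scal_scal_mult)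
    moreover have "(1 / x) ^ (k ^ n) = 1 / z"
      by (simp add: power_one_over x(2))
    then have "norm (1 / x) \<le> 1 + norm z + norm (1 / z)"
      using norm_root_le[OF _ kn] by (smt (verit) norm_ge_zero)
    ultimately show "\<exists>y. b * E z = scal y * E z \<and> norm y \<le> 1 + norm z + norm (1 / z)"
      by blast
  qed
  ultimately show ?thesis
    using that by blast
qed

lemma root_of_regular:
  assumes k: "k \<ge> 1" and roots: "\<And>s. s \<in> H \<Longrightarrow> semisimple s \<Longrightarrow> \<exists>h\<in>H. semisimple h \<and> h ^ k = s"
    and g: "g \<in> H" "jordan g s v"
    and e: "e > 0" "\<And>g'. g' \<in> H \<Longrightarrow> dist g' g < e \<Longrightarrow> card (spec g') \<le> card (spec g)"
  shows "\<exists>h\<in>H. h ^ k = g"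
proof -
  have jd: "g = s * v" "s * v = v * s" "semisimple s" "nilp (v - 1)"
    using g(2) by (auto simp: jordan_def)
  obtain c where c: "c > 0"
    "\<And>a. a \<in> H \<Longrightarrow> semisimple a \<Longrightarrow> a * s = s * a \<Longrightarrow> dist a 1 < c \<Longrightarrow> a * v = v * a"
    using semisimple_near_1_commutes[OF g e] by blast
  have "\<exists>h. \<forall>n. (h n \<in> H \<and> semisimple (h n) \<and> (n = 0 \<longrightarrow> h n = s)) \<and> h (Suc n) ^ k = h n"
    by (rule dependent_nat_choice[where P = "\<lambda>n x. x \<in> H \<and> semisimple x \<and> (n = 0 \<longrightarrow> x = s)"
          and Q = "\<lambda>n x y. y ^ k = x"]) (use jd(3) jordan_closed[OF g] roots in auto)
  then obtain h where h: "\<And>n. h n \<in> H" "\<And>n. semisimple (h n)" "h 0 = s" "\<And>n. h (Suc n) ^ k = h n"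
    by blast
  have hpow: "h (m + n) ^ (k ^ n) = h m" for m n
    by (induction n) (simp_all add: power_mult h(4))
  obtain m C where C: "\<And>n. norm (h (m + n)) \<le> C"
    "\<And>n b. b * h (m + n) = 1 \<Longrightarrow> h (m + n) * b = 1 \<Longrightarrow> norm b \<le> C"
    using iterated_roots_bounded[of h, OF h(1,2,4) k] by blast
  have "C \<ge> 0"
    using C(1)[of 0] norm_ge_zero order.trans by blast
  then have "c / (C + 1) > 0"
    using c(1) by simp
  then obtain i j where ij: "i < j" "dist (h (m + i)) (h (m + j)) < c / (C + 1)"
    using bounded_sequence_close_terms[of "\<lambda>n. h (m + n)", OF C(1)] by blast
  define x where "x = h (m + j)"
  obtain b where b: "b \<in> H" "b * x = 1" "x * b = 1"
    using inv_closed[OF h(1)] by (metis x_def)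
  \<comment> \<open>\<open>h (m + i)\<close> is x raised to \<open>k ^ (j - i)\<close>, so its
    product with the inverse of x is \<open>x ^ q\<close>, and this q is prime to k.\<close>
  define q where "q = k ^ (j - i) - 1"
  have "m + j = m + i + (j - i)"
    using ij(1) by simp
  then have xi: "x ^ (Suc q) = h (m + i)"
    unfolding x_def q_def using hpow[of "m + i" "j - i"] k by simp
  define a where "a = x ^ q"
  have ab: "a = h (m + i) * b"
    unfolding a_def xi[symmetric] power_Suc2 mult.assoc b(3) by simp
  have xs: "x ^ (k ^ (m + j)) = s"
    using hpow[of 0 "m + j"] by (simp add: x_def h(3))
  have av: "a * v = v * a"
  proof (rule c(2))
    show "a \<in> H"
      unfolding a_def x_def by (intro power_closed h)
    show "semisimple a"
      unfolding a_def x_def by (intro semisimple_power h)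
    show "a * s = s * a"
      unfolding xs[symmetric] a_def by (simp add: power_add[symmetric] add.commute)
    have "a - 1 = (h (m + i) - x) * b"
      by (simp add: ab left_diff_distrib b(3))
    then have "dist a 1 \<le> dist (h (m + i)) x * norm b"
      by (simp add: dist_norm norm_mult_ineq)
    also have "\<dots> \<le> dist (h (m + i)) x * (C + 1)"
      using C(2)[of b j] b by (intro mult_left_mono) (simp_all add: x_def)
    also have "\<dots> < c"
      using ij(2) \<open>C \<ge> 0\<close> by (simp add: x_def pos_less_divide_eq)
    finally show "dist a 1 < c" .
  qed
  have "coprime (k ^ (m + j)) q"
    unfolding q_def using k ij(1) by (intro coprime_power_power_minus_1) auto
  \<comment> \<open>Bezout expresses x through powers of \<open>s\<close> and \<open>a\<close>, both
    of which commute with \<open>v\<close>.\<close>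
  then obtain y1 y2 where y: "k ^ (m + j) * y1 = q * y2 + 1"
    using bezout_nat[of "k ^ (m + j)" q] k by (auto simp: coprime_iff_gcd_eq_1)
  have sx: "s ^ y1 = a ^ y2 * x"
    unfolding xs[symmetric] a_def power_mult[symmetric] y by (simp add: power_commutes)
  obtain a' where a': "a' * a ^ y2 = 1" "a ^ y2 * a' = 1"
    using inv_closed[OF power_closed[OF power_closed[OF h(1)]]] unfolding a_def x_def by blast
  have xv: "x * v = v * x"
  proof -
    have "a ^ y2 * v = v * a ^ y2" "s ^ y1 * v = v * s ^ y1"
      by (rule power_commuting_commutes, fact av jd(2))+
    moreover from this(1) have "a' * v = v * a'"
      by (rule inverse_commute[OF a'])
    moreover have "x = a' * s ^ y1"
      by (simp add: sx mult.assoc[symmetric] a'(1))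
    ultimately show ?thesis
      by (metis mult.assoc)
  qed
  \<comment> \<open>The index \<open>m + j\<close> is positive because i < j, so \<open>h 1\<close>
    is a power of x.\<close>
  have "h 1 = x ^ (k ^ (m + j - 1))"
    using hpow[of 1 "m + j - 1"] ij(1) by (simp add: x_def)
  then have hv: "v * h 1 = h 1 * v"
    using power_commuting_commutes[OF xv] by simp
  let ?u = "upow v (of_real (1 / real k))"
  have "?u ^ k = upow v (of_nat k * of_real (1 / real k))"
    by (rule upow_of_nat_mult[OF jd(4), symmetric])
  then have "?u ^ k = v"
    using k by simp
  then have "(h 1 * ?u) ^ k = g"
    using commuting_power_distrib[OF upow_commute[OF hv[symmetric]], of _ k] h(3) h(4)[of 0] by (simp add: jd(1))
  moreover have "h 1 * ?u \<in> H"
    by (intro mult_closed h upow_closed[OF g])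
  ultimately show ?thesis by blast
qed

text \<open>The number of eigenvalues is bounded, so it has a maximum on the part of
  \<open>H\<close> within \<open>e\<close> of \<open>g\<close>. A point where it is attained is a
  local maximum in \<open>H\<close>, and there an exact root exists.\<close>

theorem powers_dense:
  assumes "k \<ge> 1" "\<And>s. s \<in> H \<Longrightarrow> semisimple s \<Longrightarrow> \<exists>h\<in>H. semisimple h \<and> h ^ k = s"
    and "g \<in> H" "e > 0"
  shows "\<exists>h\<in>H. dist (h ^ k) g < e"
proof -
  have "\<exists>x. (x \<in> H \<and> dist x g < e) \<and> (\<forall>y. y \<in> H \<and> dist y g < e \<longrightarrow> card (spec y) \<le> card (spec x))"
    by (rule ex_has_greatest_nat[of _ g _ "Suc (mdim TYPE('n))"])
      (use assms(3,4) in \<open>simp_all only: less_Suc_eq_le dist_self simp_thms card_spec_le\<close>)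
  then obtain x where x: "x \<in> H" "dist x g < e"
      "\<And>y. y \<in> H \<Longrightarrow> dist y g < e \<Longrightarrow> card (spec y) \<le> card (spec x)"
    by blast
  obtain b where "b * x = 1" "x * b = 1"
    using inv_closed[OF x(1)] by blast
  then obtain s v where "jordan x s v"
    using jordan_exists by metis
  moreover have "card (spec y) \<le> card (spec x)" if "y \<in> H" "dist y x < e - dist x g" for y
    using that x(3)[of y] dist_triangle[of y g x] by simp
  ultimately show ?thesis
    using root_of_regular[OF assms(1,2) x(1)] x(2) by (metis diff_gt_0_iff_gt)
qed

end

section \<open>The exponential map\<close>

lemma exp_scaleR_of_nat:
  fixes x :: "'a::{real_normed_algebra_1, banach}"
  shows "exp (real n *\<^sub>R x) = exp x ^ n"
proof (induction n)
  case (Suc n)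
  have "exp (x + real n *\<^sub>R x) = exp x * exp (real n *\<^sub>R x)"
    by (rule exp_add_commuting) simp
  then show ?case
    by (simp add: Suc.IH scaleR_add_left)
qed simp

lemma exp_mult_exp_minus:
  fixes x :: "'a::{real_normed_algebra_1, banach}"
  shows "exp x * exp (- x) = 1" "exp (- x) * exp x = 1"
  using exp_add_commuting[of x "- x"] exp_add_commuting[of "- x" x] by simp_all

lemma exp_divide_power:
  fixes x :: "'a::{real_normed_algebra_1, banach}"
  assumes "k \<ge> 1"
  shows "exp ((1 / real k) *\<^sub>R x) ^ k = exp x"
  using exp_scaleR_of_nat[of k "(1 / real k) *\<^sub>R x"] assms by simp

text \<open>The exponential series converges uniformly on each ball by the Weierstrass test.\<close>

lemma continuous_on_exp_algebra:
  "continuous_on UNIV (exp :: 'a::{real_normed_algebra_1, banach} \<Rightarrow> 'a)"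
proof -
  have "continuous_on (ball 0 r) (exp :: 'a \<Rightarrow> 'a)" for r
  proof -
    have "uniform_limit (ball 0 r) (\<lambda>n (x :: 'a). \<Sum>i<n. x ^ i /\<^sub>R fact i) (\<lambda>x. suminf (\<lambda>i. x ^ i /\<^sub>R fact i)) sequentially"
    proof (rule Weierstrass_m_test)
      fix n and x :: 'a
      assume "x \<in> ball 0 r"
      then have "norm (x ^ n) \<le> r ^ n"
        by (intro order.trans[OF norm_power_ineq] power_mono) simp_all
      then show "norm (x ^ n /\<^sub>R fact n) \<le> r ^ n /\<^sub>R fact n"
        by (simp add: mult_left_mono)
    qed (rule summable_exp_generic)
    then have "uniform_limit (ball 0 r) (\<lambda>n (x :: 'a). \<Sum>i<n. x ^ i /\<^sub>R fact i) exp sequentially"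
      by (simp add: exp_def [abs_def])
    then show ?thesis
      by (rule uniform_limit_theorem[rotated]) (auto intro!: always_eventually continuous_intros)
  qed
  then have "isCont (exp :: 'a \<Rightarrow> 'a) x" for x
    using continuous_on_interior[of "ball 0 (norm x + 1)" exp x] by simp
  then show ?thesis
    by (simp add: continuous_at_imp_continuous_on)
qed

lemmas isCont_exp_algebra = continuous_on_exp_algebra[unfolded continuous_on_eq_continuous_at[OF open_UNIV], rule_format, OF UNIV_I]

lemma norm_exp_remainder_le:
  fixes x :: "'a::{real_normed_algebra_1, banach}"
  shows "norm (exp x - 1 - x) \<le> (norm x)\<^sup>2 * exp (norm x)"
proof -
  have "(\<lambda>n. x ^ (n + 2) /\<^sub>R fact (n + 2)) sums (exp x - (\<Sum>i<2. x ^ i /\<^sub>R fact i))"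
    by (rule sums_split_initial_segment[OF exp_converges])
  then have s: "(\<lambda>n. x ^ (n + 2) /\<^sub>R fact (n + 2)) sums (exp x - 1 - x)"
    by (simp add: numeral_2_eq_2 algebra_simps)
  have t: "(\<lambda>n. (norm x)\<^sup>2 * (norm x ^ n /\<^sub>R fact n)) sums ((norm x)\<^sup>2 * exp (norm x))"
    by (rule sums_mult[OF exp_converges])
  have "norm (x ^ (n + 2) /\<^sub>R fact (n + 2)) \<le> (norm x)\<^sup>2 * (norm x ^ n /\<^sub>R fact n)" for n
  proof -
    have "norm (x ^ (n + 2)) \<le> (norm x)\<^sup>2 * norm x ^ n"
      using norm_power_ineq[of x "n + 2"] by (simp only: power_add mult.commute)
    moreover have "1 / fact (n + 2) \<le> 1 / (fact n :: real)"
      by (intro divide_left_mono fact_mono) simp_all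
    ultimately have "1 / fact (n + 2) * norm (x ^ (n + 2)) \<le> 1 / fact n * ((norm x)\<^sup>2 * norm x ^ n)"
      by (intro mult_mono) simp_all
    then show ?thesis
      by (simp add: inverse_eq_divide mult_ac)
  qed
  then have "norm (suminf (\<lambda>n. x ^ (n + 2) /\<^sub>R fact (n + 2))) \<le> suminf (\<lambda>n. (norm x)\<^sup>2 * (norm x ^ n /\<^sub>R fact n))"
    by (intro norm_suminf_le sums_summable[OF t])
  then show ?thesis
    unfolding sums_unique[OF s, symmetric] sums_unique[OF t, symmetric] .
qed

lemma has_derivative_exp_0:
  "(exp has_derivative (\<lambda>x. x)) (at (0 :: 'a::{real_normed_algebra_1, banach}))"
proof (rule has_derivativeI_sandwich[of 1])
  fix y :: 'a
  assume "y \<noteq> 0" "dist y 0 < 1"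
  then have "norm (exp y - 1 - y) \<le> (norm y)\<^sup>2 * exp 1"
    by (intro order.trans[OF norm_exp_remainder_le] mult_left_mono) simp_all
  then show "norm ((exp y - exp 0) - (y - 0)) / norm (y - 0) \<le> norm y * exp 1"
    using \<open>y \<noteq> 0\<close> by (simp add: pos_divide_le_eq power2_eq_square mult_ac)
next
  show "((\<lambda>y :: 'a. norm y * exp 1) \<longlongrightarrow> 0) (at 0)"
    by (auto intro!: tendsto_eq_intros)
qed (simp_all add: bounded_linear_ident)

lemma exp_commute:
  fixes x :: "'a::{real_normed_algebra_1, banach}"
  assumes "c * x = x * c"
  shows "c * exp x = exp x * c"
proof -
  have "x ^ n * c = c * x ^ n" for n
    by (rule power_commuting_commutes) (simp add: assms)
  then have "(\<lambda>n. c * (x ^ n /\<^sub>R fact n)) sums (exp x * c)"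
    using sums_mult2[OF exp_converges, of x c] by simp
  then show ?thesis
    using sums_mult[OF exp_converges, of c x] sums_unique2 by blast
qed

lemma power_conj:
  fixes a b x :: "'a::monoid_mult"
  assumes "b * a = 1" "a * b = 1"
  shows "(b * x * a) ^ n = b * x ^ n * a"
proof (induction n)
  case (Suc n)
  have "(b * x * a) ^ Suc n = b * x * a * (b * x ^ n * a)"
    by (simp only: power_Suc Suc.IH)
  also have "\<dots> = b * x * (a * b) * x ^ n * a"
    by (simp only: mult.assoc)
  finally show ?case
    by (simp add: assms mult.assoc)
qed (simp add: assms)

lemma exp_conj:
  fixes x :: "'a::{real_normed_algebra_1, banach}"
  assumes "b * a = 1" "a * b = 1"
  shows "exp (b * x * a) = b * exp x * a"
proof -
  have "(\<lambda>n. b * (x ^ n /\<^sub>R fact n) * a) sums (b * exp x * a)"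
    by (intro sums_mult sums_mult2 exp_converges)
  then have "(\<lambda>n. (b * x * a) ^ n /\<^sub>R fact n) sums (b * exp x * a)"
    by (simp add: power_conj[OF assms])
  then show ?thesis
    using exp_converges sums_unique2 by blast
qed

text \<open>The commutator with \<open>c\<close> is a derivation, so that of a power is a sum of
  \<open>Suc n\<close> products containing one factor \<open>x * c - c * x\<close> each.\<close>

lemma norm_power_commutator_le:
  fixes x c :: "'a::real_normed_algebra_1"
  shows "norm (x ^ Suc n * c - c * x ^ Suc n) \<le> real (Suc n) * norm x ^ n * norm (x * c - c * x)"
proof (induction n)
  case (Suc n)
  have "x ^ Suc (Suc n) * c - c * x ^ Suc (Suc n) =
      x * (x ^ Suc n * c - c * x ^ Suc n) + (x * c - c * x) * x ^ Suc n"
    by (simp add: algebra_simps)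
  then have "norm (x ^ Suc (Suc n) * c - c * x ^ Suc (Suc n)) \<le>
      norm x * norm (x ^ Suc n * c - c * x ^ Suc n) + norm (x * c - c * x) * norm (x ^ Suc n)"
    by (metis norm_triangle_le add_mono norm_mult_ineq)
  also have "\<dots> \<le> norm x * (real (Suc n) * norm x ^ n * norm (x * c - c * x)) + norm (x * c - c * x) * norm x ^ Suc n"
    by (intro add_mono mult_left_mono Suc.IH norm_power_ineq) simp_all
  also have "\<dots> = real (Suc (Suc n)) * norm x ^ Suc n * norm (x * c - c * x)"
    by (simp add: algebra_simps)
  finally show ?case .
qed simp

text \<open>In the series of \<open>exp x * c - c * exp x = 0\<close> the linear term is the
  commutator of x and c; the later terms are bounded by \<open>exp (norm x) - 1\<close> times its
  norm. This factor is less than 1, so the commutator vanishes.\<close>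

lemma commute_of_exp_commute:
  fixes x c :: "'a::{real_normed_algebra_1, banach}"
  assumes "c * exp x = exp x * c" "exp (norm x) < 2"
  shows "c * x = x * c"
proof -
  let ?d = "x * c - c * x"
  define f where "f = (\<lambda>n. (x ^ n * c - c * x ^ n) /\<^sub>R fact n)"
  have "f sums (exp x * c - c * exp x)"
    unfolding f_def scaleR_diff_right
    by (intro sums_diff) (use sums_mult2[OF exp_converges, of x c] sums_mult[OF exp_converges, of c x] in simp_all)
  then have "(\<lambda>n. f (n + 2)) sums (0 - (\<Sum>i<2. f i))"
    using assms(1) by (intro sums_split_initial_segment) simp
  then have s: "(\<lambda>n. f (n + 2)) sums (- ?d)"
    by (simp add: numeral_2_eq_2 f_def)
  have "(\<lambda>n. norm x ^ (n + 1) /\<^sub>R fact (n + 1)) sums (exp (norm x) - (\<Sum>i<1. norm x ^ i /\<^sub>R fact i))"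
    by (rule sums_split_initial_segment[OF exp_converges])
  then have t: "(\<lambda>n. norm ?d * (norm x ^ (n + 1) /\<^sub>R fact (n + 1))) sums (norm ?d * (exp (norm x) - 1))"
    by (intro sums_mult) simp
  have "norm (f (n + 2)) \<le> norm ?d * (norm x ^ (n + 1) /\<^sub>R fact (n + 1))" for n
  proof -
    have "norm (f (n + 2)) = norm (x ^ Suc (Suc n) * c - c * x ^ Suc (Suc n)) / fact (Suc (Suc n))"
      by (simp add: f_def inverse_eq_divide del: power_Suc fact_Suc)
    also have "\<dots> \<le> real (Suc (Suc n)) * norm x ^ Suc n * norm ?d / fact (Suc (Suc n))"
      by (intro divide_right_mono norm_power_commutator_le) simp
    also have "\<dots> = norm ?d * (norm x ^ (n + 1) /\<^sub>R fact (n + 1))"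
      by (simp add: fact_Suc[of "Suc n"] inverse_eq_divide del: of_nat_Suc power_Suc fact_Suc)
    finally show ?thesis .
  qed
  then have "norm (suminf (\<lambda>n. f (n + 2))) \<le> suminf (\<lambda>n. norm ?d * (norm x ^ (n + 1) /\<^sub>R fact (n + 1)))"
    by (intro norm_suminf_le sums_summable[OF t])
  then have "norm ?d \<le> norm ?d * (exp (norm x) - 1)"
    unfolding sums_unique[OF s, symmetric] sums_unique[OF t, symmetric] by (simp only: norm_minus_cancel)
  then have "norm ?d * (2 - exp (norm x)) \<le> 0"
    by (simp add: algebra_simps)
  with assms(2) have "norm ?d \<le> 0"
    by (simp add: mult_le_0_iff)
  then show ?thesis by simp
qed

lemma norm_power_diff_le:
  fixes a b :: "'a::real_normed_algebra_1"
  assumes "norm a \<le> M" "norm b \<le> M"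
  shows "norm (a ^ Suc n - b ^ Suc n) \<le> real (Suc n) * M ^ n * norm (a - b)"
proof (induction n)
  case (Suc n)
  have "M \<ge> 0"
    using assms(1) norm_ge_zero order.trans by blast
  have "a ^ Suc (Suc n) - b ^ Suc (Suc n) = a * (a ^ Suc n - b ^ Suc n) + (a - b) * b ^ Suc n"
    by (simp add: algebra_simps)
  then have "norm (a ^ Suc (Suc n) - b ^ Suc (Suc n)) \<le>
      norm a * norm (a ^ Suc n - b ^ Suc n) + norm (a - b) * norm (b ^ Suc n)"
    by (metis norm_triangle_le add_mono norm_mult_ineq)
  also have "\<dots> \<le> M * (real (Suc n) * M ^ n * norm (a - b)) + norm (a - b) * M ^ Suc n"
    by (intro add_mono mult_mono Suc.IH order.trans[OF norm_power_ineq power_mono] assms norm_ge_zero \<open>M \<ge> 0\<close> order_refl)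
  also have "\<dots> = real (Suc (Suc n)) * M ^ Suc n * norm (a - b)"
    by (simp add: algebra_simps)
  finally show ?case .
qed simp

lemma LIMSEQ_exp_difference:
  fixes z :: "'a::{real_normed_algebra_1, banach}"
  shows "(\<lambda>n. real (Suc n) *\<^sub>R (exp ((1 / real (Suc n)) *\<^sub>R z) - 1)) \<longlonglongrightarrow> z"
proof -
  define b where "b = (\<lambda>n. exp ((1 / real (Suc n)) *\<^sub>R z))"
  have "norm (real (Suc n) *\<^sub>R (b n - 1) - z) \<le> (norm z)\<^sup>2 * exp (norm z) * (1 / real (Suc n))" for n
  proof -
    let ?y = "(1 / real (Suc n)) *\<^sub>R z"
    have ny: "norm ?y = norm z / real (Suc n)"
      by simp
    have "real (Suc n) *\<^sub>R (b n - 1) - z = real (Suc n) *\<^sub>R (exp ?y - 1 - ?y)"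
      by (simp add: b_def scaleR_diff_right del: of_nat_Suc)
    then have "norm (real (Suc n) *\<^sub>R (b n - 1) - z) \<le> real (Suc n) * ((norm ?y)\<^sup>2 * exp (norm ?y))"
      using norm_exp_remainder_le[of ?y] by (simp add: mult_left_mono del: of_nat_Suc)
    also have "\<dots> \<le> real (Suc n) * ((norm ?y)\<^sup>2 * exp (norm z))"
      unfolding ny by (intro mult_left_mono iffD2[OF exp_le_cancel_iff] divide_left_mono[of 1 _ "norm z", simplified]) (simp_all)
    also have "\<dots> = (norm z)\<^sup>2 * exp (norm z) * (1 / real (Suc n))"
      unfolding ny by (simp add: power2_eq_square del: of_nat_Suc)
    finally show ?thesis .
  qed
  then have "\<forall>n. norm (real (Suc n) *\<^sub>R (b n - 1) - z) \<le> (norm z)\<^sup>2 * exp (norm z) * (1 / real (Suc n))" ..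
  moreover have "(\<lambda>n. (norm z)\<^sup>2 * exp (norm z) * (1 / real (Suc n))) \<longlonglongrightarrow> 0"
    using tendsto_mult_right_zero[OF LIMSEQ_inverse_real_of_nat] by (simp only: inverse_eq_divide)
  ultimately have "(\<lambda>n. real (Suc n) *\<^sub>R (b n - 1) - z) \<longlonglongrightarrow> 0"
    by (rule Lim_null_comparison[OF always_eventually])
  then show ?thesis
    by (simp only: LIM_zero_iff b_def)
qed

text \<open>Compare with \<open>b n\<close>, whose power is exactly \<open>exp z\<close>. Both norms
  are at most \<open>1 + C / Suc n\<close>, so exchanging \<open>c n\<close> for \<open>b n\<close>
  in the power costs at most \<open>exp C\<close> times \<open>Suc n\<close> times the norm of the
  difference, which tends to 0.\<close>

lemma LIMSEQ_power_exp:
  fixes c :: "nat \<Rightarrow> 'a::{real_normed_algebra_1, banach}"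
  assumes "(\<lambda>n. real (Suc n) *\<^sub>R (c n - 1)) \<longlonglongrightarrow> z"
  shows "(\<lambda>n. c n ^ Suc n) \<longlonglongrightarrow> exp z"
proof -
  define b where "b = (\<lambda>n. exp ((1 / real (Suc n)) *\<^sub>R z))"
  have b: "b n ^ Suc n = exp z" for n
    unfolding b_def by (rule exp_divide_power) simp
  have lb: "(\<lambda>n. real (Suc n) *\<^sub>R (b n - 1)) \<longlonglongrightarrow> z"
    unfolding b_def by (rule LIMSEQ_exp_difference)
  have lim: "(\<lambda>n. real (Suc n) *\<^sub>R (c n - b n)) \<longlonglongrightarrow> 0"
    using tendsto_diff[OF assms lb] by (simp add: algebra_simps)
  obtain C where C: "C > 0" "\<And>n. norm (real (Suc n) *\<^sub>R (c n - 1)) \<le> C" "\<And>n. norm (real (Suc n) *\<^sub>R (b n - 1)) \<le> C"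
  proof -
    obtain C1 where "\<And>n. norm (real (Suc n) *\<^sub>R (c n - 1)) \<le> C1" "C1 > 0"
      using convergent_imp_Bseq[OF convergentI[OF assms]] unfolding Bseq_def by blast
    moreover obtain C2 where "\<And>n. norm (real (Suc n) *\<^sub>R (b n - 1)) \<le> C2" "C2 > 0"
      using convergent_imp_Bseq[OF convergentI[OF lb]] unfolding Bseq_def by blast
    ultimately show ?thesis
      using that[of "max C1 C2"] by (meson less_max_iff_disj max.coboundedI1 max.coboundedI2)
  qed
  have norm_le: "norm y \<le> 1 + C / real (Suc n)" if "norm (real (Suc n) *\<^sub>R (y - 1)) \<le> C" for y :: 'a and n
  proof -
    have "norm (y - 1) \<le> C / real (Suc n)"
      using that by (simp add: pos_le_divide_eq mult.commute del: of_nat_Suc)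
    then show ?thesis
      using norm_triangle_sub[of y 1] by simp
  qed
  have "norm (c n ^ Suc n - exp z) \<le> exp C * norm (real (Suc n) *\<^sub>R (c n - b n))" for n
  proof -
    have "norm (c n ^ Suc n - b n ^ Suc n) \<le> real (Suc n) * (1 + C / real (Suc n)) ^ n * norm (c n - b n)"
      by (intro norm_power_diff_le norm_le C)
    also have "(1 + C / real (Suc n)) ^ n \<le> exp C"
    proof -
      have "(1 + C / real (Suc n)) ^ n \<le> (1 + C / real (Suc n)) ^ Suc n"
        using C(1) by (intro power_increasing) simp_all
      also have "\<dots> \<le> exp (C / real (Suc n)) ^ Suc n"
        using C(1) by (intro power_mono exp_ge_add_one_self) (simp add: add_nonneg_nonneg)
      also have "\<dots> = exp C"
        using exp_of_nat_mult[of "Suc n" "C / real (Suc n)"] by (simp del: of_nat_Suc)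
      finally show ?thesis .
    qed
    then have "real (Suc n) * (1 + C / real (Suc n)) ^ n * norm (c n - b n) \<le> real (Suc n) * exp C * norm (c n - b n)"
      by (intro mult_right_mono mult_left_mono) simp_all
    finally show ?thesis
      unfolding b by (simp add: mult_ac)
  qed
  moreover have "(\<lambda>n. exp C * norm (real (Suc n) *\<^sub>R (c n - b n))) \<longlonglongrightarrow> 0"
    using tendsto_norm_zero[OF lim] by (rule tendsto_mult_right_zero)
  ultimately have "(\<lambda>n. c n ^ Suc n - exp z) \<longlonglongrightarrow> 0"
    by (rule Lim_null_comparison[OF always_eventually[OF allI]])
  then show ?thesis
    by (simp only: LIM_zero_iff)
qed

section \<open>Closed matrix groups\<close>

text \<open>The small factor \<open>exp x\<close> cannot blur the separated eigenvalues of
  \<open>s\<close>, so \<open>h\<close> is block diagonal for its eigenspaces. Then \<open>h\<close>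
  commutes with \<open>s\<close>, hence with \<open>exp x\<close>, hence with
  \<open>x\<close>.\<close>

lemma commute_near_semisimple:
  fixes s :: "'n::finite sqmat"
  assumes ss: "s' * s = 1" "s * s' = 1" "semisimple s"
  obtains d where "d > 0"
    "\<And>x h. norm x < d \<Longrightarrow> s * x = x * s \<Longrightarrow> h * (s * exp x) = s * exp x * h \<Longrightarrow> h * s = s * h \<and> h * x = x * h"
proof -
  obtain L E where LE: "spectral s 1 L E"
    using ss(3) by (auto simp: semisimple_def)
  obtain r where r: "r > 0" "\<And>z w. z \<in> L \<Longrightarrow> w \<in> L \<Longrightarrow> z \<noteq> w \<Longrightarrow> r * (norm z + norm w) < norm (z - w)"
    using separating_radius[OF spectral_finite[OF LE]] by blast
  have "\<exists>d>0. \<forall>x :: 'n sqmat. dist x 0 < d \<longrightarrow> dist (exp x) (exp 0) < r"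
    using isCont_exp_algebra[of "0 :: 'n sqmat"] r(1) unfolding continuous_at_eps_delta by blast
  then obtain d1 where d1: "d1 > 0" "\<And>x :: 'n sqmat. norm x < d1 \<Longrightarrow> norm (exp x - 1) < r"
    by (auto simp: dist_norm)
  \<comment> \<open>Provides \<open>exp (norm x) < 2\<close>, under which commuting with
    \<open>exp x\<close> implies commuting with \<open>x\<close>.\<close>
  have "\<exists>d>0. \<forall>t :: real. dist t 0 < d \<longrightarrow> dist (exp t) (exp 0) < 1"
    using isCont_exp[of "0 :: real"] unfolding continuous_at_eps_delta by (metis zero_less_one)
  then obtain d2 where d2: "d2 > 0" "\<And>t :: real. \<bar>t\<bar> < d2 \<Longrightarrow> \<bar>exp t - 1\<bar> < 1"
    by (auto simp: dist_real_def)
  have commute: "h * s = s * h \<and> h * x = x * h"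
    if x: "norm x < min d1 d2" "s * x = x * s" and h: "h * (s * exp x) = s * exp x * h" for x h
  proof -
    have se: "s * exp x = exp x * s"
      by (rule exp_commute[OF x(2)])
    have Ee: "E z * exp x = exp x * E z" if "z \<in> L" for z
      using spectral_commute[OF LE that, of "exp x"] se by simp
    have sE: "E z * s = scal z * E z" "s * E z = scal z * E z" if "z \<in> L" for z
      using spectral_commute[OF LE that, of s] spectral_eigen[OF LE that] by simp_all
    \<comment> \<open>With B the block, the relation reads (z - w) B = w B (exp x - 1) - z (exp x -
      1) B; for small x the right side is too small unless B = 0.\<close>
    have off_diagonal: "E z * h * E w = 0" if zw: "z \<in> L" "w \<in> L" "z \<noteq> w" for z w
    proof (rule ccontr)
      let ?B = "E z * h * E w"
      assume nz: "?B \<noteq> 0"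
      have "E z * (h * (s * exp x)) * E w = E z * h * (s * (exp x * E w))"
        by (simp only: mult.assoc)
      also have "\<dots> = E z * h * (s * E w) * exp x"
        by (simp only: Ee[OF zw(2), symmetric] mult.assoc)
      also have "\<dots> = scal w * (?B * exp x)"
        by (simp only: sE(2)[OF zw(2)] scal_left_commute[of h] scal_left_commute[of "E z"] mult.assoc)
      finally have 1: "E z * (h * (s * exp x)) * E w = scal w * (?B * exp x)" .
      have "E z * (s * exp x * h) * E w = E z * s * exp x * h * E w"
        by (simp only: mult.assoc)
      also have "\<dots> = scal z * (E z * exp x * h * E w)"
        by (simp only: sE(1)[OF zw(1)] mult.assoc)
      also have "\<dots> = scal z * (exp x * ?B)"
        by (simp only: Ee[OF zw(1)] mult.assoc)
      finally have "scal w * (?B * exp x) = scal z * (exp x * ?B)"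
        using 1 h by simp
      then have "scal (z - w) * ?B = scal w * (?B * (exp x - 1)) - scal z * ((exp x - 1) * ?B)"
        by (simp add: algebra_simps scal_diff)
      then have "norm (z - w) * norm ?B \<le> norm w * norm (?B * (exp x - 1)) + norm z * norm ((exp x - 1) * ?B)"
        by (metis norm_scal_mult norm_triangle_ineq4)
      also have "\<dots> \<le> norm w * (norm ?B * norm (exp x - 1)) + norm z * (norm (exp x - 1) * norm ?B)"
        by (intro add_mono mult_left_mono norm_mult_ineq) simp_all
      also have "\<dots> = norm (exp x - 1) * (norm z + norm w) * norm ?B"
        by (simp add: algebra_simps)
      also have "\<dots> \<le> r * (norm z + norm w) * norm ?B"
        using d1(2)[of x] x(1) by (intro mult_right_mono) simp_all
      also have "\<dots> < norm (z - w) * norm ?B"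
        using r(2)[OF zw] nz by (intro mult_strict_right_mono) simp_all
      finally show False by simp
    qed
    have "h * s = (\<Sum>w\<in>L. h * s * E w)"
      by (simp add: sum_distrib_left[symmetric] spectral_sum[OF LE])
    also have "\<dots> = (\<Sum>w\<in>L. s * h * E w)"
    proof (rule sum.cong[OF refl])
      fix w
      assume w: "w \<in> L"
      have "h * E w = (\<Sum>z\<in>L. E z * (h * E w))"
        by (rule spectral_resolve[OF LE])
      also have "\<dots> = E w * (h * E w)"
        using off_diagonal[OF _ w] w spectral_finite[OF LE] by (simp add: sum.remove[OF _ w] mult.assoc)
      finally have hE: "h * E w = E w * (h * E w)" .
      have "s * h * E w = s * E w * (h * E w)"
        by (subst mult.assoc, subst hE) (simp only: mult.assoc)
      also have "\<dots> = scal w * (E w * (h * E w))"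
        by (simp only: sE(2)[OF w] mult.assoc)
      also have "\<dots> = h * (scal w * E w)"
        by (simp only: hE[symmetric] scal_left_commute[of h])
      finally show "h * s * E w = s * h * E w"
        by (simp only: sE(2)[OF w] mult.assoc)
    qed
    also have "\<dots> = s * h"
      by (simp add: sum_distrib_left[symmetric] spectral_sum[OF LE])
    finally have hs: "h * s = s * h" .
    have "s * (h * exp x) = s * (exp x * h)"
      using h by (simp only: mult.assoc[symmetric] hs)
    then have "h * exp x = exp x * h"
      using ss(1) by (metis mult.assoc mult_1)
    moreover have "exp (norm x) < 2"
      using d2(2)[of "norm x"] x(1) by simp
    ultimately have "h * x = x * h"
      by (rule commute_of_exp_commute)
    with hs show ?thesis by simp
  qed
  show ?thesis
    by (rule that[of "min d1 d2"], use d1(1) d2(1) in simp, rule commute)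
qed

lemma exists_linear_projection:
  fixes S :: "'a::real_vector set"
  assumes "subspace S"
  obtains p where "linear p" "range p \<subseteq> S" "\<And>x. x \<in> S \<Longrightarrow> p x = x"
  using linear_exists_left_inverse_on[OF linear_id assms inj_on_id] by auto

text \<open>Closedness is meant relative to the general linear group: only invertible limits have to
  stay in \<open>H\<close>.\<close>

locale closed_matrix_group = matrix_group H
  for H :: "'n::finite sqmat set" +
  assumes limit_closed: "(\<And>n :: nat. X n \<in> H) \<Longrightarrow> X \<longlonglongrightarrow> l \<Longrightarrow> b * l = 1 \<Longrightarrow> l * b = 1 \<Longrightarrow> l \<in> H"
begin

lemma inverse_closed: "a \<in> H \<Longrightarrow> b * a = 1 \<Longrightarrow> b \<in> H"
  using inv_closed[of a] by (metis mult.assoc mult_1 mult_1_right)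

lemma exp_limit_closed: "(\<And>n :: nat. X n \<in> H) \<Longrightarrow> X \<longlonglongrightarrow> exp x \<Longrightarrow> exp x \<in> H"
  by (rule limit_closed[OF _ _ exp_mult_exp_minus(2,1)])

text \<open>The real Lie algebra of \<open>H\<close>, described by one-parameter subgroups.\<close>

definition lie :: "'n sqmat set" where
  "lie = {x. \<forall>t :: real. exp (t *\<^sub>R x) \<in> H}"

lemma exp_lie: "x \<in> lie \<Longrightarrow> exp x \<in> H"
  unfolding lie_def using scaleR_one by (metis (mono_tags) mem_Collect_eq)

text \<open>Trotter product formula: the n-th power of exp (t x / n) exp (t y / n) tends to exp (t
  (x + y)).\<close>

lemma lie_add:
  assumes "x \<in> lie" "y \<in> lie"
  shows "x + y \<in> lie"
  unfolding lie_def
proof (rule CollectI, rule allI)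
  fix t :: real
  define e where "e = (\<lambda>n z. exp ((1 / real (Suc n)) *\<^sub>R (t *\<^sub>R z)) :: 'n sqmat)"
  have lim: "(\<lambda>n. real (Suc n) *\<^sub>R (e n z - 1)) \<longlonglongrightarrow> t *\<^sub>R z" for z
    unfolding e_def by (rule LIMSEQ_exp_difference)
  have "(\<lambda>n. e n y) \<longlonglongrightarrow> exp (0 *\<^sub>R (t *\<^sub>R y))"
    unfolding e_def using LIMSEQ_inverse_real_of_nat
    by (intro isCont_tendsto_compose[OF isCont_exp_algebra] tendsto_intros) (simp add: inverse_eq_divide)
  then have "(\<lambda>n. real (Suc n) *\<^sub>R (e n x - 1) * e n y + real (Suc n) *\<^sub>R (e n y - 1))
      \<longlonglongrightarrow> t *\<^sub>R x * exp (0 *\<^sub>R (t *\<^sub>R y)) + t *\<^sub>R y"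
    by (intro tendsto_add tendsto_mult lim)
  then have "(\<lambda>n. real (Suc n) *\<^sub>R (e n x * e n y - 1)) \<longlonglongrightarrow> t *\<^sub>R (x + y)"
    by (simp add: algebra_simps)
  then have "(\<lambda>n. (e n x * e n y) ^ Suc n) \<longlonglongrightarrow> exp (t *\<^sub>R (x + y))"
    by (rule LIMSEQ_power_exp)
  moreover have "e n z \<in> H" if "z \<in> lie" for n z
    using that by (simp add: e_def lie_def)
  then have "(e n x * e n y) ^ Suc n \<in> H" for n
    using assms by (intro power_closed mult_closed)
  ultimately show "exp (t *\<^sub>R (x + y)) \<in> H"
    by (intro exp_limit_closed)
qed

lemma lie_scaleR: "x \<in> lie \<Longrightarrow> r *\<^sub>R x \<in> lie"
  by (simp add: lie_def)

lemma subspace_lie: "subspace lie"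
  using one_closed lie_add lie_scaleR by (auto simp: subspace_def lie_def)

lemma lie_conj:
  assumes "x \<in> lie" "a \<in> H" "b * a = 1" "a * b = 1"
  shows "b * x * a \<in> lie"
proof -
  have "exp (t *\<^sub>R (b * x * a)) = b * exp (t *\<^sub>R x) * a" for t :: real
    using exp_conj[OF assms(3,4), of "t *\<^sub>R x"] by simp
  then show ?thesis
    using assms(1) inverse_closed[OF assms(2,3)] assms(2) by (simp add: lie_def mult_closed)
qed

text \<open>If \<open>exp z\<^sub>n \<in> H\<close> with \<open>0 \<noteq> z\<^sub>n \<rightarrow> 0\<close>, then the limit directions of \<open>z\<^sub>n\<close> lie in the Lie algebra.\<close>

lemma exp_complement_eq_0:
  assumes W: "subspace W" "\<And>x. x \<in> lie \<Longrightarrow> mat_of x \<in> W \<Longrightarrow> x = 0"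
  obtains e where "e > 0" "\<And>z. mat_of z \<in> W \<Longrightarrow> norm z < e \<Longrightarrow> exp z \<in> H \<Longrightarrow> z = 0"
proof (rule ccontr)
  assume neg: "\<not> thesis"
  have "\<exists>z. mat_of z \<in> W \<and> norm z < 1 / real (Suc n) \<and> exp z \<in> H \<and> z \<noteq> 0" for n
    using neg that[of "1 / real (Suc n)"] by (metis of_nat_0_less_iff zero_less_Suc zero_less_divide_1_iff)
  then obtain z where z: "\<And>n. mat_of (z n) \<in> W" "\<And>n. norm (z n) < 1 / real (Suc n)"
      "\<And>n. exp (z n) \<in> H" "\<And>n. z n \<noteq> 0"
    by metis
  define r where "r = (\<lambda>n. norm (mat_of (z n)))"
  have r: "r n > 0" for n
    using z(4) by (simp add: r_def sqmat_eq_iff)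
  have "z \<longlonglongrightarrow> 0"
    by (rule Lim_null_comparison[OF always_eventually[OF allI[OF less_imp_le[OF z(2)]]]])
      (use LIMSEQ_inverse_real_of_nat in \<open>simp add: inverse_eq_divide\<close>)
  then have "(\<lambda>n. mat_of (z n)) \<longlonglongrightarrow> mat_of 0"
    by (rule bounded_linear.tendsto[OF bounded_linear_mat_of])
  then have r0: "r \<longlonglongrightarrow> 0"
    unfolding r_def by (intro tendsto_norm_zero) simp
  \<comment> \<open>Directions are normalized in the Euclidean norm of the vector type, where the
    unit sphere of \<open>W\<close> is compact.\<close>
  define y where "y = (\<lambda>n. mat_of (z n) /\<^sub>R r n)"
  have "y n \<in> sphere 0 1 \<inter> W" for n
    using z(1) r[of n] subspace_scale[OF W(1)] by (simp add: y_def r_def)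
  moreover have "compact (sphere 0 1 \<inter> W)"
    by (intro compact_Int_closed compact_sphere closed_subspace W)
  ultimately obtain l \<sigma> where l: "l \<in> sphere 0 1 \<inter> W" "strict_mono \<sigma>" "(y \<circ> \<sigma>) \<longlonglongrightarrow> l"
    unfolding compact_def by metis
  have r0': "(\<lambda>n. r (\<sigma> n)) \<longlonglongrightarrow> 0"
    using LIMSEQ_subseq_LIMSEQ[OF r0 l(2)] by (simp add: o_def)
  have pos: "exp (t *\<^sub>R of_mat l) \<in> H" if "t \<ge> 0" for t :: real
  proof -
    \<comment> \<open>Integer multiples of \<open>r (\<sigma> n)\<close> approximate t as
      \<open>r\<close> tends to 0, and integer multiples of the \<open>z (\<sigma> n)\<close> have
      exponentials in \<open>H\<close>.\<close>
    define m where "m = (\<lambda>n. nat \<lfloor>t / r (\<sigma> n)\<rfloor>)"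
    have m: "norm (real (m n) * r (\<sigma> n) - t) \<le> r (\<sigma> n)" for n
    proof -
      have t: "t / r (\<sigma> n) \<ge> 0"
        using that r[of "\<sigma> n"] by simp
      then have "real (m n) \<le> t / r (\<sigma> n)" "t / r (\<sigma> n) < real (m n) + 1"
        unfolding m_def by linarith+
      then have "real (m n) * r (\<sigma> n) \<le> t" "t < (real (m n) + 1) * r (\<sigma> n)"
        using r[of "\<sigma> n"] by (simp_all add: pos_le_divide_eq pos_divide_less_eq)
      then show ?thesis
        by (simp add: algebra_simps)
    qed
    have "(\<lambda>n. real (m n) * r (\<sigma> n) - t) \<longlonglongrightarrow> 0"
      by (rule Lim_null_comparison[OF always_eventually[OF allI[OF m]] r0'])
    then have "(\<lambda>n. real (m n) * r (\<sigma> n)) \<longlonglongrightarrow> t"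
      by (simp only: LIM_zero_iff)
    then have "(\<lambda>n. (real (m n) * r (\<sigma> n)) *\<^sub>R of_mat ((y \<circ> \<sigma>) n)) \<longlonglongrightarrow> t *\<^sub>R of_mat l"
      by (intro tendsto_scaleR bounded_linear.tendsto[OF bounded_linear_of_mat] l)
    moreover have "(real (m n) * r (\<sigma> n)) *\<^sub>R of_mat ((y \<circ> \<sigma>) n) = real (m n) *\<^sub>R z (\<sigma> n)" for n
      using r[of "\<sigma> n"] by (simp add: y_def sqmat_eq_iff)
    ultimately have "(\<lambda>n. real (m n) *\<^sub>R z (\<sigma> n)) \<longlonglongrightarrow> t *\<^sub>R of_mat l"
      by simp
    then have "(\<lambda>n. exp (real (m n) *\<^sub>R z (\<sigma> n))) \<longlonglongrightarrow> exp (t *\<^sub>R of_mat l)"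
      by (rule isCont_tendsto_compose[OF isCont_exp_algebra])
    moreover have "exp (real (m n) *\<^sub>R z (\<sigma> n)) \<in> H" for n
      by (simp add: exp_scaleR_of_nat power_closed z(3))
    ultimately show ?thesis
      by (intro exp_limit_closed)
  qed
  have "of_mat l \<in> lie"
    unfolding lie_def
  proof (rule CollectI, rule allI)
    fix t :: real
    show "exp (t *\<^sub>R of_mat l) \<in> H"
    proof (cases "t \<ge> 0")
      case False
      then have "exp (- (t *\<^sub>R of_mat l)) \<in> H"
        using pos[of "- t"] by simp
      then show ?thesis
        using inverse_closed exp_mult_exp_minus(1) by blast
    qed (rule pos)
  qed
  then have "of_mat l = 0"
    using W(2) l(1) by simp
  then show False
    using l(1) by (simp add: sqmat_eq_iff)
qed

text \<open>\<open>Ad(s\<^sup>-\<^sup>1) - 1\<close> is semisimple, so the Lie algebra is the sum of its kernel and its image.\<close>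

lemma lie_decomposition:
  assumes ss: "s \<in> H" "s' * s = 1" "s * s' = 1" "semisimple s" and z: "z \<in> lie"
  obtains x y where "x \<in> lie" "s * x = x * s" "y \<in> lie" "z = s' * y * s - y + x"
proof -
  define T where "T = (\<lambda>y. s' * y * s - y)"
  have linT: "linear T"
    by (rule linearI) (simp_all add: T_def algebra_simps)
  have T0: "s * y = y * s" if "T y = 0" for y
  proof -
    have "s * y = s * (s' * y * s)"
      using that by (simp add: T_def)
    then show ?thesis
      by (simp add: mult.assoc[symmetric] ss(3))
  qed
  \<comment> \<open>T^2 and T have the same kernel. If D = T y commutes with s, then y s = s y + s
    D, and multiplying by \<open>E z\<close> on both sides leaves z D \<open>E z\<close> =
    0.\<close>
  have TT0: "T y = 0" if "T (T y) = 0" for y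
  proof -
    obtain L E where LE: "spectral s 1 L E"
      using ss(4) by (auto simp: semisimple_def)
    let ?D = "T y"
    have sD: "s * ?D = ?D * s"
      by (rule T0[OF that])
    have ys: "y * s = s * y + s * ?D"
      by (simp add: T_def right_diff_distrib mult.assoc[symmetric] ss(3))
    have "?D * E z = 0" if z: "z \<in> L" for z
    proof -
      have Es: "E z * s = scal z * E z"
        using spectral_commute[OF LE z, of s] spectral_eigen[OF LE z] by simp
      have DE: "?D * E z = E z * ?D"
        by (rule spectral_commute[OF LE z]) (simp add: sD)
      have "E z * (y * s) * E z = scal z * (E z * y * E z)"
        by (simp only: mult.assoc spectral_eigen[OF LE z] scal_left_commute[of y] scal_left_commute[of "E z"])
      moreover have "E z * (s * y) * E z = scal z * (E z * y * E z)"
        by (simp only: mult.assoc[symmetric] Es)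
      ultimately have "E z * (s * ?D) * E z = 0"
        unfolding ys by (simp add: distrib_left distrib_right)
      moreover have "E z * ?D * E z = ?D * E z"
        by (simp only: DE[symmetric] mult.assoc spectral_idem[OF LE z])
      then have "E z * (s * ?D) * E z = scal z * (?D * E z)"
        by (simp only: mult.assoc[symmetric] Es) (simp only: mult.assoc)
      ultimately show ?thesis
        using unit_spectral_nonzero[OF ss(2) LE z] by (simp add: scal_mult_eq_0_iff)
    qed
    then have "?D * (\<Sum>z\<in>L. E z) = 0"
      by (simp add: sum_distrib_left)
    then show ?thesis
      by (simp add: spectral_sum[OF LE])
  qed
  have Tlie: "T y \<in> lie" if "y \<in> lie" for y
    unfolding T_def by (intro subspace_diff[OF subspace_lie] lie_conj[OF that ss(1-3)] that)
  \<comment> \<open>Passage to the vector type, where dimensions are available: T is injective on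
    its image V of the Lie algebra, hence maps V onto V.\<close>
  define T' where "T' = mat_of \<circ> T \<circ> of_mat"
  have linT': "linear T'"
    unfolding T'_def o_assoc[symmetric]
    by (intro linear_compose[OF linear_compose[OF bounded_linear.linear[OF bounded_linear_of_mat] linT] linear_mat_of, unfolded o_assoc[symmetric]])
  define V where "V = mat_of ` T ` lie"
  have subV: "subspace V"
    unfolding V_def by (intro linear_subspace_image linT linear_mat_of subspace_lie)
  have "T' ` V \<subseteq> V"
    using Tlie by (auto simp: T'_def V_def)
  moreover have "inj_on T' (span V)"
    unfolding span_eq_iff[THEN iffD2, OF subV] linear_injective_on_subspace_0[OF linT' subV]
    using TT0 by (auto simp: T'_def V_def sqmat_eq_iff)
  then have "dim (T' ` V) = dim V"
    by (rule dim_image_eq[OF linT'])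
  ultimately have "T' ` V = V"
    by (intro subspace_dim_equal linear_subspace_image linT' subV) simp_all
  moreover have "mat_of (T z) \<in> V"
    using z by (simp add: V_def)
  ultimately have "mat_of (T z) \<in> T' ` V"
    by simp
  then obtain v where v: "v \<in> V" "mat_of (T z) = T' v"
    by blast
  then obtain y where y: "y \<in> lie" "mat_of (T z) = T' (mat_of (T y))"
    unfolding V_def by blast
  \<comment> \<open>Hence \<open>z - T y\<close> lies in the kernel of T and commutes with
    s.\<close>
  then have "T z = T (T y)"
    by (simp add: T'_def sqmat_eq_iff)
  then have "T (z - T y) = 0"
    by (simp add: linear_diff[OF linT])
  moreover have "z - T y \<in> lie"
    by (intro subspace_diff[OF subspace_lie] z Tlie y)
  ultimately show ?thesis
    using that[of "z - T y" y] T0 y(1) by (simp add: T_def)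
qed

text \<open>Slice argument: a matrix near \<open>s\<close> has the form exp y s exp x exp(-y) exp w
  with x and y in the Lie algebra, x commuting with \<open>s\<close>, and w in a complement. For an
  element of \<open>H\<close> the factor exp w lies in \<open>H\<close> and, w being small, is 1. So
  a k-th power near \<open>s\<close> is conjugate in \<open>H\<close> to s exp x.\<close>

theorem semisimple_power_of_dense:
  assumes k: "k \<ge> 1" and ss: "s \<in> H" "semisimple s"
    and dense: "\<And>e. e > 0 \<Longrightarrow> \<exists>h\<in>H. dist (h ^ k) s < e"
  shows "\<exists>h\<in>H. h ^ k = s"
proof -
  obtain s' where s': "s' \<in> H" "s' * s = 1" "s * s' = 1"
    using inv_closed[OF ss(1)] by blast
  define V where "V = mat_of ` lie"
  define K where "K = mat_of ` {x \<in> lie. s * x = x * s}"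
  define W where "W = {y. \<forall>x\<in>V. orthogonal x y}"
  have subV: "subspace V"
    unfolding V_def by (intro linear_subspace_image linear_mat_of subspace_lie)
  have "subspace {x. s * x = x * s}"
    by (auto simp: subspace_def algebra_simps)
  then have "subspace (lie \<inter> {x. s * x = x * s})"
    by (intro subspace_inter subspace_lie)
  then have subK: "subspace K"
    unfolding K_def by (intro linear_subspace_image linear_mat_of) (simp add: Int_def)
  have subW: "subspace W"
    unfolding W_def by (rule subspace_orthogonal_to_vectors)
  have VW: "x = 0" if "x \<in> lie" "mat_of x \<in> W" for x
    using that by (auto simp: W_def V_def orthogonal_self sqmat_eq_iff)
  obtain e where e: "e > 0" "\<And>z. mat_of z \<in> W \<Longrightarrow> norm z < e \<Longrightarrow> exp z \<in> H \<Longrightarrow> z = 0"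
    using exp_complement_eq_0[OF subW VW] by blast
  obtain d where d: "d > 0" "\<And>x h. norm x < d \<Longrightarrow> s * x = x * s \<Longrightarrow> h * (s * exp x) = s * exp x * h \<Longrightarrow>
      h * s = s * h \<and> h * x = x * h"
    using commute_near_semisimple[OF s'(2,3) ss(2)] by blast
  \<comment> \<open>The parameters range over the full matrix space and are projected to the three
    subspaces, so that the parametrization is defined on a normed vector space.\<close>
  obtain pV where pV: "linear pV" "range pV \<subseteq> V" "\<And>x. x \<in> V \<Longrightarrow> pV x = x"
    using exists_linear_projection[OF subV] by blast
  obtain pK where pK: "linear pK" "range pK \<subseteq> K" "\<And>x. x \<in> K \<Longrightarrow> pK x = x"
    using exists_linear_projection[OF subK] by blast
  obtain pW where pW: "linear pW" "range pW \<subseteq> W" "\<And>x. x \<in> W \<Longrightarrow> pW x = x"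
    using exists_linear_projection[OF subW] by blast
  define \<pi> where "\<pi> = (\<lambda>p (x :: 'n sqmat). of_mat (p (mat_of x)) :: 'n sqmat)"
  have bl: "bounded_linear (\<pi> p)" if "linear p" for p
    unfolding \<pi>_def
    by (intro bounded_linear_compose[OF bounded_linear_of_mat] bounded_linear_compose[OF _ bounded_linear_mat_of])
      (use that linear_conv_bounded_linear in blast)
  have \<pi>V: "\<pi> pV x \<in> lie" for x
    using subsetD[OF pV(2) rangeI, of "mat_of x"] by (auto simp: \<pi>_def V_def)
  have \<pi>K: "\<pi> pK x \<in> lie" "s * \<pi> pK x = \<pi> pK x * s" for x
    using subsetD[OF pK(2) rangeI, of "mat_of x"] by (auto simp: \<pi>_def K_def)
  have \<pi>W: "mat_of (\<pi> pW x) \<in> W" for x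
    using subsetD[OF pW(2) rangeI, of "mat_of x"] by (simp add: \<pi>_def)
  define F where "F = (\<lambda>(y, x, w). exp (\<pi> pV y) * s * exp (\<pi> pK x) * exp (- \<pi> pV y) * exp (\<pi> pW w))"
  define F' where "F' = (\<lambda>(y, x, w). \<pi> pV y * s + s * \<pi> pK x - s * \<pi> pV y + s * \<pi> pW w)"
  note bl' = bl[OF pV(1)] bl[OF pK(1)] bl[OF pW(1)]
  have cont: "continuous_on UNIV F"
    unfolding F_def case_prod_unfold
    by (intro continuous_intros continuous_on_compose2[OF continuous_on_exp_algebra] bl'[THEN bounded_linear.continuous_on] subset_UNIV)
  have exp_deriv: "((\<lambda>u. exp (f u)) has_derivative f) (at 0)"
    if "bounded_linear f" for f :: "'n sqmat \<times> 'n sqmat \<times> 'n sqmat \<Rightarrow> 'n sqmat"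
    using has_derivative_compose[OF bounded_linear_imp_has_derivative[OF that], of exp "\<lambda>x. x" 0 UNIV]
      has_derivative_exp_0 linear_0[OF bounded_linear.linear[OF that]] by simp
  have blu: "bounded_linear (\<lambda>u :: 'n sqmat \<times> 'n sqmat \<times> 'n sqmat. \<pi> pV (fst u))"
      "bounded_linear (\<lambda>u :: 'n sqmat \<times> 'n sqmat \<times> 'n sqmat. - \<pi> pV (fst u))"
      "bounded_linear (\<lambda>u :: 'n sqmat \<times> 'n sqmat \<times> 'n sqmat. \<pi> pK (fst (snd u)))"
      "bounded_linear (\<lambda>u :: 'n sqmat \<times> 'n sqmat \<times> 'n sqmat. \<pi> pW (snd (snd u)))"
    by (intro bounded_linear_minus bl'[THEN bounded_linear_compose] bounded_linear_fst_comp bounded_linear_snd_comp bounded_linear_ident)+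
  have zero: "\<pi> pV 0 = 0" "\<pi> pK 0 = 0" "\<pi> pW 0 = 0"
    using bl'[THEN bounded_linear.linear, THEN linear_0] by simp_all
  have deriv: "(F has_derivative F') (at 0)"
    unfolding F_def F'_def case_prod_unfold
    by (rule has_derivative_eq_rhs, (rule has_derivative_mult has_derivative_const exp_deriv[OF blu(1)] exp_deriv[OF blu(2)]
        exp_deriv[OF blu(3)] exp_deriv[OF blu(4)])+) (simp add: zero fun_eq_iff algebra_simps)
  \<comment> \<open>The open mapping theorem applied below is for maps into a Euclidean space, hence
    the passage to the vector type. It asks for continuity and a surjective derivative at the single
    point 0.\<close>
  define G where "G = mat_of \<circ> F"
  define G' where "G' = mat_of \<circ> F'"
  have derivG: "(G has_derivative G') (at 0)"
    unfolding G_def G'_def o_def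
    by (rule bounded_linear.has_derivative[OF bounded_linear_mat_of deriv])
  have contG: "continuous_on UNIV G"
    unfolding G_def by (intro continuous_on_compose cont bounded_linear.continuous_on[OF bounded_linear_mat_of] continuous_on_id)
  \<comment> \<open>Up to the left factor s the derivative is s^-1 y s - y + x + w. By
    \<open>lie_decomposition\<close> the terms in x and y fill the Lie algebra, and w fills its
    orthogonal complement.\<close>
  have "surj G'"
  proof -
    have "v \<in> range G'" for v
    proof -
      obtain a b where ab: "a \<in> span V" "\<And>w. w \<in> span V \<Longrightarrow> orthogonal b w" "mat_of (s' * of_mat v) = a + b"
        using orthogonal_subspace_decomp_exists[of V "mat_of (s' * of_mat v)"] by metis
      have "a \<in> V" "b \<in> W"
        using ab(1,2) span_eq_iff[THEN iffD2, OF subV] by (auto simp: W_def orthogonal_commute)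
      then obtain z where z: "z \<in> lie" "a = mat_of z"
        by (auto simp: V_def)
      obtain x y where xy: "x \<in> lie" "s * x = x * s" "y \<in> lie" "z = s' * y * s - y + x"
        using lie_decomposition[OF ss(1) s'(2,3) ss(2) z(1)] by blast
      have "\<pi> pV y = y" "\<pi> pK x = x" "\<pi> pW (of_mat b) = of_mat b"
        using xy \<open>b \<in> W\<close> by (auto simp: \<pi>_def pV(3) pK(3) pW(3) V_def K_def)
      then have "F' (y, x, of_mat b) = y * s + s * x - s * y + s * of_mat b"
        by (simp add: F'_def)
      also have "\<dots> = s * (z + of_mat b)"
        unfolding xy(4) by (simp add: algebra_simps) (simp add: mult.assoc[symmetric] s'(3))
      also have "z + of_mat b = s' * of_mat v"
        using ab(3) z(2) by (simp add: sqmat_eq_iff)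
      also have "s * (s' * of_mat v) = of_mat v"
        by (simp add: mult.assoc[symmetric] s'(3))
      finally have "G' (y, x, of_mat b) = v"
        by (simp add: G'_def)
      then show ?thesis by (metis rangeI)
    qed
    then show ?thesis by blast
  qed
  then obtain g' where g': "linear g'" "G' \<circ> g' = id"
    using linear_surjective_right_inverse[of G'] has_derivative_linear[OF derivG] by blast
  \<comment> \<open>Shrinks the parameter ball until \<open>commute_near_semisimple\<close> and
    \<open>exp_complement_eq_0\<close> apply to the projected parameters.\<close>
  have small: "\<forall>\<^sub>F u :: 'n sqmat \<times> 'n sqmat \<times> 'n sqmat in nhds 0. norm (\<pi> pK (fst (snd u))) < d \<and> norm (\<pi> pW (snd (snd u))) < e"
  proof (rule eventually_conj)
    have "((\<lambda>u. norm (\<pi> p (f u))) \<longlongrightarrow> norm (\<pi> p (f 0))) (nhds 0)"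
      if "linear p" "bounded_linear f" for p and f :: "'n sqmat \<times> 'n sqmat \<times> 'n sqmat \<Rightarrow> 'n sqmat"
      using linear_continuous_at[OF bounded_linear_compose[OF bl[OF that(1)] that(2)], of 0]
      by (intro tendsto_norm) (simp add: isCont_def tendsto_at_iff_tendsto_nhds[of "\<lambda>u. \<pi> p (f u)"])
    from this[OF pK(1) bounded_linear_compose[OF bounded_linear_fst bounded_linear_snd]]
      this[OF pW(1) bounded_linear_compose[OF bounded_linear_snd bounded_linear_snd]]
    show "\<forall>\<^sub>F u :: 'n sqmat \<times> 'n sqmat \<times> 'n sqmat in nhds 0. norm (\<pi> pK (fst (snd u))) < d"
      "\<forall>\<^sub>F u :: 'n sqmat \<times> 'n sqmat \<times> 'n sqmat in nhds 0. norm (\<pi> pW (snd (snd u))) < e"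
      using d(1) e(1) zero
      by (auto intro!: order_tendstoD(2))
  qed
  then obtain r where r: "r > 0" "\<And>u :: 'n sqmat \<times> 'n sqmat \<times> 'n sqmat. dist u 0 < r \<Longrightarrow> norm (\<pi> pK (fst (snd u))) < d \<and> norm (\<pi> pW (snd (snd u))) < e"
    unfolding eventually_nhds_metric by blast
  have "G 0 \<in> interior (G ` ball 0 r)"
    by (rule sussmann_open_mapping[OF open_UNIV contG UNIV_I derivG _ g'(2)])
      (use r(1) g'(1) linear_conv_bounded_linear in auto)
  moreover have "G 0 = mat_of s"
    by (simp add: G_def F_def zero_prod_def zero)
  ultimately obtain \<rho> where \<rho>: "\<rho> > 0" "ball (mat_of s) \<rho> \<subseteq> G ` ball 0 r"
    by (auto simp: mem_interior)
  let ?c = "(real CARD('n))\<^sup>2"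
  have c: "?c > 0"
    by simp
  obtain h where h: "h \<in> H" "dist (h ^ k) s < \<rho> / ?c"
    using dense[OF divide_pos_pos[OF \<rho>(1) c]] by blast
  have "dist (mat_of (h ^ k)) (mat_of s) \<le> ?c * dist (h ^ k) s"
    by (rule dist_mat_of_le)
  also have "\<dots> < \<rho>"
    using h(2) c by (simp only: pos_less_divide_eq mult.commute[of ?c])
  finally have "mat_of (h ^ k) \<in> G ` ball 0 r"
    using \<rho>(2) by (auto simp: dist_commute)
  then obtain y x w where u: "(y, x, w) \<in> ball 0 r" "mat_of (h ^ k) = G (y, x, w)"
    by auto
  define Y X Z where YXZ: "Y = \<pi> pV y" "X = \<pi> pK x" "Z = \<pi> pW w"
  have hk: "h ^ k = exp Y * s * exp X * exp (- Y) * exp Z"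
    unfolding sqmat_eq_iff using u(2) by (simp add: G_def F_def YXZ)
  have X: "X \<in> lie" "s * X = X * s" "norm X < d" and Z: "mat_of Z \<in> W" "norm Z < e" and Y: "Y \<in> lie"
    using r(2)[of "(y, x, w)"] u(1) \<pi>V \<pi>K \<pi>W by (auto simp: YXZ dist_commute)
  have minus: "- A \<in> lie" if "A \<in> lie" for A
    using subspace_neg[OF subspace_lie that] .
  have YH: "exp Y \<in> H" "exp (- Y) \<in> H" "exp X \<in> H" "exp (- X) \<in> H"
    using X(1) Y minus exp_lie by blast+
  have "exp Y * (exp (- X) * (s' * (exp (- Y) * h ^ k))) = exp Z"
  proof -
    have cancel: "exp (- A) * (exp A * B) = B" "exp A * (exp (- A) * B) = B" "s' * (s * B) = B" for A B :: "'n sqmat"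
      by (simp_all only: mult.assoc[symmetric] exp_mult_exp_minus s'(2) mult_1)
    show ?thesis
      by (simp only: hk mult.assoc cancel)
  qed
  then have "exp Z \<in> H"
    using YH s'(1) h(1) by (metis mult_closed power_closed)
  then have "Z = 0"
    using e(2) Z by blast
  \<comment> \<open>Conjugation by \<open>exp Y\<close> turns the power into
    \<open>s * exp X\<close>. Commuting with its own power, f commutes with \<open>X\<close>, so a
    factor exp (-X / k) removes \<open>exp X\<close>.\<close>
  define f where "f = exp (- Y) * h * exp Y"
  have fH: "f \<in> H"
    unfolding f_def by (intro mult_closed YH h)
  have fk: "f ^ k = s * exp X"
  proof -
    have "f ^ k = exp (- Y) * h ^ k * exp Y"
      unfolding f_def by (rule power_conj[OF exp_mult_exp_minus(2,1)])
    also have "\<dots> = (exp (- Y) * exp Y) * s * exp X * (exp (- Y) * exp Y)"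
      by (simp only: hk \<open>Z = 0\<close> exp_zero mult_1_right mult.assoc)
    finally show ?thesis
      by (simp add: exp_mult_exp_minus)
  qed
  have "f * (s * exp X) = s * exp X * f"
    unfolding fk[symmetric] by (simp add: power_commutes)
  then have "f * X = X * f"
    using d(2) X by blast
  then have fe: "f * exp ((1 / real k) *\<^sub>R (- X)) = exp ((1 / real k) *\<^sub>R (- X)) * f"
    by (intro exp_commute) simp
  have "(f * exp ((1 / real k) *\<^sub>R (- X))) ^ k = s * exp X * exp (- X)"
    unfolding commuting_power_distrib[OF fe] exp_divide_power[OF k] fk ..
  also have "\<dots> = s"
    by (simp add: mult.assoc exp_mult_exp_minus)
  finally have "(f * exp ((1 / real k) *\<^sub>R (- X))) ^ k = s" .
  moreover have "f * exp ((1 / real k) *\<^sub>R (- X)) \<in> H"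
    using minus[OF X(1)] by (intro mult_closed fH) (simp add: lie_def)
  ultimately show ?thesis by blast
qed

end

section \<open>Real points\<close>

text \<open>By uniqueness the parts are those constructed in \<open>jordan_exists\<close>.\<close>

lemma jordan_commute:
  assumes "h * g = 1" "g * h = 1" "jordan g s v" "c * g = g * c"
  shows "c * s = s * c" "c * v = v * c"
  using jordan_exists[OF assms(1,2)] jordan_unique[OF assms(1,2,3)] assms(4) by metis+

text \<open>Real matrices are the fixed points of this ring automorphism, a form of reality that
  passes to Jordan parts by uniqueness.\<close>

definition mcnj :: "'n::finite sqmat \<Rightarrow> 'n sqmat" where
  "mcnj A = of_mat (\<chi> i j. cnj (mat_of A $ i $ j))"

lemma mat_of_mcnj [simp]: "mat_of (mcnj A) $ i $ j = cnj (mat_of A $ i $ j)"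
  by (simp add: mcnj_def)

lemma mcnj_mult: "mcnj (A * B) = mcnj A * mcnj B"
  and mcnj_diff: "mcnj (A - B) = mcnj A - mcnj B"
  and mcnj_scal: "mcnj (scal z) = scal (cnj z)"
  and mcnj_0 [simp]: "mcnj 0 = 0"
  and mcnj_1 [simp]: "mcnj 1 = 1"
  and mcnj_add: "mcnj (A + B) = mcnj A + mcnj B"
  by (simp_all add: sqmat_eq_iff vec_eq_iff matrix_matrix_mult_def mat_def)

lemma mcnj_sum: "mcnj (sum f I) = (\<Sum>i\<in>I. mcnj (f i))"
  by (induction I rule: infinite_finite_induct) (simp_all add: mcnj_add)

lemma mcnj_power: "mcnj (A ^ m) = mcnj A ^ m"
  by (induction m) (simp_all add: mcnj_mult)

lemma mcnj_eq_iff: "mcnj A = A \<longleftrightarrow> (\<forall>i j. mat_of A $ i $ j \<in> \<real>)"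
  by (auto simp: sqmat_eq_iff vec_eq_iff Reals_cnj_iff)

lemma semisimple_mcnj:
  assumes "semisimple s"
  shows "semisimple (mcnj s)"
proof -
  obtain L E where LE: "spectral s 1 L E"
    using assms by (auto simp: semisimple_def)
  show ?thesis
  proof (rule semisimpleI[of L _ "\<lambda>z. mcnj (E z)" cnj])
    show "mcnj s * mcnj (E z) = scal (cnj z) * mcnj (E z)" if "z \<in> L" for z
      by (simp only: mcnj_mult[symmetric] mcnj_scal[symmetric] spectral_eigen[OF LE that])
    show "(\<Sum>z\<in>L. mcnj (E z)) = 1"
      by (simp add: mcnj_sum[symmetric] spectral_sum[OF LE])
  qed (rule spectral_finite[OF LE])
qed

lemma jordan_mcnj:
  assumes "jordan g s v"
  shows "jordan (mcnj g) (mcnj s) (mcnj v)"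
proof -
  have j: "g = s * v" "s * v = v * s" "semisimple s" "nilp (v - 1)"
    using assms by (auto simp: jordan_def)
  obtain m where "(v - 1) ^ m = 0"
    using j(4) by (auto simp: nilp_def)
  then have "(mcnj v - 1) ^ m = 0"
    using mcnj_power[of "v - 1" m] by (simp add: mcnj_diff)
  then have "nilp (mcnj v - 1)"
    by (auto simp: nilp_def)
  moreover have "mcnj s * mcnj v = mcnj v * mcnj s"
    by (simp only: mcnj_mult[symmetric] j(2))
  ultimately show ?thesis
    using semisimple_mcnj[OF j(3)] by (simp add: jordan_def j(1) mcnj_mult)
qed

lemma mcnj_upow: "mcnj (upow v t) = upow (mcnj v) (cnj t)"
  by (simp add: upow_def nev_def mcnj_sum mcnj_mult mcnj_scal mcnj_power mcnj_diff gbinomial_prod_rev)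

section \<open>Translation between \<open>sqmat\<close> and the general linear group\<close>

lemma monoid_matrix_monoid: "monoid (matrix_monoid :: (complex^'n^'n) monoid)"
  by (rule monoidI) (simp_all add: matrix_monoid_def matrix_mul_assoc)

lemma group_general_linear: "group (general_linear :: (complex^'n^'n) monoid)"
  unfolding general_linear_def by (rule monoid.units_group[OF monoid_matrix_monoid])

lemma carrier_general_linear:
  "carrier (general_linear :: (complex^'n^'n) monoid) = {A. \<exists>B. B ** A = mat 1 \<and> A ** B = mat 1}"
  by (auto simp: general_linear_def units_of_def Units_def matrix_monoid_def)

lemma mult_general_linear [simp]: "mult general_linear = (**)"
  and one_general_linear [simp]: "one general_linear = mat 1"
  by (simp_all add: general_linear_def units_of_def matrix_monoid_def)

lemma pow_general_linear: "mat_of A [^]\<^bsub>general_linear\<^esub> (m :: nat) = mat_of (A ^ m)"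
  by (induction m) (simp_all add: nat_pow_def power_Suc2 del: power_Suc)

lemma pow_matrix_monoid: "mat_of A [^]\<^bsub>matrix_monoid\<^esub> (m :: nat) = mat_of (A ^ m)"
  by (induction m) (simp_all add: nat_pow_def power_Suc2 matrix_monoid_def del: power_Suc)

lemma power_map_mat_of: "power_map k (mat_of A) = mat_of (A ^ k)"
  by (simp only: power_map_def pow_general_linear)

lemma unipotent_mat_of: "unipotent (mat_of A) \<longleftrightarrow> nilp (A - 1)"
proof -
  have "unipotent (mat_of A) \<longleftrightarrow> (\<exists>m. mat_of ((A - 1) ^ m) = 0)"
    by (simp only: unipotent_def pow_matrix_monoid[symmetric] mat_of_simps)
  then show ?thesis
    by (simp add: nilp_def sqmat_eq_iff)
qed

lemma eq_mat_of_imageI: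
  assumes "\<And>a. mat_of a \<in> X \<longleftrightarrow> a \<in> Y"
  shows "X = mat_of ` Y"
proof (intro equalityI subsetI)
  fix x
  assume "x \<in> X"
  then have "of_mat x \<in> Y"
    using assms[of "of_mat x"] by simp
  then show "x \<in> mat_of ` Y"
    by (rule rev_image_eqI) simp
qed (use assms in auto)

lemma tendsto_poly_eval:
  assumes "(X \<longlongrightarrow> A) F"
  shows "((\<lambda>n. poly_eval p (X n)) \<longlongrightarrow> poly_eval p A) F"
  unfolding poly_eval_def case_prod_unfold
  by (intro tendsto_sum tendsto_mult tendsto_const tendsto_prod tendsto_power tendsto_vec_nth assms)

context
  fixes G :: "(complex^'n^'n) set"
  assumes G: "linear_algebraic_group G"
begin

lemma alg_group_mult: "A \<in> G \<Longrightarrow> B \<in> G \<Longrightarrow> A ** B \<in> G"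
  and alg_group_one: "mat 1 \<in> G"
  using G subgroup.m_closed[of G general_linear] subgroup.one_closed[of G general_linear]
  by (auto simp: linear_algebraic_group_def)

lemma alg_group_inverse: "A \<in> G \<Longrightarrow> \<exists>B\<in>G. B ** A = mat 1 \<and> A ** B = mat 1"
proof -
  assume A: "A \<in> G"
  have sub: "subgroup G general_linear"
    using G by (simp add: linear_algebraic_group_def)
  then have "A \<in> carrier general_linear"
    using A subgroup.subset by blast
  then show ?thesis
    using group.l_inv[OF group_general_linear] group.r_inv[OF group_general_linear]
      subgroup.m_inv_closed[OF sub A] by (intro bexI[of _ "inv\<^bsub>general_linear\<^esub> A"]) auto
qed

lemma alg_group_power: "mat_of a \<in> G \<Longrightarrow> mat_of (a ^ m) \<in> G"
  by (induction m) (auto intro: alg_group_one alg_group_mult)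

text \<open>The equations of \<open>G\<close> hold at all powers of \<open>g\<close>, hence at
  \<open>s ^ n * upow v t\<close>; n = 1, t = 0 gives \<open>s\<close>, and n = 0 gives the powers
  of \<open>v\<close>.\<close>

lemma alg_group_jordan:
  assumes "mat_of g \<in> G" "jordan g s v"
  shows "mat_of s \<in> G" "mat_of (upow v t) \<in> G"
proof -
  obtain S where S: "G = {A \<in> carrier general_linear. \<forall>p\<in>S. poly_eval p A = 0}"
    using G by (auto simp: linear_algebraic_group_def zariski_closed_in_GL_def)
  obtain B where B: "B ** mat_of g = mat 1" "mat_of g ** B = mat 1"
    using alg_group_inverse[OF assms(1)] by blast
  define h where "h = of_mat B"
  have h: "h * g = 1" "g * h = 1"
    using B by (simp_all add: h_def sqmat_eq_iff)
  have zero: "poly_eval p (mat_of (s ^ n * upow v t)) = 0" if "p \<in> S" for p n t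
  proof (rule jordan_poly_eval_zero[OF h(1) assms(2)])
    show "poly_eval p (mat_of (g ^ n)) = 0" for n
      using alg_group_power[OF assms(1), of n] S that by blast
  qed
  have j: "g = s * v" "s * v = v * s" "nilp (v - 1)"
    using assms(2) by (auto simp: jordan_def)
  have "v * h * s = 1"
  proof -
    have "s * (v * h) = 1"
      using h(2) j(1) by (simp add: mult.assoc)
    then show ?thesis
      by (simp only: sqmat_eq_iff mat_of_simps matrix_left_right_inverse)
  qed
  moreover have "s * (v * h) = 1"
    using h(2) j(1) by (simp add: mult.assoc)
  ultimately have "mat_of s \<in> carrier general_linear"
    unfolding carrier_general_linear by (metis (mono_tags, lifting) mat_of_simps(2,6) mem_Collect_eq)
  then show "mat_of s \<in> G"
    using zero[of _ 1 0] S by simp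
  have "upow v (- t) * upow v t = 1"
    using upow_minus[OF j(3), of "- t"] by simp
  then have "mat_of (upow v t) \<in> carrier general_linear"
    using upow_minus[OF j(3), of t] unfolding carrier_general_linear
    by (metis (mono_tags, lifting) mat_of_simps(2,6) mem_Collect_eq)
  then show "mat_of (upow v t) \<in> G"
    using zero[of _ 0 t] S by simp
qed

text \<open>The choice \<open>c = 1\<close> gives the group of real points itself, so the closure
  lemmas serve both groups at once.\<close>

definition real_centralizer :: "'n sqmat \<Rightarrow> 'n sqmat set" where
  "real_centralizer c = {a. mat_of a \<in> G \<and> mcnj a = a \<and> a * c = c * a}"

lemma real_centralizer_inverse:
  assumes "a \<in> real_centralizer c"
  shows "\<exists>b\<in>real_centralizer c. b * a = 1 \<and> a * b = 1"
proof -
  have a: "mat_of a \<in> G" "mcnj a = a" "a * c = c * a"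
    using assms by (auto simp: real_centralizer_def)
  obtain B where B: "B \<in> G" "B ** mat_of a = mat 1" "mat_of a ** B = mat 1"
    using alg_group_inverse[OF a(1)] by blast
  define b where "b = of_mat B"
  have b: "b * a = 1" "a * b = 1" "mat_of b \<in> G"
    using B by (simp_all add: b_def sqmat_eq_iff)
  have "mcnj b * a = 1"
    using mcnj_mult[of b a] by (simp add: a(2) b(1))
  then have "mcnj b = b"
    using b(2) by (metis mult.assoc mult_1 mult_1_right)
  then show ?thesis
    using b inverse_commute[OF b(1,2) a(3)] by (auto simp: real_centralizer_def)
qed

lemma real_centralizer_mult:
  assumes "a \<in> real_centralizer c" "b \<in> real_centralizer c"
  shows "a * b \<in> real_centralizer c"
proof -
  have "a * b * c = c * (a * b)"
    using assms unfolding real_centralizer_def by (metis (mono_tags, lifting) mem_Collect_eq mult.assoc)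
  then show ?thesis
    using assms by (auto simp: real_centralizer_def mcnj_mult intro: alg_group_mult)
qed

lemma real_centralizer_one: "1 \<in> real_centralizer c"
  by (simp add: real_centralizer_def alg_group_one)

lemma matrix_group_real_centralizer: "matrix_group (real_centralizer c)"
  by (rule matrix_group.intro[OF real_centralizer_one real_centralizer_mult real_centralizer_inverse])

text \<open>Conjugation fixes \<open>g\<close>, so by uniqueness it fixes both Jordan parts; these
  commute with \<open>c\<close> since \<open>g\<close> does, and a real exponent keeps
  \<open>upow\<close> real.\<close>

lemma jordan_closed_real_centralizer: "jordan_closed_group (real_centralizer c)"
proof (rule jordan_closed_group.intro[OF matrix_group_real_centralizer], unfold_locales)
  fix g s v
  assume g: "g \<in> real_centralizer c" and j: "jordan g s v"
  have g': "mat_of g \<in> G" "mcnj g = g" "c * g = g * c"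
    using g by (auto simp: real_centralizer_def)
  obtain h where h: "h * g = 1" "g * h = 1"
    using real_centralizer_inverse[OF g] by blast
  have "jordan g (mcnj s) (mcnj v)"
    using jordan_mcnj[OF j] g'(2) by simp
  then have cj: "mcnj s = s" "mcnj v = v"
    using jordan_unique[OF h _ j] by blast+
  have com: "c * s = s * c" "c * v = v * c"
    using jordan_commute[OF h j g'(3)] by blast+
  show "s \<in> real_centralizer c"
    using alg_group_jordan(1)[OF g'(1) j] cj com by (simp add: real_centralizer_def)
  show "upow v (of_real t) \<in> real_centralizer c" for t
    using alg_group_jordan(2)[OF g'(1) j] cj upow_commute[OF com(2)] by (simp add: real_centralizer_def mcnj_upow)
qed

text \<open>Polynomial equations, reality and commutation with \<open>c\<close> pass to limits, and
  invertibility of the limit is assumed.\<close>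

lemma closed_real_centralizer: "closed_matrix_group (real_centralizer c)"
proof (rule closed_matrix_group.intro[OF matrix_group_real_centralizer], unfold_locales)
  fix X :: "nat \<Rightarrow> 'n sqmat" and l b
  assume X: "\<And>n. X n \<in> real_centralizer c" "X \<longlonglongrightarrow> l" and b: "b * l = 1" "l * b = 1"
  obtain S where S: "G = {A \<in> carrier general_linear. \<forall>p\<in>S. poly_eval p A = 0}"
    using G by (auto simp: linear_algebraic_group_def zariski_closed_in_GL_def)
  have lim: "(\<lambda>n. mat_of (X n)) \<longlonglongrightarrow> mat_of l"
    by (rule bounded_linear.tendsto[OF bounded_linear_mat_of X(2)])
  have "poly_eval p (mat_of l) = 0" if "p \<in> S" for p
  proof -
    have "poly_eval p (mat_of (X n)) = 0" for n
    proof -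
      have "mat_of (X n) \<in> G"
        using X(1)[of n] by (simp add: real_centralizer_def)
      then show ?thesis
        using S that by blast
    qed
    then show ?thesis
      using tendsto_poly_eval[OF lim, of p] by (simp add: LIMSEQ_const_iff)
  qed
  moreover have "mat_of l \<in> carrier general_linear"
    using b unfolding carrier_general_linear by (metis (mono_tags, lifting) mat_of_simps(2,6) mem_Collect_eq)
  ultimately have "mat_of l \<in> G"
    using S by blast
  moreover have "mcnj l = l"
    unfolding mcnj_eq_iff
  proof (intro allI)
    fix i j
    have "mat_of (X n) $ i $ j \<in> \<real>" for n
      using X(1)[of n] mcnj_eq_iff by (auto simp: real_centralizer_def)
    moreover have "(\<lambda>n. mat_of (X n) $ i $ j) \<longlonglongrightarrow> mat_of l $ i $ j"
      by (intro tendsto_vec_nth lim)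
    ultimately show "mat_of l $ i $ j \<in> \<real>"
      by (rule closed_sequentially[OF closed_complex_Reals])
  qed
  moreover have "l * c = c * l"
  proof -
    have "X n * c = c * X n" for n
      using X(1)[of n] by (simp add: real_centralizer_def)
    then have "(\<lambda>n. c * X n) \<longlonglongrightarrow> l * c"
      using tendsto_mult_right[OF X(2), of c] by simp
    then show ?thesis
      by (rule LIMSEQ_unique[OF _ tendsto_mult_left[OF X(2)]])
  qed
  ultimately show "l \<in> real_centralizer c"
    by (simp add: real_centralizer_def)
qed

lemma real_points_mat_of: "mat_of a \<in> real_points G \<longleftrightarrow> a \<in> real_centralizer 1"
  by (simp add: real_points_def real_centralizer_def mcnj_eq_iff)

lemma centralizer_mat_of: "mat_of a \<in> centralizer (real_points G) (mat_of c) \<longleftrightarrow> a \<in> real_centralizer c"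
  by (simp add: centralizer_def real_points_def real_centralizer_def mcnj_eq_iff sqmat_eq_iff[of "a * c"])

text \<open>Density in the subspace topology is approximation within every e, and the metrics of the
  two types are Lipschitz equivalent.\<close>

lemma dense_in_centralizer_iff:
  "dense_in (power_map k ` centralizer (real_points G) (mat_of c)) (centralizer (real_points G) (mat_of c)) \<longleftrightarrow>
    (\<forall>a\<in>real_centralizer c. \<forall>e>0. \<exists>h\<in>real_centralizer c. dist (h ^ k) a < e)"
proof -
  let ?Z = "centralizer (real_points G) (mat_of c)" and ?c = "(real CARD('n))\<^sup>2"
  have Z: "?Z = mat_of ` real_centralizer c"
    by (rule eq_mat_of_imageI[OF centralizer_mat_of])
  have D: "power_map k ` ?Z = (\<lambda>h. mat_of (h ^ k)) ` real_centralizer c"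
    by (simp add: Z image_image power_map_mat_of)
  have sub: "power_map k ` ?Z \<subseteq> ?Z"
    unfolding D unfolding Z
    using matrix_group.power_closed[OF matrix_group_real_centralizer] by blast
  then have "top_of_set ?Z closure_of (power_map k ` ?Z) = ?Z \<inter> closure (power_map k ` ?Z)"
    by (simp add: closure_of_subtopology Int_absorb1 euclidean_closure_of)
  then have "dense_in (power_map k ` ?Z) ?Z \<longleftrightarrow> ?Z \<subseteq> closure (power_map k ` ?Z)"
    using sub by (auto simp: dense_in_def)
  also have "\<dots> \<longleftrightarrow> (\<forall>a\<in>real_centralizer c. \<forall>e>0. \<exists>h\<in>real_centralizer c. dist (mat_of (h ^ k)) (mat_of a) < e)"
    unfolding D unfolding Z by (auto simp: closure_approachable subset_iff)
  also have "\<dots> \<longleftrightarrow> (\<forall>a\<in>real_centralizer c. \<forall>e>0. \<exists>h\<in>real_centralizer c. dist (h ^ k) a < e)"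
  proof -
    have c: "?c > 0"
      by simp
    have "dist (mat_of A) (mat_of B) < e" if "dist A B < e / ?c" for A B :: "'n sqmat" and e
      using order.strict_trans1[OF dist_mat_of_le[of A B]] that c by (simp only: pos_less_divide_eq mult.commute[of ?c])
    moreover have "dist A B < e" if "dist (mat_of A) (mat_of B) < e / ?c" for A B :: "'n sqmat" and e
      using order.strict_trans1[OF dist_le_dist_mat_of[of A B]] that c by (simp only: pos_less_divide_eq mult.commute[of ?c])
    moreover have "e / ?c > 0" if "e > 0" for e
      using that c by (rule divide_pos_pos)
    ultimately have "(\<forall>e>0. \<exists>h\<in>real_centralizer c. dist (mat_of (h ^ k)) (mat_of a) < e) \<longleftrightarrow>
        (\<forall>e>0. \<exists>h\<in>real_centralizer c. dist (h ^ k) a < e)" for a :: "'n sqmat"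
      by (metis (no_types, lifting))
    then show ?thesis
      by simp
  qed
  finally show ?thesis .
qed

text \<open>A root of \<open>s * v\<close> in the real points has a semisimple part that is a root
  of \<open>s\<close> and commutes with \<open>v\<close>. This supplies the semisimple roots that
  \<open>powers_dense\<close> asks for.\<close>

lemma powers_surj_imp_dense:
  assumes k: "k \<ge> 1" and surj: "\<And>g. g \<in> real_centralizer 1 \<Longrightarrow> \<exists>h\<in>real_centralizer 1. h ^ k = g"
    and v: "v \<in> real_centralizer 1" "nilp (v - 1)" and a: "a \<in> real_centralizer v" "e > 0"
  shows "\<exists>h\<in>real_centralizer v. dist (h ^ k) a < e"
proof (rule jordan_closed_group.powers_dense[OF jordan_closed_real_centralizer k _ a])
  fix s
  assume s: "s \<in> real_centralizer v" "semisimple s"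
  have sv: "s * v = v * s"
    using s(1) by (simp add: real_centralizer_def)
  have j: "jordan (s * v) s v"
    using s(2) v(2) sv by (simp add: jordan_def)
  have "s \<in> real_centralizer 1"
    using s(1) by (simp add: real_centralizer_def)
  then have "s * v \<in> real_centralizer 1"
    using v(1) by (rule real_centralizer_mult)
  then obtain h where h: "h \<in> real_centralizer 1" "h ^ k = s * v"
    using surj by blast
  obtain h' where h': "h' * h = 1" "h * h' = 1"
    using real_centralizer_inverse[OF h(1)] by blast
  obtain g' where g': "g' * (s * v) = 1" "s * v * g' = 1"
    using real_centralizer_inverse[OF \<open>s * v \<in> real_centralizer 1\<close>] by blast
  obtain t w where tw: "jordan h t w"
    using jordan_exists[OF h'] by metis
  have "jordan (s * v) (t ^ k) (w ^ k)"
    using jordan_power[OF tw, of k] h(2) by simp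
  then have "t ^ k = s"
    using jordan_unique(1)[OF g' _ j] by blast
  \<comment> \<open>A root commutes with its power, so \<open>h\<close> commutes with the unipotent
    part \<open>v\<close> of that power, and then so does the semisimple part \<open>t\<close> of
    \<open>h\<close>.\<close>
  have "h * (s * v) = s * v * h"
    unfolding h(2)[symmetric] by (simp add: power_commutes)
  then have "h * v = v * h"
    by (rule jordan_commute(2)[OF g' j])
  then have "v * t = t * v"
    using jordan_commute(1)[OF h' tw] by metis
  moreover have "t \<in> real_centralizer 1"
    by (rule jordan_closed_group.jordan_closed[OF jordan_closed_real_centralizer h(1) tw])
  ultimately have "t \<in> real_centralizer v"
    by (simp add: real_centralizer_def)
  moreover have "semisimple t"
    using tw by (simp add: jordan_def)
  ultimately show "\<exists>h\<in>real_centralizer v. semisimple h \<and> h ^ k = s"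
    using \<open>t ^ k = s\<close> by blast
qed

text \<open>Density in the centralizer of the unipotent part \<open>v\<close> gives an exact root of
  \<open>s\<close> commuting with \<open>v\<close>; multiplied by \<open>v\<close> to the power 1 /
  k it is a root of \<open>g\<close>.\<close>

lemma dense_imp_powers_surj:
  assumes k: "k \<ge> 1"
    and dense: "\<And>v a e. v \<in> real_centralizer 1 \<Longrightarrow> nilp (v - 1) \<Longrightarrow> a \<in> real_centralizer v \<Longrightarrow> e > 0 \<Longrightarrow>
      \<exists>h\<in>real_centralizer v. dist (h ^ k) a < e"
    and g: "g \<in> real_centralizer 1"
  shows "\<exists>h\<in>real_centralizer 1. h ^ k = g"
proof -
  obtain g' where g': "g' * g = 1" "g * g' = 1"
    using real_centralizer_inverse[OF g] by blast
  obtain s v where j: "jordan g s v"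
    using jordan_exists[OF g'] by metis
  have jd: "g = s * v" "s * v = v * s" "semisimple s" "nilp (v - 1)"
    using j by (auto simp: jordan_def)
  have s: "s \<in> real_centralizer 1" and vt: "\<And>t :: real. upow v (of_real t) \<in> real_centralizer 1"
    using jordan_closed_group.jordan_closed[OF jordan_closed_real_centralizer g j]
      jordan_closed_group.upow_closed[OF jordan_closed_real_centralizer g j] by blast+
  have v: "v \<in> real_centralizer 1"
    using vt[of 1] by simp
  have "s \<in> real_centralizer v"
    using s jd(2) by (simp add: real_centralizer_def)
  then obtain h where h: "h \<in> real_centralizer v" "h ^ k = s"
    using closed_matrix_group.semisimple_power_of_dense[OF closed_real_centralizer k _ jd(3)] dense[OF v jd(4)]
    by blast
  let ?u = "upow v (of_real (1 / real k))"
  have "h * v = v * h" "h \<in> real_centralizer 1"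
    using h(1) by (simp_all add: real_centralizer_def)
  then have "h * ?u = ?u * h" "h * ?u \<in> real_centralizer 1"
    using upow_commute real_centralizer_mult vt by blast+
  moreover have "?u ^ k = upow v (of_nat k * of_real (1 / real k))"
    by (rule upow_of_nat_mult[OF jd(4), symmetric])
  then have "?u ^ k = v"
    using k by simp
  ultimately show ?thesis
    using commuting_power_distrib[of h ?u k] h(2) jd(1) by metis
qed

end

theorem corollary1p2:
  fixes G :: "(complex^'n^'n) set" and k :: nat
  assumes "linear_algebraic_group G"
    and "defined_over_reals G"
    and "k \<ge> 1"
  shows "power_map k ` real_points G = real_points G \<longleftrightarrow>
    (\<forall>u\<in>real_points G. unipotent u \<longrightarrow>
       dense_in (power_map k ` centralizer (real_points G) u) (centralizer (real_points G) u))"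
proof -
  note G = assms(1)
  let ?R = "real_centralizer G 1"
  have R: "real_points G = mat_of ` ?R"
    by (rule eq_mat_of_imageI[OF real_points_mat_of[OF G]])
  have "power_map k ` real_points G = mat_of ` (\<lambda>h. h ^ k) ` ?R"
    unfolding R image_image power_map_mat_of ..
  then have "power_map k ` real_points G = real_points G \<longleftrightarrow> (\<lambda>h. h ^ k) ` ?R = ?R"
    unfolding R by (simp add: inj_image_eq_iff inj_on_def sqmat_eq_iff)
  also have "\<dots> \<longleftrightarrow> (\<forall>g\<in>?R. \<exists>h\<in>?R. h ^ k = g)"
  proof -
    have sub: "(\<lambda>h. h ^ k) ` ?R \<subseteq> ?R"
      using matrix_group.power_closed[OF matrix_group_real_centralizer[OF G]] by blast
    have "(\<lambda>h. h ^ k) ` ?R = ?R \<longleftrightarrow> ?R \<subseteq> (\<lambda>h. h ^ k) ` ?R"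
      by (simp only: set_eq_subset sub simp_thms)
    also have "\<dots> \<longleftrightarrow> (\<forall>g\<in>?R. \<exists>h\<in>?R. h ^ k = g)"
      unfolding subset_eq by (intro ball_cong refl) auto
    finally show ?thesis .
  qed
  \<comment> \<open>The equivalence proper; the other links of the chain translate between the two
    matrix types.\<close>
  also have "\<dots> \<longleftrightarrow> (\<forall>v\<in>?R. nilp (v - 1) \<longrightarrow>
      (\<forall>a\<in>real_centralizer G v. \<forall>e>0. \<exists>h\<in>real_centralizer G v. dist (h ^ k) a < e))"
    (is "?surj \<longleftrightarrow> ?dense")
  proof
    show ?dense if ?surj
      using powers_surj_imp_dense[OF G assms(3)] that by blast
    show ?surj if ?dense
      using dense_imp_powers_surj[OF G assms(3)] that by blast
  qed
  also have "\<dots> \<longleftrightarrow> (\<forall>u\<in>real_points G. unipotent u \<longrightarrow>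
       dense_in (power_map k ` centralizer (real_points G) u) (centralizer (real_points G) u))"
  proof -
    have "(\<forall>u\<in>real_points G. P u) \<longleftrightarrow> (\<forall>v\<in>?R. P (mat_of v))" for P
      unfolding R by blast
    then show ?thesis
      by (simp only: unipotent_mat_of dense_in_centralizer_iff[OF G])
  qed
  finally show ?thesis .
qed

end
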